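(* Let $F\in C_{rd}(\overline\Omega\times\mathbb{R}^4,\mathbb{R})$, $G\in C_{rd}(\overline\Omega\times I\times\mathbb{R}^3,\mathbb{R})$, and let $\alpha,\beta$ be real-valued rd-continuous boundary data, $\alpha=\alpha(x,z)$ and $\beta=\beta(y,z)$, with delta derivatives $\alpha^{\Delta}$ (in $x$) and $\beta^{\Delta}$ (in $y$), and $\alpha(x_0,z)=\beta(y_0,z)$ for $z\in I$. Consider the problem $$u^{\Delta_2\Delta_1}(x,y,z)=F\big(x,y,z,u(x,y,z),u^{\Delta_1}(x,y,z),u^{\Delta_2}(x,y,z),(Hu)(x,y,z)\big),$$ $$u(x,y_0,z)=\alpha(x,z),\qquad u(x_0,y,z)=\beta(y,z),$$ for $(x,y,z)\in\overline\Omega$, where $$(Hu)(x,y,z)=\int_a^b G\big(x,y,z,q,u(x,y,q),u^{\Delta_1}(x,y,q),u^{\Delta_2}(x,y,q)\big)\,\Delta q .$$ Suppose there are $M\in C_{rd}(\overline\Omega,\mathbb{R}_+)$ and $K\in C_{rd}(\overline\Omega\times I,\mathbb{R}_+)$ such that, for all values of the arguments, $$|F(x,y,z,u_1,u_2,u_3,u_4)-F(x,y,z,\overline u_1,\overline u_2,\overline u_3,\overline u_4)|\le M(x,y,z)\sum_{i=1}^4|u_i-\overline u_i|,$$ $$|G(x,y,z,q,u_1,u_2,u_3)-G(x,y,z,q,\overline u_1,\overline u_2,\overline u_3)|\le K(x,y,z,q)\sum_{i=1}^3|u_i-\overline u_i|.$$ Suppose that, for the constant $\lambda>0$ used in the definition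 of the space $S$, there are nonnegative constants $\gamma_1,\gamma_2,\gamma_3$ such that for all $(x,y)\in\Omega$, $z\in I$, $$\int_{x_0}^x\int_{y_0}^y M(s,t,z)\Big[e_\lambda(s,t,|z|)+\int_a^b K(s,t,z,q)e_\lambda(s,t,|q|)\Delta q\Big]\Delta t\,\Delta s\le\gamma_1e_\lambda(x,y,|z|),$$ $$\int_{y_0}^y M(x,t,z)\Big[e_\lambda(x,t,|z|)+\int_a^b K(x,t,z,q)e_\lambda(x,t,|q|)\Delta q\Big]\Delta t\le\gamma_2e_\lambda(x,y,|z|),$$ $$\int_{x_0}^x M(s,y,z)\Big[e_\lambda(s,y,|z|)+\int_a^b K(s,y,z,q)e_\lambda(s,y,|q|)\Delta q\Big]\Delta s\le\gamma_3e_\lambda(x,y,|z|).$$ Suppose also that there are nonnegative constants $\eta_1,\eta_2,\eta_3$ such that for all $(x,y)\in\Omega$, $z\in I$, $$|\alpha(x,z)|+|\beta(y,z)|+|\alpha(x_0,z)|+\int_{x_0}^x\int_{y_0}^y|F(s,t,z,0,0,0,(H0)(s,t,z))|\Delta t\,\Delta s\le\eta_1e_\lambda(x,y,|z|),$$ $$|\alpha^{\Delta}(x,z)|+\int_{y_0}^y|F(x,t,z,0,0,0,(H0)(x,t,z))|\Delta t\le\eta_2e_\lambda(x,y,|z|),$$ $$|\beta^{\Delta}(y,z)|+\int_{x_0}^x|F(s,y,z,0,0,0,(H0)(s,y,z))|\Delta s\le\eta_3e_\lambda(x,y,|z|),$$ where $H0$ denotes $Hu$ for $u\equiv0$. If $\gamma=\gamma_1+\gamma_2+\gamma_3<1$,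 then the problem has a unique solution $u(x,y,z)$ in $S$.
   Context: $\mathbb{T}_1,\mathbb{T}_2$ are time scales (nonempty closed subsets of $\mathbb{R}$) with at least two points, $x_0\in\mathbb{T}_1$, $y_0\in\mathbb{T}_2$, and $\Omega=\{(x,y)\in\mathbb{T}_1\times\mathbb{T}_2: x\ge x_0,\ y\ge y_0\}$. $I=[a,b]$ with $a<b$, and $\overline\Omega=\Omega\times I$. $\mathbb{R}_+=[0,\infty)$. $\int\cdot\,\Delta s$ and $\int\cdot\,\Delta t$ are delta integrals on $\mathbb{T}_1$ and $\mathbb{T}_2$; $\int_a^b\cdot\,\Delta q$ is the integral over $I$ (the ordinary integral, $I$ being a real interval). $C_{rd}(A,B)$ denotes the rd-continuous functions from $A$ to $B$, in the standard sense of time scale calculus with respect to the time-scale variables (continuity at right-dense points, finite one-sided limits at left-dense points), jointly with continuity in the real variables. $u^{\Delta_1},u^{\Delta_2}$ are the delta partial derivatives of $u(x,y,z)$ with respect to $x\in\mathbb{T}_1$ and $y\in\mathbb{T}_2$, and $u^{\Delta_2\Delta_1}=u^{\Delta_1\Delta_2}$ is the mixed delta derivative. For $u,u^{\Delta_1},u^{\Delta_2}\in C_{rd}(\overline\Omega,\mathbb{R})$ put $|u(x,y,z)|_W=|u(x,y,z)|+|u^{\Delta_1}(x,y,z)|+|u^{\Delta_2}(x,y,z)|$. $\lambda>0$ is a fixed constant and $e_\lambda(x,y,|z|)$ is a fixed exponential-type weight on $\overline\Omega$, i.e. a continuous, strictly positive function of $(x,y,|z|)$; $e_{\ominus\lambda}(x,y,|z|)=1/e_\lambda(x,y,|z|)$.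 $S$ is the space of functions $u$ with $u,u^{\Delta_1},u^{\Delta_2}\in C_{rd}(\overline\Omega,\mathbb{R})$ for which there is a constant $N\ge0$ with $|u(x,y,z)|_W\le N e_\lambda(x,y,|z|)$ on $\overline\Omega$; it is a Banach space with the norm $|u|_S=\sup_{(x,y,z)\in\overline\Omega}|u(x,y,z)|_W\,e_{\ominus\lambda}(x,y,|z|)$. A solution of the problem is a function $u\in C_{rd}(\overline\Omega,\mathbb{R})$ (with the delta derivatives that occur) satisfying the equation and the two boundary conditions.
   Formalization: The delta derivatives of α and β are also assumed rd-continuous (any solution in S forces this), and rd-continuity is taken to include continuity at a left-dense maximum of a time scale; without these the claim can fail. *)

theory Defs
  imports "HOL-Analysis.Analysis"
begin

section \<open>Delta calculus on a time scale\<close>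

definition time_scale :: "real set \<Rightarrow> bool" where
  "time_scale T \<longleftrightarrow> closed T \<and> T \<noteq> {}"

text \<open>Forward and backward jump, with the usual conventions that a maximum is mapped
  to itself by \<open>\<sigma>\<close> and a minimum is mapped to itself by \<open>\<rho>\<close>.\<close>

definition sigma :: "real set \<Rightarrow> real \<Rightarrow> real" where
  "sigma T t = (if \<exists>s\<in>T. t < s then Inf {s\<in>T. t < s} else t)"

definition rho :: "real set \<Rightarrow> real \<Rightarrow> real" where
  "rho T t = (if \<exists>s\<in>T. s < t then Sup {s\<in>T. s < t} else t)"

text \<open>A maximum counts as right-dense. Hence rd-continuity includes continuity at a left-dense
  maximum, without which an rd-continuous function need not be a delta derivative there.\<close>

definition right_dense :: "real set \<Rightarrow> real \<Rightarrow> bool" where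
  "right_dense T t \<longleftrightarrow> sigma T t = t"

definition left_dense :: "real set \<Rightarrow> real \<Rightarrow> bool" where
  "left_dense T t \<longleftrightarrow> (\<exists>s\<in>T. s < t) \<and> rho T t = t"

text \<open>\<open>T\<close> without its maximum if that maximum is not left-dense. For a time scale with at least
  two points this is the usual \<open>T\<^sup>\<kappa>\<close>; for a singleton it is empty.\<close>

definition kappa :: "real set \<Rightarrow> real set" where
  "kappa T = {t\<in>T. (\<exists>s\<in>T. t < s) \<or> left_dense T t}"

definition has_delta_derivative ::
    "real set \<Rightarrow> (real \<Rightarrow> real) \<Rightarrow> real \<Rightarrow> real \<Rightarrow> bool" where
  "has_delta_derivative T f D t \<longleftrightarrow>
     t \<in> kappa T \<and>
     (\<forall>\<epsilon>>0. \<exists>\<delta>>0. \<forall>s\<in>T. \<bar>s - t\<bar> < \<delta> \<longrightarrow>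
        \<bar>f (sigma T t) - f s - D * (sigma T t - s)\<bar> \<le> \<epsilon> * \<bar>sigma T t - s\<bar>)"

text \<open>Outside \<open>T\<^sup>\<kappa>\<close>, where no delta derivative is defined, the value is \<open>0\<close> by convention.\<close>

definition delta_deriv :: "real set \<Rightarrow> (real \<Rightarrow> real) \<Rightarrow> real \<Rightarrow> real" where
  "delta_deriv T f t = (if t \<in> kappa T then (THE D. has_delta_derivative T f D t) else 0)"

text \<open>The Cauchy delta integral: the increment of an antiderivative on \<open>T\<close>.\<close>

definition delta_integral :: "real set \<Rightarrow> real \<Rightarrow> real \<Rightarrow> (real \<Rightarrow> real) \<Rightarrow> real" where
  "delta_integral T r s f =
     (THE v. \<exists>\<Phi>. (\<forall>t\<in>kappa T. has_delta_derivative T \<Phi> (f t) t) \<and> v = \<Phi> s - \<Phi> r)"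


section \<open>Rd-continuity\<close>

text \<open>The ways of approaching \<open>t\<close> along which an rd-continuous function has a finite limit: within
  all of \<open>T\<close> if \<open>t\<close> is right-dense, strictly from the left if \<open>t\<close> is left-dense. The sets of
  the first filter all contain \<open>t\<close>, so a limit along it is necessarily the value at \<open>t\<close>: its
  existence says that the function is continuous at \<open>t\<close>, and nothing in the variable \<open>t\<close> if \<open>t\<close> is
  right-scattered.\<close>

definition rd_filters :: "real set \<Rightarrow> real \<Rightarrow> real filter set" where
  "rd_filters T t =
     {if right_dense T t then inf (nhds t) (principal T) else principal {t}}
     \<union> (if left_dense T t then {at t within (T \<inter> {..<t})} else {})"

text \<open>Functions of one or two time-scale variables and of real variables ranging over \<open>W\<close>; the
  limits are joint in all the variables.\<close>

definition rd_continuous ::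
    "real set \<Rightarrow> 'w::topological_space set \<Rightarrow> (real \<Rightarrow> 'w \<Rightarrow> real) \<Rightarrow> bool" where
  "rd_continuous T W f \<longleftrightarrow>
     (\<forall>t\<in>T. \<forall>w\<in>W. \<forall>A\<in>rd_filters T t.
        \<exists>l. ((\<lambda>(s, v). f s v) \<longlongrightarrow> l) (prod_filter A (inf (nhds w) (principal W))))"

definition rd_continuous2 ::
    "real set \<Rightarrow> real set \<Rightarrow> 'w::topological_space set \<Rightarrow> (real \<Rightarrow> real \<Rightarrow> 'w \<Rightarrow> real) \<Rightarrow> bool"
  where
  "rd_continuous2 X Y W f \<longleftrightarrow>
     (\<forall>x\<in>X. \<forall>y\<in>Y. \<forall>w\<in>W. \<forall>A\<in>rd_filters X x. \<forall>B\<in>rd_filters Y y.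
        \<exists>l. ((\<lambda>(s, t, v). f s t v) \<longlongrightarrow> l)
              (prod_filter A (prod_filter B (inf (nhds w) (principal W)))))"


section \<open>The boundary value problem\<close>

text \<open>Below, \<open>X\<close> and \<open>Y\<close> are the parts of the two time scales to the right of \<open>x\<^sub>0\<close> and \<open>y\<^sub>0\<close>;
  since \<open>u\<close> lives on \<open>X \<times> Y \<times> [a, b]\<close> only, its delta derivatives are taken on \<open>X\<close> and \<open>Y\<close>.\<close>

definition pdelta1 ::
    "real set \<Rightarrow> (real \<Rightarrow> real \<Rightarrow> real \<Rightarrow> real) \<Rightarrow> real \<Rightarrow> real \<Rightarrow> real \<Rightarrow> real" where
  "pdelta1 X u x y z = delta_deriv X (\<lambda>s. u s y z) x"

definition pdelta2 ::
    "real set \<Rightarrow> (real \<Rightarrow> real \<Rightarrow> real \<Rightarrow> real) \<Rightarrow> real \<Rightarrow> real \<Rightarrow> real \<Rightarrow> real" where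
  "pdelta2 Y u x y z = delta_deriv Y (\<lambda>t. u x t z) y"

definition delta_differentiable ::
    "real set \<Rightarrow> real set \<Rightarrow> real set \<Rightarrow> (real \<Rightarrow> real \<Rightarrow> real \<Rightarrow> real) \<Rightarrow> bool" where
  "delta_differentiable X Y I u \<longleftrightarrow>
     (\<forall>x\<in>kappa X. \<forall>y\<in>Y. \<forall>z\<in>I. \<exists>D. has_delta_derivative X (\<lambda>s. u s y z) D x) \<and>
     (\<forall>x\<in>X. \<forall>y\<in>kappa Y. \<forall>z\<in>I. \<exists>D. has_delta_derivative Y (\<lambda>t. u x t z) D y)"

definition W_abs ::
    "real set \<Rightarrow> real set \<Rightarrow> (real \<Rightarrow> real \<Rightarrow> real \<Rightarrow> real) \<Rightarrow> real \<Rightarrow> real \<Rightarrow> real \<Rightarrow> real" where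
  "W_abs X Y u x y z = \<bar>u x y z\<bar> + \<bar>pdelta1 X u x y z\<bar> + \<bar>pdelta2 Y u x y z\<bar>"

definition S_space ::
    "real set \<Rightarrow> real set \<Rightarrow> real set \<Rightarrow> (real \<Rightarrow> real \<Rightarrow> real \<Rightarrow> real)
      \<Rightarrow> (real \<Rightarrow> real \<Rightarrow> real \<Rightarrow> real) set" where
  "S_space X Y I e =
     {u. delta_differentiable X Y I u \<and>
         rd_continuous2 X Y I u \<and>
         rd_continuous2 X Y I (pdelta1 X u) \<and>
         rd_continuous2 X Y I (pdelta2 Y u) \<and>
         (\<exists>N\<ge>0. \<forall>x\<in>X. \<forall>y\<in>Y. \<forall>z\<in>I. W_abs X Y u x y z \<le> N * e x y \<bar>z\<bar>)}"

definition H_op ::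
    "real set \<Rightarrow> real set \<Rightarrow> real \<Rightarrow> real
      \<Rightarrow> (real \<Rightarrow> real \<Rightarrow> real \<Rightarrow> real \<Rightarrow> real \<Rightarrow> real \<Rightarrow> real \<Rightarrow> real)
      \<Rightarrow> (real \<Rightarrow> real \<Rightarrow> real \<Rightarrow> real) \<Rightarrow> real \<Rightarrow> real \<Rightarrow> real \<Rightarrow> real" where
  "H_op X Y a b G u x y z =
     integral {a..b} (\<lambda>q. G x y z q (u x y q) (pdelta1 X u x y q) (pdelta2 Y u x y q))"

text \<open>Both iterated derivatives \<open>(u\<^sup>\<Delta>\<^sup>2)\<^sup>\<Delta>\<^sup>1\<close> and \<open>(u\<^sup>\<Delta>\<^sup>1)\<^sup>\<Delta>\<^sup>2\<close> exist and equal the right-hand side.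
  The equation is imposed where these derivatives are defined.\<close>

definition is_solution ::
    "real set \<Rightarrow> real set \<Rightarrow> real \<Rightarrow> real \<Rightarrow> real \<Rightarrow> real
      \<Rightarrow> (real \<Rightarrow> real \<Rightarrow> real \<Rightarrow> real \<Rightarrow> real \<Rightarrow> real \<Rightarrow> real \<Rightarrow> real)
      \<Rightarrow> (real \<Rightarrow> real \<Rightarrow> real \<Rightarrow> real \<Rightarrow> real \<Rightarrow> real \<Rightarrow> real \<Rightarrow> real)
      \<Rightarrow> (real \<Rightarrow> real \<Rightarrow> real) \<Rightarrow> (real \<Rightarrow> real \<Rightarrow> real)
      \<Rightarrow> (real \<Rightarrow> real \<Rightarrow> real \<Rightarrow> real) \<Rightarrow> bool" where
  "is_solution X Y a b x0 y0 F G \<alpha> \<beta> u \<longleftrightarrow>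
     rd_continuous2 X Y {a..b} u \<and>
     delta_differentiable X Y {a..b} u \<and>
     (\<forall>x\<in>kappa X. \<forall>y\<in>kappa Y. \<forall>z\<in>{a..b}.
        (let rhs = F x y z (u x y z) (pdelta1 X u x y z) (pdelta2 Y u x y z)
                     (H_op X Y a b G u x y z)
         in has_delta_derivative X (\<lambda>s. pdelta2 Y u s y z) rhs x \<and>
            has_delta_derivative Y (\<lambda>t. pdelta1 X u x t z) rhs y)) \<and>
     (\<forall>x\<in>X. \<forall>z\<in>{a..b}. u x y0 z = \<alpha> x z) \<and>
     (\<forall>y\<in>Y. \<forall>z\<in>{a..b}. u x0 y z = \<beta> y z)"

end

theory Submission
  imports Defs
begin

text \<open>A solution is determined by its mixed derivative \<open>f\<close>: it is the sum of the boundary data and the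
  iterated delta integral of \<open>f\<close>. Inserting this function and its partial derivatives into the
  right-hand side turns the problem into a fixed-point equation for \<open>f\<close>, which is solved by Picard
  iteration starting from \<open>F(\<cdot>, 0, 0, 0, H0)\<close>. If two candidates differ by at most
  \<open>c\<close> times \<open>M (e + \<integral> K e)\<close>, then the functions they generate differ by at most \<open>c \<gamma> e\<close> in the
  norm of \<open>S\<close>, and by the Lipschitz conditions the new right-hand sides by at most \<open>c \<gamma> M (e + \<integral> K e)\<close>.
  This contraction gives existence and uniqueness. Both orders of differentiation are recovered from one
  iterated integral by differentiating under the integral sign, which requires rd-continuity to be uniform on
  compact parts of the scales: the approach filters of a point together cover a neighbourhood of it, so
  Heine-Borel applies although an rd-continuous function need not be continuous.\<close>

section \<open>Limits along filters in Cauchy form\<close>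

text \<open>The unknown is the mixed derivative rather than \<open>u\<close>, because
  differentiability of a limit of functions would need an argument of its own. Here every iterate
  comes with explicit derivatives, the sequences for \<open>u\<close> and its two derivatives
  converge separately, and their limits are afterwards recognised as belonging to one function.
  Completeness of \<open>S\<close> is thereby replaced by geometric convergence of real sequences at
  each point, measured in units of the weight.

  The obstacle is rd-continuity. At a point that is left-dense and right-scattered, the limit from
  the left may differ from the value, so a limit cannot be named through the function. Limits are
  therefore used in Cauchy form, as small oscillation on an event of the filter, a form that passes
  through integrals and uniform limits.

  The delta integral is a definite description. It has a usable value only once antiderivatives are
  known to exist, by way of an ordinary integral, and to be unique up to constants, by way of a
  monotonicity theorem proved by induction along the scale.\<close>

lemma convergent_along_iff_cauchy:
  fixes f :: "'a \<Rightarrow> real"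
  shows "(\<exists>l. (f \<longlongrightarrow> l) F) \<longleftrightarrow>
    (\<forall>\<epsilon>>0. \<exists>P. eventually P F \<and> (\<forall>x y. P x \<longrightarrow> P y \<longrightarrow> \<bar>f x - f y\<bar> < \<epsilon>))"
    (is "?L \<longleftrightarrow> ?R")
proof -
  have "?L \<longleftrightarrow> cauchy_filter (filtermap f F)"
  proof
    assume ?L
    then show "cauchy_filter (filtermap f F)"
      using nhds_imp_cauchy_filter unfolding filterlim_def by blast
  next
    assume c: "cauchy_filter (filtermap f F)"
    show ?L
    proof (cases "F = bot")
      case False
      then have "\<exists>l\<in>UNIV. filtermap f F \<le> nhds l"
        using complete_UNIV[where 'a=real] c unfolding complete_uniform
        by (elim allE[of _ "filtermap f F"]) (simp add: filtermap_bot_iff)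
      then show ?thesis by (simp add: filterlim_def)
    qed simp
  qed
  then show ?thesis by (simp add: cauchy_filter_metric_filtermap dist_real_def imp_conjL)
qed

text \<open>A tube lemma for filters: each point of \<open>C\<close> has a neighbourhood that is
  served by a single event of \<open>E\<close>, and a finite subcover leaves finitely many events to
  intersect. With pairs of parameters for \<open>E\<close> it yields uniform oscillation bounds,
  with \<open>at_top\<close> it yields boundedness.\<close>

lemma eventually_ball_compact:
  assumes C: "compact C"
    and loc: "\<And>t. t \<in> C \<Longrightarrow>
      eventually (\<lambda>(z, s). \<Phi> z s) (prod_filter E (inf (nhds t) (principal C)))"
  shows "eventually (\<lambda>z. \<forall>t\<in>C. \<Phi> z t) E"
proof -
  have "\<exists>U. open U \<and> t \<in> U \<and> eventually (\<lambda>z. \<forall>s\<in>U \<inter> C. \<Phi> z s) E" if tC: "t \<in> C" for t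
  proof -
    obtain P Q where P: "eventually P E" and Q: "eventually Q (inf (nhds t) (principal C))"
        and PQ: "\<And>z s. P z \<Longrightarrow> Q s \<Longrightarrow> \<Phi> z s"
      using loc[OF tC] unfolding eventually_prod_filter by auto
    obtain U where U: "open U" "t \<in> U" "\<forall>s\<in>U. s \<in> C \<longrightarrow> Q s"
      using Q unfolding eventually_inf_principal eventually_nhds by blast
    have "eventually (\<lambda>z. \<forall>s\<in>U \<inter> C. \<Phi> z s) E"
      using P by eventually_elim (use PQ U in blast)
    with U show ?thesis by blast
  qed
  then obtain U where U: "\<And>t. t \<in> C \<Longrightarrow> open (U t)" "\<And>t. t \<in> C \<Longrightarrow> t \<in> U t"
      "\<And>t. t \<in> C \<Longrightarrow> eventually (\<lambda>z. \<forall>s\<in>U t \<inter> C. \<Phi> z s) E"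
    by metis
  have "C \<subseteq> (\<Union>t\<in>C. U t)" using U(2) by blast
  then obtain D where D: "D \<subseteq> C" "finite D" "C \<subseteq> (\<Union>t\<in>D. U t)"
    using compactE_image[OF C, of C U] U(1) by blast
  have "eventually (\<lambda>z. \<forall>t\<in>D. \<forall>s\<in>U t \<inter> C. \<Phi> z s) E"
    using D U(3) by (subst eventually_ball_finite_distrib) auto
  then show ?thesis
    by eventually_elim (use D(3) in blast)
qed


section \<open>Approach filters of a time scale\<close>

lemma sigma_ge: "t \<le> sigma T t"
  unfolding sigma_def by (auto intro!: cInf_greatest)

lemma sigma_le: "s \<in> T \<Longrightarrow> t < s \<Longrightarrow> sigma T t \<le> s"
  unfolding sigma_def by (auto intro!: cInf_lower bdd_belowI[of _ t])

lemma sigma_mem: "closed T \<Longrightarrow> t \<in> T \<Longrightarrow> sigma T t \<in> T"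
proof (cases "\<exists>s\<in>T. t < s")
  case True
  assume "closed T" "t \<in> T"
  have "Inf {s \<in> T. t < s} \<in> closure {s \<in> T. t < s}"
    using True by (intro closure_contains_Inf bdd_belowI[of _ t]) auto
  also have "\<dots> \<subseteq> closure T" by (rule closure_mono) auto
  finally show ?thesis using True \<open>closed T\<close> by (simp add: sigma_def)
qed (simp add: sigma_def)

lemma rho_le: "rho T t \<le> t"
  unfolding rho_def by (auto intro!: cSup_least)

lemma le_rho: "s \<in> T \<Longrightarrow> s < t \<Longrightarrow> s \<le> rho T t"
  unfolding rho_def by (auto intro!: cSup_upper bdd_aboveI[of _ t])

text \<open>The point \<open>s\<close> is required because a maximum counts as right-dense although
  nothing of \<open>T\<close> lies to its right.\<close>

lemma right_dense_near:
  assumes "right_dense T t" "s \<in> T" "t < s" "0 < \<delta>"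
  shows "\<exists>r\<in>T. t < r \<and> r < t + \<delta>"
proof (rule ccontr)
  assume "\<not> ?thesis"
  then have "t + \<delta> \<le> Inf {r\<in>T. t < r}" using assms by (intro cInf_greatest) force+
  then show False using assms by (auto simp: right_dense_def sigma_def split: if_splits)
qed

lemma left_dense_near:
  assumes "left_dense T t" "0 < \<delta>"
  shows "\<exists>r\<in>T. t - \<delta> < r \<and> r < t"
proof (rule ccontr)
  assume n: "\<not> ?thesis"
  obtain s where s: "s \<in> T" "s < t" "rho T t = t" using assms by (auto simp: left_dense_def)
  then have "Sup {r\<in>T. r < t} \<le> t - \<delta>" using n by (intro cSup_least) force+
  then show False using s assms by (auto simp: rho_def split: if_splits)
qed

lemma left_denseI:
  assumes "\<And>\<delta>. 0 < \<delta> \<Longrightarrow> \<exists>r\<in>T. t - \<delta> < r \<and> r < t"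
  shows "left_dense T t"
proof -
  obtain s where s: "s \<in> T" "s < t" using assms[of 1] by auto
  have "\<not> rho T t < t"
  proof
    assume "rho T t < t"
    then obtain r where "r \<in> T" "rho T t < r" "r < t" using assms[of "t - rho T t"] by auto
    then show False using le_rho[of r T t] by simp
  qed
  then show ?thesis using rho_le[of T t] s by (auto simp: left_dense_def)
qed

lemma rd_filters_le:
  assumes "t \<in> T" "A \<in> rd_filters T t"
  shows "A \<le> inf (nhds t) (principal T)"
proof -
  have "principal {t} \<le> inf (nhds t) (principal T)"
    using assms(1) by (auto simp: le_filter_def eventually_inf_principal eventually_principal
        dest: eventually_nhds_x_imp_x)
  moreover have "at t within (T \<inter> {..<t}) \<le> inf (nhds t) (principal T)"
    unfolding at_within_def by (rule inf_mono) auto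
  ultimately show ?thesis using assms(2) by (auto simp: rd_filters_def split: if_splits)
qed

lemma eventually_rd_filters:
  "t \<in> T \<Longrightarrow> A \<in> rd_filters T t \<Longrightarrow> eventually P (inf (nhds t) (principal T)) \<Longrightarrow> eventually P A"
  using rd_filters_le le_filter_def by blast

lemma eventually_rd_filters_mem:
  "t \<in> T \<Longrightarrow> A \<in> rd_filters T t \<Longrightarrow> eventually (\<lambda>s. s \<in> T) A"
  by (rule eventually_rd_filters) (auto simp: eventually_inf_principal)

lemma eventually_rd_filters_near:
  assumes "t \<in> T" "A \<in> rd_filters T t" "0 < \<delta>"
  shows "eventually (\<lambda>s. \<bar>s - t\<bar> < \<delta>) A"
proof -
  have "eventually (\<lambda>s. \<bar>s - t\<bar> < \<delta>) (nhds t)"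
    using assms(3) by (auto simp: eventually_nhds_metric dist_real_def)
  then show ?thesis by (intro eventually_rd_filters[OF assms(1,2)]) (simp add: eventually_inf_principal eventually_mono)
qed

text \<open>The first approach filter of a point always sees the point itself. Choosing it freezes a
  variable at \<open>t\<close>, which turns joint limits into limits of sections.\<close>

lemma rd_filters_point:
  assumes "t \<in> T"
  obtains A where "A \<in> rd_filters T t" "\<And>P. eventually P A \<Longrightarrow> P t"
proof
  show "(if right_dense T t then inf (nhds t) (principal T) else principal {t}) \<in> rd_filters T t"
    by (simp add: rd_filters_def)
  show "P t" if "eventually P (if right_dense T t then inf (nhds t) (principal T) else principal {t})" for P
    using that assms by (auto simp: eventually_inf_principal eventually_principal
        dest: eventually_nhds_x_imp_x split: if_splits)
qed

lemma finite_rd_filters: "finite (rd_filters T t)"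
  by (simp add: rd_filters_def)

text \<open>At a right-dense point one of the filters is already the whole neighbourhood filter.
  Otherwise the gap up to \<open>sigma T t\<close> is empty, \<open>principal {t}\<close> takes care
  of \<open>t\<close>, and to the left there is either the left filter or another gap.\<close>

lemma eventually_nhds_if_rd_filters:
  assumes t: "t \<in> T" and P: "\<And>A. A \<in> rd_filters T t \<Longrightarrow> eventually P A"
  shows "eventually P (inf (nhds t) (principal T))"
proof (cases "right_dense T t")
  case True
  then show ?thesis using P[of "inf (nhds t) (principal T)"] by (simp add: rd_filters_def)
next
  case False
  then have "t < sigma T t" using sigma_ge[of t T] by (auto simp: right_dense_def)
  moreover have "P t" using P[of "principal {t}"] False by (simp add: rd_filters_def eventually_principal)
  moreover obtain d where d: "d > 0" "\<And>s. s \<in> T \<Longrightarrow> s < t \<Longrightarrow> t - d < s \<Longrightarrow> P s"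
  proof (cases "left_dense T t")
    case True
    then have "eventually P (at t within (T \<inter> {..<t}))"
      using P by (simp add: rd_filters_def)
    then obtain d where "d > 0" "\<forall>s\<in>T \<inter> {..<t}. s \<noteq> t \<and> dist s t < d \<longrightarrow> P s"
      unfolding eventually_at by blast
    then show ?thesis by (intro that[of d]) (auto simp: dist_real_def)
  next
    case False
    then obtain \<delta> where \<delta>: "0 < \<delta>" "\<not> (\<exists>r\<in>T. t - \<delta> < r \<and> r < t)"
      using left_denseI by blast
    then show ?thesis by (intro that[of \<delta>]) auto
  qed
  ultimately show ?thesis
    unfolding eventually_inf_principal eventually_nhds_metric
  proof (intro exI[of _ "min d (sigma T t - t)"] conjI allI impI)
    fix s assume "dist s t < min d (sigma T t - t)" "s \<in> T"
    then show "P s" using d(2)[of s] sigma_le[of s T t] \<open>P t\<close>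
      by (cases s t rule: linorder_cases) (auto simp: dist_real_def)
  qed auto
qed

text \<open>A point has at most two approach filters, so the events of \<open>E\<close> belonging to
  them can be intersected while the events near \<open>t\<close> are united.\<close>

lemma eventually_prod_nhds_if_rd_filters:
  assumes t: "t \<in> T"
    and P: "\<And>A. A \<in> rd_filters T t \<Longrightarrow> eventually (\<lambda>(z, s). \<Phi> z s) (prod_filter E A)"
  shows "eventually (\<lambda>(z, s). \<Phi> z s) (prod_filter E (inf (nhds t) (principal T)))"
proof -
  have "\<forall>A\<in>rd_filters T t. \<exists>P Q. eventually P E \<and> eventually Q A \<and> (\<forall>z s. P z \<longrightarrow> Q s \<longrightarrow> \<Phi> z s)"
    using P unfolding eventually_prod_filter by auto
  then obtain P where "\<forall>A\<in>rd_filters T t. \<exists>Q. eventually (P A) E \<and> eventually Q A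
      \<and> (\<forall>z s. P A z \<longrightarrow> Q s \<longrightarrow> \<Phi> z s)"
    unfolding bchoice_iff by blast
  then obtain Q where Q: "\<forall>A\<in>rd_filters T t. eventually (P A) E \<and> eventually (Q A) A
      \<and> (\<forall>z s. P A z \<longrightarrow> Q A s \<longrightarrow> \<Phi> z s)"
    unfolding bchoice_iff by blast
  have 1: "eventually (\<lambda>z. \<forall>A\<in>rd_filters T t. P A z) E"
    using Q finite_rd_filters by (subst eventually_ball_finite_distrib) auto
  have 2: "eventually (\<lambda>s. \<exists>A\<in>rd_filters T t. Q A s) (inf (nhds t) (principal T))"
  proof (rule eventually_nhds_if_rd_filters[OF t])
    fix A assume A: "A \<in> rd_filters T t"
    then have "eventually (Q A) A" using Q by blast
    then show "eventually (\<lambda>s. \<exists>A\<in>rd_filters T t. Q A s) A"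
      by eventually_elim (use A in blast)
  qed
  have 3: "\<Phi> z s" if "\<forall>A\<in>rd_filters T t. P A z" "\<exists>A\<in>rd_filters T t. Q A s" for z s
    using that Q by blast
  show ?thesis
    unfolding eventually_prod_filter
    using 1 2 3 by (intro exI[of _ "\<lambda>z. \<forall>A\<in>rd_filters T t. P A z"]
        exI[of _ "\<lambda>s. \<exists>A\<in>rd_filters T t. Q A s"]) auto
qed

text \<open>A point of \<open>T\<close> outside \<open>kappa T\<close> is a maximum that is not
  left-dense, hence isolated in \<open>T\<close>. So the convention that delta derivatives are
  \<open>0\<close> outside \<open>kappa T\<close> does not spoil their rd-continuity.\<close>

lemma eventually_kappa_iff:
  assumes t: "t \<in> T" and A: "A \<in> rd_filters T t"
  shows "eventually (\<lambda>s. s \<in> kappa T \<longleftrightarrow> t \<in> kappa T) A"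
proof (rule eventually_rd_filters[OF t A])
  show "eventually (\<lambda>s. s \<in> kappa T \<longleftrightarrow> t \<in> kappa T) (inf (nhds t) (principal T))"
  proof (cases "t \<in> kappa T")
    case False
    then have max: "\<And>s. s \<in> T \<Longrightarrow> s \<le> t" and "\<not> left_dense T t"
      using t by (force simp: kappa_def)+
    then obtain \<delta> where \<delta>: "0 < \<delta>" "\<not> (\<exists>r\<in>T. t - \<delta> < r \<and> r < t)"
      using left_denseI by blast
    then show ?thesis
      unfolding eventually_inf_principal eventually_nhds_metric
      using max by (intro exI[of _ \<delta>]) (force simp: dist_real_def)
  next
    case True
    show ?thesis
    proof (cases "\<exists>m\<in>T. t < m")
      case False
      have "s \<in> kappa T" if "s \<in> T" for s
        using that True False t unfolding kappa_def by (cases "s = t") force+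
      then show ?thesis using True by (simp add: eventually_inf_principal)
    next
      case m: True
      then obtain m where "m \<in> T" "t < m" by blast
      then show ?thesis using True
        unfolding eventually_inf_principal eventually_nhds_metric
        by (intro exI[of _ "m - t"]) (force simp: dist_real_def kappa_def)
    qed
  qed
qed


section \<open>Delta derivatives\<close>

lemma kappa_subset: "kappa T \<subseteq> T"
  by (auto simp: kappa_def)

text \<open>Such points have a nonzero increment \<open>sigma T t - s\<close>, which is what forces
  the delta derivative to be unique. At a right-scattered point \<open>t\<close> itself
  serves.\<close>

lemma kappa_approach:
  assumes "t \<in> kappa T" "0 < \<delta>"
  shows "\<exists>s\<in>T. \<bar>s - t\<bar> < \<delta> \<and> s \<noteq> sigma T t"
proof (cases "right_dense T t")
  case False
  then show ?thesis using assms by (intro bexI[of _ t]) (auto simp: right_dense_def kappa_def)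
next
  case rd: True
  then have \<sigma>: "sigma T t = t" by (simp add: right_dense_def)
  show ?thesis
  proof (cases "\<exists>s\<in>T. t < s")
    case True
    then obtain r where "r \<in> T" "t < r" "r < t + \<delta>"
      using right_dense_near[OF rd _ _ assms(2)] by blast
    then show ?thesis using \<sigma> by (intro bexI[of _ r]) auto
  next
    case False
    then have "left_dense T t" using assms(1) by (auto simp: kappa_def)
    then obtain r where "r \<in> T" "t - \<delta> < r" "r < t"
      using left_dense_near assms(2) by blast
    then show ?thesis using \<sigma> by (intro bexI[of _ r]) auto
  qed
qed

lemma has_delta_derivativeD:
  assumes "has_delta_derivative T f D t" "0 < \<epsilon>"
  obtains \<delta> where "0 < \<delta>" "\<And>s. s \<in> T \<Longrightarrow> \<bar>s - t\<bar> < \<delta> \<Longrightarrow>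
      \<bar>f (sigma T t) - f s - D * (sigma T t - s)\<bar> \<le> \<epsilon> * \<bar>sigma T t - s\<bar>"
  using assms unfolding has_delta_derivative_def by blast

lemma has_delta_derivative_kappa: "has_delta_derivative T f D t \<Longrightarrow> t \<in> kappa T"
  by (simp add: has_delta_derivative_def)

lemma has_delta_derivative_unique:
  assumes D: "has_delta_derivative T f D t" and E: "has_delta_derivative T f E t"
  shows "D = E"
proof (rule ccontr)
  assume "D \<noteq> E"
  \<comment> \<open>A third of the distance: the two error bounds together allow only
    \<open>2 * \<epsilon>\<close> of the \<open>3 * \<epsilon>\<close>.\<close>
  define \<epsilon> where "\<epsilon> = \<bar>D - E\<bar> / 3"
  have \<epsilon>: "\<epsilon> > 0" using \<open>D \<noteq> E\<close> by (simp add: \<epsilon>_def)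
  obtain d1 where d1: "d1 > 0" "\<And>s. s \<in> T \<Longrightarrow> \<bar>s - t\<bar> < d1 \<Longrightarrow>
      \<bar>f (sigma T t) - f s - D * (sigma T t - s)\<bar> \<le> \<epsilon> * \<bar>sigma T t - s\<bar>"
    using has_delta_derivativeD[OF D \<epsilon>] by metis
  obtain d2 where d2: "d2 > 0" "\<And>s. s \<in> T \<Longrightarrow> \<bar>s - t\<bar> < d2 \<Longrightarrow>
      \<bar>f (sigma T t) - f s - E * (sigma T t - s)\<bar> \<le> \<epsilon> * \<bar>sigma T t - s\<bar>"
    using has_delta_derivativeD[OF E \<epsilon>] by metis
  obtain s where s: "s \<in> T" "\<bar>s - t\<bar> < min d1 d2" "s \<noteq> sigma T t"
    using kappa_approach[OF has_delta_derivative_kappa[OF D], of "min d1 d2"] d1(1) d2(1) by auto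
  define h where "h = sigma T t - s"
  have h: "\<bar>h\<bar> > 0" using s by (simp add: h_def)
  have "\<bar>f (sigma T t) - f s - D * h\<bar> \<le> \<epsilon> * \<bar>h\<bar>" "\<bar>f (sigma T t) - f s - E * h\<bar> \<le> \<epsilon> * \<bar>h\<bar>"
    using d1(2)[of s] d2(2)[of s] s by (auto simp: h_def)
  then have "\<bar>D * h - E * h\<bar> \<le> 2 * \<epsilon> * \<bar>h\<bar>" by linarith
  moreover have "\<bar>D * h - E * h\<bar> = 3 * \<epsilon> * \<bar>h\<bar>"
    by (simp add: \<epsilon>_def left_diff_distrib[symmetric] abs_mult)
  ultimately show False using h \<epsilon> by simp
qed

lemma delta_deriv_eq: "has_delta_derivative T f D t \<Longrightarrow> delta_deriv T f t = D"
  unfolding delta_deriv_def using has_delta_derivative_kappa has_delta_derivative_unique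
  by (auto intro!: the_equality)

lemma has_delta_derivative_delta_deriv:
  "\<exists>D. has_delta_derivative T f D t \<Longrightarrow> has_delta_derivative T f (delta_deriv T f t) t"
  using delta_deriv_eq by metis

lemma has_delta_derivative_cong:
  assumes "closed T" "\<And>s. s \<in> T \<Longrightarrow> f s = g s" "has_delta_derivative T f D t"
  shows "has_delta_derivative T g D t"
proof -
  have t: "t \<in> T" using has_delta_derivative_kappa[OF assms(3)] kappa_subset by blast
  show ?thesis
    using assms(3) unfolding has_delta_derivative_def
    by (simp add: assms(2)[symmetric] sigma_mem[OF assms(1) t])
qed

lemma delta_deriv_cong:
  assumes "closed T" "\<And>s. s \<in> T \<Longrightarrow> f s = g s"
  shows "delta_deriv T f t = delta_deriv T g t"
proof -
  have "has_delta_derivative T f D t \<longleftrightarrow> has_delta_derivative T g D t" for D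
    using has_delta_derivative_cong[OF assms(1), of f g] has_delta_derivative_cong[OF assms(1), of g f]
      assms(2) by metis
  then show ?thesis by (simp add: delta_deriv_def)
qed

lemma has_delta_derivative_const: "t \<in> kappa T \<Longrightarrow> has_delta_derivative T (\<lambda>_. c) 0 t"
  by (auto simp: has_delta_derivative_def intro: exI[of _ 1])

lemma has_delta_derivative_id: "t \<in> kappa T \<Longrightarrow> has_delta_derivative T (\<lambda>s. s) 1 t"
  by (auto simp: has_delta_derivative_def intro: exI[of _ 1])

lemma has_delta_derivative_cmult:
  assumes "has_delta_derivative T f D t"
  shows "has_delta_derivative T (\<lambda>s. c * f s) (c * D) t"
  unfolding has_delta_derivative_def
proof (intro conjI allI impI)
  show "t \<in> kappa T" by (rule has_delta_derivative_kappa[OF assms])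
  fix \<epsilon> :: real assume \<epsilon>: "\<epsilon> > 0"
  then obtain \<delta> where \<delta>: "0 < \<delta>" "\<And>s. s \<in> T \<Longrightarrow> \<bar>s - t\<bar> < \<delta> \<Longrightarrow>
      \<bar>f (sigma T t) - f s - D * (sigma T t - s)\<bar> \<le> \<epsilon> / (\<bar>c\<bar> + 1) * \<bar>sigma T t - s\<bar>"
    using has_delta_derivativeD[OF assms, of "\<epsilon> / (\<bar>c\<bar> + 1)"] by (auto simp: add_nonneg_pos)
  show "\<exists>\<delta>>0. \<forall>s\<in>T. \<bar>s - t\<bar> < \<delta> \<longrightarrow>
      \<bar>c * f (sigma T t) - c * f s - c * D * (sigma T t - s)\<bar> \<le> \<epsilon> * \<bar>sigma T t - s\<bar>"
  proof (intro exI[of _ \<delta>] conjI ballI impI \<delta>(1))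
    fix s assume s: "s \<in> T" "\<bar>s - t\<bar> < \<delta>"
    have "\<bar>c * f (sigma T t) - c * f s - c * D * (sigma T t - s)\<bar>
        = \<bar>c\<bar> * \<bar>f (sigma T t) - f s - D * (sigma T t - s)\<bar>"
      by (simp add: abs_mult[symmetric] algebra_simps)
    also have "\<dots> \<le> \<bar>c\<bar> * (\<epsilon> / (\<bar>c\<bar> + 1) * \<bar>sigma T t - s\<bar>)"
      by (intro mult_left_mono \<delta>(2) s) auto
    also have "\<dots> = (\<bar>c\<bar> / (\<bar>c\<bar> + 1)) * (\<epsilon> * \<bar>sigma T t - s\<bar>)" by simp
    also have "\<dots> \<le> 1 * (\<epsilon> * \<bar>sigma T t - s\<bar>)"
      using \<epsilon> by (intro mult_right_mono) (auto simp: divide_le_eq_1)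
    finally show "\<bar>c * f (sigma T t) - c * f s - c * D * (sigma T t - s)\<bar> \<le> \<epsilon> * \<bar>sigma T t - s\<bar>"
      by simp
  qed
qed

lemma has_delta_derivative_add:
  assumes f: "has_delta_derivative T f D t" and g: "has_delta_derivative T g E t"
  shows "has_delta_derivative T (\<lambda>s. f s + g s) (D + E) t"
  unfolding has_delta_derivative_def
proof (intro conjI allI impI)
  show "t \<in> kappa T" by (rule has_delta_derivative_kappa[OF f])
  fix \<epsilon> :: real assume \<epsilon>: "\<epsilon> > 0"
  obtain d1 where d1: "0 < d1" "\<And>s. s \<in> T \<Longrightarrow> \<bar>s - t\<bar> < d1 \<Longrightarrow>
      \<bar>f (sigma T t) - f s - D * (sigma T t - s)\<bar> \<le> \<epsilon> / 2 * \<bar>sigma T t - s\<bar>"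
    using has_delta_derivativeD[OF f, of "\<epsilon> / 2"] \<epsilon> by auto
  obtain d2 where d2: "0 < d2" "\<And>s. s \<in> T \<Longrightarrow> \<bar>s - t\<bar> < d2 \<Longrightarrow>
      \<bar>g (sigma T t) - g s - E * (sigma T t - s)\<bar> \<le> \<epsilon> / 2 * \<bar>sigma T t - s\<bar>"
    using has_delta_derivativeD[OF g, of "\<epsilon> / 2"] \<epsilon> by auto
  show "\<exists>\<delta>>0. \<forall>s\<in>T. \<bar>s - t\<bar> < \<delta> \<longrightarrow>
      \<bar>f (sigma T t) + g (sigma T t) - (f s + g s) - (D + E) * (sigma T t - s)\<bar>
        \<le> \<epsilon> * \<bar>sigma T t - s\<bar>"
  proof (intro exI[of _ "min d1 d2"] conjI ballI impI)
    fix s assume s: "s \<in> T" "\<bar>s - t\<bar> < min d1 d2"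
    have "f (sigma T t) + g (sigma T t) - (f s + g s) - (D + E) * (sigma T t - s)
      = (f (sigma T t) - f s - D * (sigma T t - s)) + (g (sigma T t) - g s - E * (sigma T t - s))"
      by (simp add: algebra_simps)
    moreover have "\<epsilon> * \<bar>sigma T t - s\<bar> = \<epsilon> / 2 * \<bar>sigma T t - s\<bar> + \<epsilon> / 2 * \<bar>sigma T t - s\<bar>" by simp
    ultimately show "\<bar>f (sigma T t) + g (sigma T t) - (f s + g s) - (D + E) * (sigma T t - s)\<bar>
        \<le> \<epsilon> * \<bar>sigma T t - s\<bar>"
      using d1(2)[of s] d2(2)[of s] s by linarith
  qed (use d1 d2 in auto)
qed

lemma has_delta_derivative_diff:
  "has_delta_derivative T f D t \<Longrightarrow> has_delta_derivative T g E t \<Longrightarrow>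
    has_delta_derivative T (\<lambda>s. f s - g s) (D - E) t"
  using has_delta_derivative_add[of T f D t "\<lambda>s. - 1 * g s" "- 1 * E"]
    has_delta_derivative_cmult[of T g E t "- 1"] by simp

text \<open>For \<open>s = t\<close> the increment in the definition is fixed while
  \<open>\<epsilon>\<close> is arbitrary, so the error vanishes. At a right-dense point both sides
  are \<open>0\<close>.\<close>

lemma has_delta_derivative_right_scattered:
  assumes "has_delta_derivative T f D t"
  shows "f (sigma T t) - f t = D * (sigma T t - t)"
proof -
  have t: "t \<in> T" using has_delta_derivative_kappa[OF assms] kappa_subset by blast
  have "\<bar>f (sigma T t) - f t - D * (sigma T t - t)\<bar> \<le> \<epsilon> * \<bar>sigma T t - t\<bar>" if "\<epsilon> > 0" for \<epsilon>
    using has_delta_derivativeD[OF assms that] t by (metis abs_zero diff_self)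
  then have "\<bar>f (sigma T t) - f t - D * (sigma T t - t)\<bar> \<le> 0 + e" if "e > 0" for e
    using that sigma_ge[of t T]
    by (cases "sigma T t = t") (force dest: spec[of _ "e / \<bar>sigma T t - t\<bar>"])+
  then have "\<bar>f (sigma T t) - f t - D * (sigma T t - t)\<bar> \<le> 0" by (rule field_le_epsilon)
  then show ?thesis by simp
qed

lemma has_delta_derivative_continuous:
  assumes f: "has_delta_derivative T f D t" and e: "0 < e"
  shows "\<exists>\<delta>>0. \<forall>s\<in>T. \<bar>s - t\<bar> < \<delta> \<longrightarrow> \<bar>f t - f s\<bar> < e"
proof -
  define \<mu> where "\<mu> = sigma T t - t"
  \<comment> \<open>The error splits into \<open>\<epsilon> * \<bar>\<mu>\<bar>\<close>, kept below
    \<open>e / 2\<close> for the fixed graininess \<open>\<mu>\<close>, and a multiple of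
    \<open>\<bar>t - s\<bar>\<close>, which \<open>\<delta>\<close> controls.\<close>
  define \<epsilon> where "\<epsilon> = e / (2 * (\<bar>\<mu>\<bar> + 1))"
  have \<epsilon>: "\<epsilon> > 0" using e by (simp add: \<epsilon>_def add_nonneg_pos)
  have \<epsilon>\<mu>: "\<epsilon> * \<bar>\<mu>\<bar> < e / 2"
  proof -
    have "\<epsilon> * \<bar>\<mu>\<bar> < \<epsilon> * (\<bar>\<mu>\<bar> + 1)" using \<epsilon> by simp
    also have "\<dots> = e / 2" by (simp add: \<epsilon>_def add_nonneg_eq_0_iff field_simps)
    finally show ?thesis .
  qed
  obtain d where d: "0 < d" "\<And>s. s \<in> T \<Longrightarrow> \<bar>s - t\<bar> < d \<Longrightarrow>
      \<bar>f (sigma T t) - f s - D * (sigma T t - s)\<bar> \<le> \<epsilon> * \<bar>sigma T t - s\<bar>"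
    using has_delta_derivativeD[OF f \<epsilon>] by metis
  define \<delta> where "\<delta> = min d (e / (2 * (\<bar>D\<bar> + \<epsilon>)))"
  have pos: "\<bar>D\<bar> + \<epsilon> > 0" using \<epsilon> by simp
  show ?thesis
  proof (intro exI[of _ \<delta>] conjI ballI impI)
    show "\<delta> > 0" using d(1) e pos by (simp add: \<delta>_def)
    fix s assume s: "s \<in> T" "\<bar>s - t\<bar> < \<delta>"
    have 1: "f (sigma T t) - f t = D * \<mu>"
      using has_delta_derivative_right_scattered[OF f] by (simp add: \<mu>_def)
    have 2: "\<bar>f (sigma T t) - f s - D * (sigma T t - s)\<bar> \<le> \<epsilon> * \<bar>sigma T t - s\<bar>"
      using d(2) s by (simp add: \<delta>_def)
    have 3: "sigma T t - s = \<mu> + (t - s)" by (simp add: \<mu>_def)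
    have "\<epsilon> * \<bar>sigma T t - s\<bar> \<le> \<epsilon> * \<bar>\<mu>\<bar> + \<epsilon> * \<bar>t - s\<bar>"
      unfolding 3 distrib_left[symmetric] using \<epsilon> by (intro mult_left_mono) auto
    moreover have "f t - f s = (f (sigma T t) - f s - D * (sigma T t - s)) + D * (t - s)"
      using 1 unfolding 3 by (simp add: algebra_simps)
    moreover have "\<bar>D * (t - s)\<bar> = \<bar>D\<bar> * \<bar>t - s\<bar>" by (rule abs_mult)
    moreover have "(\<bar>D\<bar> + \<epsilon>) * \<bar>t - s\<bar> \<le> e / 2"
    proof -
      have "\<bar>t - s\<bar> \<le> e / (2 * (\<bar>D\<bar> + \<epsilon>))" using s unfolding \<delta>_def by linarith
      then show ?thesis using pos by (simp add: field_simps)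
    qed
    ultimately show "\<bar>f t - f s\<bar> < e" using 2 \<epsilon>\<mu> unfolding distrib_right by linarith
  qed
qed

text \<open>The supremum \<open>m\<close> of the points up to which \<open>P\<close> holds satisfies
  \<open>P\<close> itself, being either one of them or a left-dense limit of them. If
  \<open>m < s\<close>, the jump or the right-dense step carries \<open>P\<close> beyond
  \<open>m\<close>, a contradiction.\<close>

lemma delta_induct:
  assumes T: "closed T" and r: "r \<in> T" "P r" and s: "s \<in> T" "r \<le> s"
    and scattered: "\<And>t. t \<in> T \<Longrightarrow> r \<le> t \<Longrightarrow> t < sigma T t \<Longrightarrow> sigma T t \<le> s \<Longrightarrow> P t \<Longrightarrow> P (sigma T t)"
    and right: "\<And>t. t \<in> T \<Longrightarrow> r \<le> t \<Longrightarrow> t < s \<Longrightarrow> sigma T t = t \<Longrightarrow> P t \<Longrightarrow>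
      \<exists>\<delta>>0. \<forall>q\<in>T. t < q \<longrightarrow> q < t + \<delta> \<longrightarrow> q \<le> s \<longrightarrow> P q"
    and left: "\<And>t. t \<in> T \<Longrightarrow> r < t \<Longrightarrow> t \<le> s \<Longrightarrow> left_dense T t \<Longrightarrow>
      (\<And>q. q \<in> T \<Longrightarrow> r \<le> q \<Longrightarrow> q < t \<Longrightarrow> P q) \<Longrightarrow> P t"
  shows "P s"
proof -
  define S where "S = {t \<in> T. r \<le> t \<and> t \<le> s \<and> (\<forall>q\<in>T. r \<le> q \<longrightarrow> q \<le> t \<longrightarrow> P q)}"
  have rS: "r \<in> S" using r s by (auto simp: S_def order.antisym)
  have bdd: "bdd_above S" by (auto simp: S_def intro: bdd_aboveI[of _ s])
  define m where "m = Sup S"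
  have mT: "m \<in> T"
  proof -
    have "m \<in> closure S" unfolding m_def by (rule closure_contains_Sup) (use rS bdd in auto)
    also have "\<dots> \<subseteq> closure T" by (rule closure_mono) (auto simp: S_def)
    finally show ?thesis using T by simp
  qed
  have rm: "r \<le> m" unfolding m_def using rS bdd by (rule cSup_upper)
  have ms: "m \<le> s" unfolding m_def using rS by (intro cSup_least) (auto simp: S_def)
  have below: "P q" if q: "q \<in> T" "r \<le> q" "q < m" for q
  proof -
    obtain t where "t \<in> S" "q < t"
      using q(3) rS unfolding m_def by (subst (asm) less_cSup_iff) (use bdd in auto)
    then show ?thesis using q by (auto simp: S_def)
  qed
  have Pm: "P m"
  proof (cases "m \<in> S")
    case True
    then show ?thesis using mT rm by (auto simp: S_def)
  next
    case False
    have "left_dense T m"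
    proof (rule left_denseI)
      fix \<delta> :: real assume "\<delta> > 0"
      then have "m - \<delta> < Sup S" by (simp add: m_def)
      then obtain t where t: "t \<in> S" "m - \<delta> < t"
        using rS by (subst (asm) less_cSup_iff) (use bdd in auto)
      moreover have "t \<le> m" unfolding m_def using t(1) bdd by (rule cSup_upper)
      ultimately show "\<exists>q\<in>T. m - \<delta> < q \<and> q < m"
        using False by (intro bexI[of _ t]) (auto simp: S_def less_le)
    qed
    then show ?thesis
      using left[of m] mT rm ms below False rS by (metis order.order_iff_strict)
  qed
  have upto: "P q" if "q \<in> T" "r \<le> q" "q \<le> m" for q
    using below[of q] Pm that by (cases "q = m") auto
  have "m = s"
  proof (rule ccontr)
    assume "m \<noteq> s"
    then have lt: "m < s" using ms by simp
    show False
    proof (cases "sigma T m = m")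
      case False
      then have sm: "m < sigma T m" using sigma_ge[of m T] by simp
      have les: "sigma T m \<le> s" using lt s(1) by (rule sigma_le[rotated])
      then have Ps: "P (sigma T m)" using scattered mT rm sm Pm by blast
      have "sigma T m \<in> S"
        unfolding S_def
      proof (intro CollectI conjI ballI impI)
        fix q assume q: "q \<in> T" "r \<le> q" "q \<le> sigma T m"
        then show "P q" using upto[of q] sigma_le[of q T m] Ps
          by (cases "q \<le> m") (auto simp: order.antisym)
      qed (use les sm rm sigma_mem[OF T mT] in auto)
      then have "sigma T m \<le> m" unfolding m_def using bdd by (intro cSup_upper) (simp_all add: m_def)
      then show False using sm by simp
    next
      case True
      obtain \<delta> where \<delta>: "\<delta> > 0" "\<And>q. q \<in> T \<Longrightarrow> m < q \<Longrightarrow> q < m + \<delta> \<Longrightarrow> q \<le> s \<Longrightarrow> P q"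
        using right[OF mT rm lt True Pm] by blast
      obtain q where q: "q \<in> T" "m < q" "q < m + min \<delta> (s - m)"
        using right_dense_near[of T m s "min \<delta> (s - m)"] True s(1) lt \<delta>(1)
        by (auto simp: right_dense_def)
      have "q \<in> S"
        unfolding S_def
      proof (intro CollectI conjI ballI impI)
        fix p assume p: "p \<in> T" "r \<le> p" "p \<le> q"
        then show "P p" using upto[of p] \<delta>(2)[of p] q by (cases "p \<le> m") auto
      qed (use q rm in auto)
      then have "q \<le> m" unfolding m_def using bdd by (rule cSup_upper)
      then show False using q by simp
    qed
  qed
  then show ?thesis using Pm by simp
qed

text \<open>Induction along the scale, with a slack that is removed at the end. The derivative is
  consulted only at points that lie below \<open>s\<close> or are left-dense, and these belong to
  \<open>kappa T\<close>; at left-dense points it merely supplies continuity.\<close>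

lemma delta_derivative_nonneg_imp_le:
  assumes T: "closed T" and r: "r \<in> T" and s: "s \<in> T" "r \<le> s"
    and D: "\<And>t. t \<in> kappa T \<Longrightarrow> r \<le> t \<Longrightarrow> t \<le> s \<Longrightarrow> has_delta_derivative T f (D t) t \<and> 0 \<le> D t"
  shows "f r \<le> f s"
proof -
  have "f r - f s \<le> 0 + e" if "e > 0" for e
  proof -
    \<comment> \<open>The slack \<open>\<epsilon> * (t - r)\<close> absorbs the error of the
      derivative estimate at right-dense points. The summand \<open>1\<close> keeps the quotient
      meaningful for \<open>s = r\<close>.\<close>
    define \<epsilon> where "\<epsilon> = e / (s - r + 1)"
    have \<epsilon>: "\<epsilon> > 0" using that s by (simp add: \<epsilon>_def)
    have kap: "t \<in> kappa T" if "t \<in> T" "t < s \<or> left_dense T t" for t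
      using that s(1) by (auto simp: kappa_def)
    have "f r - f s \<le> \<epsilon> * (s - r)"
    proof (rule delta_induct[of T r "\<lambda>t. f r - f t \<le> \<epsilon> * (t - r)"])
      fix t assume t: "t \<in> T" "r \<le> t" "t < sigma T t" "sigma T t \<le> s" "f r - f t \<le> \<epsilon> * (t - r)"
      then have "has_delta_derivative T f (D t) t \<and> 0 \<le> D t" using D[of t] kap[of t] by simp
      then have "f (sigma T t) - f t = D t * (sigma T t - t)" "0 \<le> D t"
        using has_delta_derivative_right_scattered by auto
      then have "0 \<le> f (sigma T t) - f t" using t by simp
      moreover have "\<epsilon> * (t - r) \<le> \<epsilon> * (sigma T t - r)" using \<epsilon> t by simp
      ultimately show "f r - f (sigma T t) \<le> \<epsilon> * (sigma T t - r)" using t(5) by linarith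
    next
      fix t assume t: "t \<in> T" "r \<le> t" "t < s" "sigma T t = t" "f r - f t \<le> \<epsilon> * (t - r)"
      then have "has_delta_derivative T f (D t) t" and D0: "0 \<le> D t" using D[of t] kap[of t] by auto
      then obtain \<delta> where \<delta>: "\<delta> > 0" "\<And>q. q \<in> T \<Longrightarrow> \<bar>q - t\<bar> < \<delta> \<Longrightarrow>
          \<bar>f t - f q - D t * (t - q)\<bar> \<le> \<epsilon> * \<bar>t - q\<bar>"
        using has_delta_derivativeD[OF _ \<epsilon>] t(4) by metis
      show "\<exists>\<delta>>0. \<forall>q\<in>T. t < q \<longrightarrow> q < t + \<delta> \<longrightarrow> q \<le> s \<longrightarrow> f r - f q \<le> \<epsilon> * (q - r)"
      proof (intro exI[of _ \<delta>] conjI ballI impI \<delta>(1))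
        fix q assume q: "q \<in> T" "t < q" "q < t + \<delta>"
        then have "\<bar>f t - f q - D t * (t - q)\<bar> \<le> \<epsilon> * (q - t)" using \<delta>(2)[of q] by simp
        moreover have "D t * (t - q) \<le> 0" using D0 q by (simp add: mult_nonneg_nonpos)
        moreover have "\<epsilon> * (q - r) = \<epsilon> * (q - t) + \<epsilon> * (t - r)" by (simp add: algebra_simps)
        ultimately show "f r - f q \<le> \<epsilon> * (q - r)" using t(5) by linarith
      qed
    next
      fix t assume t: "t \<in> T" "r < t" "t \<le> s" "left_dense T t"
        and IH: "\<And>q. q \<in> T \<Longrightarrow> r \<le> q \<Longrightarrow> q < t \<Longrightarrow> f r - f q \<le> \<epsilon> * (q - r)"
      have d: "has_delta_derivative T f (D t) t" using D[of t] kap[of t] t by auto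
      show "f r - f t \<le> \<epsilon> * (t - r)"
      proof (rule field_le_epsilon)
        fix e :: real assume "e > 0"
        then obtain \<delta> where \<delta>: "\<delta> > 0" "\<And>q. q \<in> T \<Longrightarrow> \<bar>q - t\<bar> < \<delta> \<Longrightarrow> \<bar>f t - f q\<bar> < e"
          using has_delta_derivative_continuous[OF d] by blast
        obtain q where q: "q \<in> T" "t - min \<delta> (t - r) < q" "q < t"
          using left_dense_near[OF t(4), of "min \<delta> (t - r)"] \<delta>(1) t(2) by auto
        have "f r - f q \<le> \<epsilon> * (q - r)" using IH q by simp
        also have "\<dots> \<le> \<epsilon> * (t - r)" using \<epsilon> q by simp
        finally have "f r - f q \<le> \<epsilon> * (t - r)" .
        moreover have "\<bar>f t - f q\<bar> < e" using \<delta>(2)[of q] q by auto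
        ultimately show "f r - f t \<le> \<epsilon> * (t - r) + e" by linarith
      qed
    qed (use T r s in auto)
    also have "\<dots> \<le> e"
    proof -
      have "\<epsilon> * (s - r) \<le> \<epsilon> * (s - r + 1)" using \<epsilon> by simp
      also have "\<dots> = e" using s by (simp add: \<epsilon>_def)
      finally show ?thesis .
    qed
    finally show ?thesis by simp
  qed
  then show ?thesis using field_le_epsilon[of "f r - f s" 0] by simp
qed

text \<open>Two antiderivatives differ by a function with delta derivative \<open>0\<close>, which
  is constant because both it and its negative are nondecreasing. Hence one antiderivative is enough
  to evaluate the definite description.\<close>

lemma delta_integral_eq:
  assumes T: "closed T" and r: "r \<in> T" and s: "s \<in> T"
    and \<Phi>: "\<And>t. t \<in> kappa T \<Longrightarrow> has_delta_derivative T \<Phi> (f t) t"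
  shows "delta_integral T r s f = \<Phi> s - \<Phi> r"
  unfolding delta_integral_def
proof (rule the_equality)
  show "\<exists>\<Psi>. (\<forall>t\<in>kappa T. has_delta_derivative T \<Psi> (f t) t) \<and> \<Phi> s - \<Phi> r = \<Psi> s - \<Psi> r"
    using \<Phi> by blast
  fix v assume "\<exists>\<Psi>. (\<forall>t\<in>kappa T. has_delta_derivative T \<Psi> (f t) t) \<and> v = \<Psi> s - \<Psi> r"
  then obtain \<Psi> where \<Psi>: "\<And>t. t \<in> kappa T \<Longrightarrow> has_delta_derivative T \<Psi> (f t) t"
      and v: "v = \<Psi> s - \<Psi> r" by blast
  have z: "has_delta_derivative T (\<lambda>t. \<Psi> t - \<Phi> t) 0 t" "has_delta_derivative T (\<lambda>t. \<Phi> t - \<Psi> t) 0 t"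
    if "t \<in> kappa T" for t
    using has_delta_derivative_diff[OF \<Psi> \<Phi>, OF that that]
      has_delta_derivative_diff[OF \<Phi> \<Psi>, OF that that] by simp_all
  have "\<Psi> p - \<Phi> p = \<Psi> q - \<Phi> q" if "p \<in> T" "q \<in> T" "p \<le> q" for p q
    using delta_derivative_nonneg_imp_le[OF T that(1,2,3), of "\<lambda>t. \<Psi> t - \<Phi> t" "\<lambda>_. 0"]
      delta_derivative_nonneg_imp_le[OF T that(1,2,3), of "\<lambda>t. \<Phi> t - \<Psi> t" "\<lambda>_. 0"] z
    by simp
  then have "\<Psi> s - \<Phi> s = \<Psi> r - \<Phi> r" using r s by (metis linear)
  then show "v = \<Phi> s - \<Phi> r" using v by simp
qed


section \<open>Antiderivatives of rd-continuous functions\<close>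

text \<open>The hypothesis says in Cauchy form that \<open>g\<close> is regulated. Around each point
  a function with one value on each side approximates \<open>g\<close> within \<open>e\<close>;
  bisection glues these pieces together, and integrability passes to uniform limits.\<close>

lemma one_sided_limits_imp_integrable:
  fixes g :: "real \<Rightarrow> real"
  assumes ab: "a \<le> b"
    and reg: "\<And>x \<epsilon>. x \<in> {a..b} \<Longrightarrow> 0 < \<epsilon> \<Longrightarrow> \<exists>\<delta>>0.
      (\<forall>s\<in>{x - \<delta><..<x} \<inter> {a..b}. \<forall>s'\<in>{x - \<delta><..<x} \<inter> {a..b}. \<bar>g s - g s'\<bar> \<le> \<epsilon>) \<and>
      (\<forall>s\<in>{x<..<x + \<delta>} \<inter> {a..b}. \<forall>s'\<in>{x<..<x + \<delta>} \<inter> {a..b}. \<bar>g s - g s'\<bar> \<le> \<epsilon>)"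
  shows "g integrable_on {a..b}"
proof -
  have "\<exists>h. (\<forall>x\<in>cbox a b. norm (g x - h x) \<le> e) \<and> h integrable_on cbox a b" if e: "e > 0" for e
  proof -
    define P where "P u v \<longleftrightarrow> (a \<le> u \<and> v \<le> b \<longrightarrow>
        (\<exists>h. (\<forall>x\<in>{u..v}. \<bar>g x - h x\<bar> \<le> e) \<and> h integrable_on {u..v}))" for u v
    have "P a b"
      using ab
    proof (induction rule: Bolzano)
      case (trans u v w)
      show ?case
        unfolding P_def
      proof (intro impI)
        assume "a \<le> u \<and> w \<le> b"
        then obtain h h' where h: "\<forall>x\<in>{u..v}. \<bar>g x - h x\<bar> \<le> e" "h integrable_on {u..v}"
          and h': "\<forall>x\<in>{v..w}. \<bar>g x - h' x\<bar> \<le> e" "h' integrable_on {v..w}"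
          using trans unfolding P_def by auto
        define k where "k x = (if x \<le> v then h x else h' x)" for x
        have "k integrable_on {u..v}"
          by (rule integrable_eq[OF h(2)]) (simp add: k_def)
        moreover have "k integrable_on {v..w}"
          by (rule integrable_spike_finite[OF _ _ h'(2), of "{v}"]) (auto simp: k_def)
        ultimately have "k integrable_on {u..w}"
          using trans by (intro Henstock_Kurzweil_Integration.integrable_combine[of u v w]) auto
        moreover have "\<forall>x\<in>{u..w}. \<bar>g x - k x\<bar> \<le> e" using h h' by (auto simp: k_def)
        ultimately show "\<exists>h. (\<forall>x\<in>{u..w}. \<bar>g x - h x\<bar> \<le> e) \<and> h integrable_on {u..w}"
          by blast
      qed
    next
      case (local x)
      obtain \<delta> where \<delta>: "\<delta> > 0"
        "\<And>s s'. s \<in> {x - \<delta><..<x} \<inter> {a..b} \<Longrightarrow> s' \<in> {x - \<delta><..<x} \<inter> {a..b} \<Longrightarrow> \<bar>g s - g s'\<bar> \<le> e"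
        "\<And>s s'. s \<in> {x<..<x + \<delta>} \<inter> {a..b} \<Longrightarrow> s' \<in> {x<..<x + \<delta>} \<inter> {a..b} \<Longrightarrow> \<bar>g s - g s'\<bar> \<le> e"
        using reg[of x e] local e by auto
      have "\<exists>h. (\<forall>x\<in>{u..v}. \<bar>g x - h x\<bar> \<le> e) \<and> h integrable_on {u..v}"
        if uv: "u \<le> x" "x \<le> v" "v - u < \<delta>" "a \<le> u" "v \<le> b" for u v
      proof -
        \<comment> \<open>The values are sampled at midpoints, so that they come from the open
          one-sided neighbourhoods of \<open>x\<close>; if \<open>u = x\<close> or
          \<open>x = v\<close>, that side is empty.\<close>
        define k where "k s = (if s < x then g ((u + x) / 2) else if s = x then g x else g ((x + v) / 2))" for s
        have "k integrable_on {u..x}"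
          by (rule integrable_spike_finite[where S = "{x}" and f = "\<lambda>_. g ((u + x) / 2)"]) (auto simp: k_def)
        moreover have "k integrable_on {x..v}"
          by (rule integrable_spike_finite[where S = "{x}" and f = "\<lambda>_. g ((x + v) / 2)"]) (auto simp: k_def)
        ultimately have "k integrable_on {u..v}"
          using uv by (intro Henstock_Kurzweil_Integration.integrable_combine[of u x v]) auto
        moreover have "\<bar>g s - k s\<bar> \<le> e" if s: "s \<in> {u..v}" for s
        proof (cases s x rule: linorder_cases)
          case less
          then show ?thesis unfolding k_def using s uv by (auto intro!: \<delta>(2))
        next
          case equal
          then show ?thesis using e by (simp add: k_def)
        next
          case greater
          then show ?thesis unfolding k_def using s uv by (auto intro!: \<delta>(3))
        qed
        ultimately show ?thesis by blast
      qed
      then show ?case using \<delta>(1) unfolding P_def by blast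
    qed
    then show ?thesis unfolding P_def by simp
  qed
  then show ?thesis using integrable_uniform_limit[of a b g] by simp
qed

definition rd_continuous_on_scale :: "real set \<Rightarrow> (real \<Rightarrow> real) \<Rightarrow> bool" where
  "rd_continuous_on_scale T f \<longleftrightarrow> (\<forall>t\<in>T. \<forall>A\<in>rd_filters T t. \<exists>l. (f \<longlongrightarrow> l) A)"

text \<open>The least point makes every \<open>T \<inter> {..c}\<close> compact and gives every real
  beyond \<open>t0\<close> a largest point of \<open>T\<close> below it.\<close>

locale time_scale_ray =
  fixes T :: "real set" and t0 :: real
  assumes closed: "closed T" and start: "t0 \<in> T" and start_le: "t \<in> T \<Longrightarrow> t0 \<le> t"
begin

definition floor_scale :: "real \<Rightarrow> real" where
  "floor_scale s = Sup {t \<in> T. t \<le> s}"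

lemma floor_scale_upper: "t \<in> T \<Longrightarrow> t \<le> s \<Longrightarrow> t \<le> floor_scale s"
  unfolding floor_scale_def by (rule cSup_upper) (auto intro: bdd_aboveI[of _ s])

lemma floor_scale_le: "t0 \<le> s \<Longrightarrow> floor_scale s \<le> s"
  unfolding floor_scale_def using start by (intro cSup_least) auto

lemma floor_scale_mem:
  assumes "t0 \<le> s" shows "floor_scale s \<in> T"
proof -
  have "floor_scale s \<in> closure {t \<in> T. t \<le> s}"
    unfolding floor_scale_def using start assms
    by (intro closure_contains_Sup) (auto intro: bdd_aboveI[of _ s])
  also have "\<dots> \<subseteq> closure T" by (rule closure_mono) auto
  finally show ?thesis using closed by simp
qed

lemma floor_scale_const:
  assumes "t0 \<le> s" "s \<le> s'" "\<And>t. t \<in> T \<Longrightarrow> s < t \<Longrightarrow> t \<le> s' \<Longrightarrow> False"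
  shows "floor_scale s' = floor_scale s"
proof (rule order.antisym)
  have "floor_scale s' \<le> s" using assms floor_scale_mem[of s'] floor_scale_le[of s']
    by (meson linorder_not_le order_trans)
  then show "floor_scale s' \<le> floor_scale s"
    using floor_scale_upper[of "floor_scale s'" s] floor_scale_mem[of s'] assms by auto
  show "floor_scale s \<le> floor_scale s'"
    using floor_scale_upper[of "floor_scale s" s'] floor_scale_mem[of s] floor_scale_le[of s] assms by auto
qed

lemma floor_scale_eq: "t \<in> T \<Longrightarrow> floor_scale t = t"
  using floor_scale_upper[of t t] floor_scale_le[of t] start_le[of t] by simp

lemma floor_scale_sigma: "t \<in> T \<Longrightarrow> t \<le> s \<Longrightarrow> s < sigma T t \<Longrightarrow> floor_scale s = t"
  using floor_scale_const[of t s] floor_scale_eq[of t] start_le[of t] sigma_le[of _ T t] by force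

lemma rd_continuous_at_right_dense:
  assumes f: "rd_continuous_on_scale T f" and t: "t \<in> T" "sigma T t = t" and \<epsilon>: "0 < \<epsilon>"
  shows "\<exists>\<delta>>0. \<forall>s\<in>T. \<bar>s - t\<bar> < \<delta> \<longrightarrow> \<bar>f s - f t\<bar> < \<epsilon>"
proof -
  have "inf (nhds t) (principal T) \<in> rd_filters T t"
    using t(2) by (simp add: rd_filters_def right_dense_def)
  then obtain P where P: "eventually P (inf (nhds t) (principal T))"
      "\<And>x y. P x \<Longrightarrow> P y \<Longrightarrow> \<bar>f x - f y\<bar> < \<epsilon>"
    using f t(1) \<epsilon> unfolding rd_continuous_on_scale_def convergent_along_iff_cauchy by blast
  obtain \<delta> where \<delta>: "\<delta> > 0" "\<forall>s. dist s t < \<delta> \<longrightarrow> s \<in> T \<longrightarrow> P s"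
    using P(1) unfolding eventually_inf_principal eventually_nhds_metric by blast
  then have "P t" using t(1) by simp
  then show ?thesis using P(2) \<delta> by (auto simp: dist_real_def intro!: exI[of _ \<delta>])
qed

text \<open>On each side of \<open>x\<close> there are two cases. Either \<open>T\<close> has a gap
  next to \<open>x\<close>, where the extended function is constant, or \<open>T\<close> accumulates
  at \<open>x\<close> from that side; then \<open>x\<close> belongs to the closed set
  \<open>T\<close> and the limit of \<open>f\<close> there applies.\<close>

lemma rd_continuous_floor_one_sided:
  assumes f: "rd_continuous_on_scale T f" and x: "t0 \<le> x" and \<epsilon>: "0 < \<epsilon>"
  shows "\<exists>\<delta>>0.
      (\<forall>s\<in>{x - \<delta><..<x} \<inter> {t0..}. \<forall>s'\<in>{x - \<delta><..<x} \<inter> {t0..}.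
        \<bar>f (floor_scale s) - f (floor_scale s')\<bar> \<le> \<epsilon>) \<and>
      (\<forall>s\<in>{x<..<x + \<delta>}. \<forall>s'\<in>{x<..<x + \<delta>}. \<bar>f (floor_scale s) - f (floor_scale s')\<bar> \<le> \<epsilon>)"
proof -
  obtain d1 where d1: "d1 > 0" "\<And>s s'. x < s \<Longrightarrow> s < x + d1 \<Longrightarrow> x < s' \<Longrightarrow> s' < x + d1 \<Longrightarrow>
      \<bar>f (floor_scale s) - f (floor_scale s')\<bar> \<le> \<epsilon>"
  proof (cases "\<exists>d>0. T \<inter> {x<..<x + d} = {}")
    case True
    then obtain d where d: "d > 0" "T \<inter> {x<..<x + d} = {}" by blast
    have "floor_scale s = floor_scale x" if "x < s" "s < x + d" for s
      by (rule floor_scale_const) (use that d x in auto)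
    then show ?thesis using d(1) \<epsilon> by (intro that[of d]) auto
  next
    case False
    have near: "\<exists>t\<in>T. x < t \<and> t < x + d" if "d > 0" for d
    proof -
      have "T \<inter> {x<..<x + d} \<noteq> {}" using False that by blast
      then show ?thesis by auto
    qed
    have "x \<in> closure T"
      unfolding closure_approachable
    proof (intro allI impI)
      fix e :: real assume "e > 0"
      then obtain t where "t \<in> T" "x < t" "t < x + e" using near by blast
      then show "\<exists>y\<in>T. dist y x < e" by (intro bexI[of _ t]) (auto simp: dist_real_def)
    qed
    then have xT: "x \<in> T" using closure_closed[OF closed] by simp
    have "sigma T x = x"
    proof (rule ccontr)
      assume "sigma T x \<noteq> x"
      then have "sigma T x - x > 0" using sigma_ge[of x T] by simp
      then obtain t where "t \<in> T" "x < t" "t < x + (sigma T x - x)" using near by blast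
      then show False using sigma_le[of t T x] by simp
    qed
    then obtain d where d: "d > 0" "\<And>s. s \<in> T \<Longrightarrow> \<bar>s - x\<bar> < d \<Longrightarrow> \<bar>f s - f x\<bar> < \<epsilon> / 2"
      using rd_continuous_at_right_dense[OF f xT, of "\<epsilon> / 2"] \<epsilon> by auto
    have "\<bar>f (floor_scale s) - f x\<bar> < \<epsilon> / 2" if "x < s" "s < x + d" for s
      by (rule d(2)) (use that x floor_scale_mem[of s] floor_scale_le[of s] floor_scale_upper[OF xT, of s] in auto)
    then have "\<bar>f (floor_scale s) - f (floor_scale s')\<bar> \<le> \<epsilon>"
      if "x < s" "s < x + d" "x < s'" "s' < x + d" for s s'
      using that by (smt (verit) field_sum_of_halves)
    then show ?thesis using d(1) by (intro that[of d]) auto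
  qed
  obtain d2 where d2: "d2 > 0" "\<And>s s'. t0 \<le> s \<Longrightarrow> x - d2 < s \<Longrightarrow> s < x \<Longrightarrow> t0 \<le> s' \<Longrightarrow> x - d2 < s' \<Longrightarrow> s' < x \<Longrightarrow>
      \<bar>f (floor_scale s) - f (floor_scale s')\<bar> \<le> \<epsilon>"
  proof (cases "\<exists>d>0. T \<inter> {x - d<..<x} = {}")
    case True
    then obtain d where d: "d > 0" "T \<inter> {x - d<..<x} = {}" by blast
    have eq: "floor_scale s' = floor_scale s" if "t0 \<le> s" "x - d < s" "s \<le> s'" "s' < x" for s s'
      by (rule floor_scale_const) (use that d in auto)
    have "\<bar>f (floor_scale s) - f (floor_scale s')\<bar> \<le> \<epsilon>"
      if "t0 \<le> s" "x - d < s" "s < x" "t0 \<le> s'" "x - d < s'" "s' < x" for s s'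
    proof (cases "s \<le> s'")
      case True
      then show ?thesis using eq[of s s'] that \<epsilon> by simp
    next
      case False
      then show ?thesis using eq[of s' s] that \<epsilon> by simp
    qed
    then show ?thesis by (intro that[of d] d(1))
  next
    case False
    have near: "\<exists>t\<in>T. x - d < t \<and> t < x" if "d > 0" for d
    proof -
      have "T \<inter> {x - d<..<x} \<noteq> {}" using False that by blast
      then show ?thesis by auto
    qed
    have ld: "left_dense T x" by (rule left_denseI) (rule near)
    have "x \<in> closure T"
      unfolding closure_approachable
    proof (intro allI impI)
      fix e :: real assume "e > 0"
      then obtain t where "t \<in> T" "x - e < t" "t < x" using near by blast
      then show "\<exists>y\<in>T. dist y x < e" by (intro bexI[of _ t]) (auto simp: dist_real_def)
    qed
    then have xT: "x \<in> T" using closure_closed[OF closed] by simp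
    have "at x within (T \<inter> {..<x}) \<in> rd_filters T x" using ld by (simp add: rd_filters_def)
    then obtain P where P: "eventually P (at x within (T \<inter> {..<x}))"
        "\<And>x y. P x \<Longrightarrow> P y \<Longrightarrow> \<bar>f x - f y\<bar> < \<epsilon>"
      using f xT \<epsilon> unfolding rd_continuous_on_scale_def convergent_along_iff_cauchy by blast
    obtain d where d: "d > 0" "\<And>s. s \<in> T \<Longrightarrow> s < x \<Longrightarrow> x - d < s \<Longrightarrow> P s"
      using P(1) unfolding eventually_at by (force simp: dist_real_def)
    \<comment> \<open>A point of \<open>T\<close> inside the window prevents
      \<open>floor_scale s\<close> from dropping out of it, while
      \<open>floor_scale s \<le> s < x\<close> keeps it strictly to the left of
      \<open>x\<close>.\<close>
    obtain t where t: "t \<in> T" "x - d < t" "t < x" using near d(1) by blast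
    have "P (floor_scale s)" if "t < s" "s < x" for s
      using that t start_le[of t] floor_scale_mem[of s] floor_scale_le[of s] floor_scale_upper[of t s]
      by (intro d(2)) auto
    then show ?thesis using t P(2) by (intro that[of "x - t"]) (auto intro: less_imp_le)
  qed
  show ?thesis using d1 d2 by (intro exI[of _ "min d1 d2"]) auto
qed

text \<open>The antiderivative is the ordinary integral of \<open>f\<close> extended to the gaps of \<open>T\<close> by its value at
  the left end of the gap.\<close>

lemma rd_antiderivative_exists:
  assumes f: "rd_continuous_on_scale T f"
  shows "\<exists>\<Phi>. \<forall>t\<in>kappa T. has_delta_derivative T \<Phi> (f t) t"
proof -
  define g where "g s = f (floor_scale s)" for s
  have int: "g integrable_on {r..s}" if "t0 \<le> r" for r s
  proof (cases "r \<le> s")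
    case True
    show ?thesis
    proof (rule one_sided_limits_imp_integrable[OF True])
      fix x \<epsilon> :: real assume x: "x \<in> {r..s}" and \<epsilon>: "0 < \<epsilon>"
      have "t0 \<le> x" using that x by simp
      then obtain \<delta> where "\<delta> > 0"
        "\<forall>p\<in>{x - \<delta><..<x} \<inter> {t0..}. \<forall>q\<in>{x - \<delta><..<x} \<inter> {t0..}. \<bar>g p - g q\<bar> \<le> \<epsilon>"
        "\<forall>p\<in>{x<..<x + \<delta>}. \<forall>q\<in>{x<..<x + \<delta>}. \<bar>g p - g q\<bar> \<le> \<epsilon>"
        using rd_continuous_floor_one_sided[OF f _ \<epsilon>, of x] unfolding g_def by blast
      then show "\<exists>\<delta>>0.
        (\<forall>p\<in>{x - \<delta><..<x} \<inter> {r..s}. \<forall>q\<in>{x - \<delta><..<x} \<inter> {r..s}. \<bar>g p - g q\<bar> \<le> \<epsilon>) \<and>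
        (\<forall>p\<in>{x<..<x + \<delta>} \<inter> {r..s}. \<forall>q\<in>{x<..<x + \<delta>} \<inter> {r..s}. \<bar>g p - g q\<bar> \<le> \<epsilon>)"
        using that by (intro exI[of _ \<delta>]) auto
    qed
  qed (simp add: integrable_on_empty)
  define \<Phi> where "\<Phi> s = integral {t0..s} g" for s
  have inc: "\<Phi> s - \<Phi> r = integral {r..s} g" if "t0 \<le> r" "r \<le> s" for r s
    using Henstock_Kurzweil_Integration.integral_combine[of t0 r s g] that int
    by (simp add: \<Phi>_def)
  \<comment> \<open>The right end is exempt from the condition on \<open>g\<close>: at
    \<open>s = sigma T t\<close> the extension already has the value \<open>f (sigma T t)\<close>.
    One point does not affect the integral.\<close>
  have bound: "\<bar>\<Phi> s - \<Phi> r - c * (s - r)\<bar> \<le> \<epsilon> * (s - r)"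
    if rs: "t0 \<le> r" "r \<le> s" and \<epsilon>: "0 \<le> \<epsilon>" and g: "\<And>p. r \<le> p \<Longrightarrow> p < s \<Longrightarrow> \<bar>g p - c\<bar> \<le> \<epsilon>" for r s c \<epsilon>
  proof -
    have "((\<lambda>p. g p - c) has_integral (integral {r..s} g - (s - r) * c)) (cbox r s)"
      using has_integral_diff[OF integrable_integral[OF int[OF rs(1)], of s] has_integral_const_real[of c r s]] rs
      by simp
    then have "norm (integral {r..s} g - (s - r) * c) \<le> \<epsilon> * measure lborel (cbox r s)"
      by (rule has_integral_bound_spike_finite[OF \<epsilon> finite.insertI[OF finite.emptyI], of _ _ _ _ s])
        (use g in auto)
    then show ?thesis using rs inc by (simp add: mult.commute)
  qed
  have "has_delta_derivative T \<Phi> (f t) t" if t: "t \<in> kappa T" for t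
    unfolding has_delta_derivative_def
  proof (intro conjI allI impI t)
    fix \<epsilon> :: real assume \<epsilon>: "0 < \<epsilon>"
    have tT: "t \<in> T" using t kappa_subset by blast
    have t0: "t0 \<le> t" by (rule start_le[OF tT])
    show "\<exists>\<delta>>0. \<forall>s\<in>T. \<bar>s - t\<bar> < \<delta> \<longrightarrow>
        \<bar>\<Phi> (sigma T t) - \<Phi> s - f t * (sigma T t - s)\<bar> \<le> \<epsilon> * \<bar>sigma T t - s\<bar>"
    proof (cases "sigma T t = t")
      case True
      obtain \<delta> where \<delta>: "\<delta> > 0" "\<And>s. s \<in> T \<Longrightarrow> \<bar>s - t\<bar> < \<delta> \<Longrightarrow> \<bar>f s - f t\<bar> < \<epsilon>"
        using rd_continuous_at_right_dense[OF f tT True \<epsilon>] by blast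
      show ?thesis
      proof (intro exI[of _ \<delta>] conjI ballI impI \<delta>(1))
        fix s assume s: "s \<in> T" "\<bar>s - t\<bar> < \<delta>"
        show "\<bar>\<Phi> (sigma T t) - \<Phi> s - f t * (sigma T t - s)\<bar> \<le> \<epsilon> * \<bar>sigma T t - s\<bar>"
        proof (cases "s \<le> t")
          case le: True
          have "\<bar>\<Phi> t - \<Phi> s - f t * (t - s)\<bar> \<le> \<epsilon> * (t - s)"
          proof (rule bound)
            fix p assume p: "s \<le> p" "p < t"
            then show "\<bar>g p - f t\<bar> \<le> \<epsilon>" unfolding g_def
              using s start_le[OF s(1)] floor_scale_mem[of p] floor_scale_le[of p] floor_scale_upper[of s p]
              by (intro less_imp_le \<delta>(2)) auto
          qed (use start_le[OF s(1)] le \<epsilon> in auto)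
          then show ?thesis using True le by simp
        next
          case False
          have "\<bar>\<Phi> s - \<Phi> t - f t * (s - t)\<bar> \<le> \<epsilon> * (s - t)"
          proof (rule bound)
            fix p assume p: "t \<le> p" "p < s"
            then show "\<bar>g p - f t\<bar> \<le> \<epsilon>" unfolding g_def
              using s t0 floor_scale_mem[of p] floor_scale_le[of p] floor_scale_upper[OF tT, of p]
              by (intro less_imp_le \<delta>(2)) auto
          qed (use t0 False \<epsilon> in auto)
          moreover have "\<Phi> t - \<Phi> s - f t * (t - s) = - (\<Phi> s - \<Phi> t - f t * (s - t))" by algebra
          ultimately show ?thesis using True False by simp
        qed
      qed
    next
      case False
      then have sc: "t < sigma T t" using sigma_ge[of t T] by simp
      define \<mu> where "\<mu> = sigma T t - t"
      \<comment> \<open>The error is exactly \<open>0\<close>, since \<open>g\<close> equals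
        \<open>f t\<close> throughout the gap.\<close>
      have jump: "\<Phi> (sigma T t) - \<Phi> t = f t * (sigma T t - t)"
        using bound[of t "sigma T t" 0 "f t"] t0 sc floor_scale_sigma[OF tT] by (simp add: g_def)
      \<comment> \<open>To the left of \<open>t\<close> the increment \<open>sigma T t - s\<close>
        stays at least \<open>\<mu>\<close>, so continuity of \<open>\<Phi>\<close> at
        \<open>t\<close> already gives the derivative estimate.\<close>
      have "continuous_on {t0..t} \<Phi>"
        unfolding \<Phi>_def by (rule indefinite_integral_continuous_1[OF int]) simp
      then have "((\<lambda>s. \<Phi> s + f t * (t - s)) \<longlongrightarrow> \<Phi> t + f t * (t - t)) (at t within {t0..t})"
        using t0 by (intro tendsto_intros) (auto simp: continuous_on_def)
      then have "eventually (\<lambda>s. dist (\<Phi> s + f t * (t - s)) (\<Phi> t + f t * (t - t)) < \<epsilon> * \<mu>) (at t within {t0..t})"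
        by (rule tendstoD) (use \<epsilon> sc in \<open>simp add: \<mu>_def\<close>)
      then obtain d where d: "d > 0" "\<And>s. t0 \<le> s \<Longrightarrow> s < t \<Longrightarrow> \<bar>s - t\<bar> < d \<Longrightarrow>
          \<bar>\<Phi> s + f t * (t - s) - \<Phi> t\<bar> < \<epsilon> * \<mu>"
        unfolding eventually_at by (auto simp: dist_real_def)
      show ?thesis
      proof (intro exI[of _ "min d \<mu>"] conjI ballI impI)
        show "min d \<mu> > 0" using d(1) sc by (simp add: \<mu>_def)
        fix s assume s: "s \<in> T" "\<bar>s - t\<bar> < min d \<mu>"
        then have "\<not> t < s" using sigma_le[of s T t] by (auto simp: \<mu>_def)
        then consider "s = t" | "s < t" by linarith
        then show "\<bar>\<Phi> (sigma T t) - \<Phi> s - f t * (sigma T t - s)\<bar> \<le> \<epsilon> * \<bar>sigma T t - s\<bar>"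
        proof cases
          case 1
          then show ?thesis using jump \<epsilon> by simp
        next
          case 2
          have "\<bar>\<Phi> s + f t * (t - s) - \<Phi> t\<bar> < \<epsilon> * \<mu>" using d(2) 2 s start_le by auto
          moreover have "\<epsilon> * \<mu> \<le> \<epsilon> * \<bar>sigma T t - s\<bar>" using \<epsilon> 2 sc by (simp add: \<mu>_def)
          moreover have "\<Phi> (sigma T t) - \<Phi> s - f t * (sigma T t - s) = - (\<Phi> s + f t * (t - s) - \<Phi> t)"
            using jump by (simp add: algebra_simps)
          ultimately show ?thesis by linarith
        qed
      qed
    qed
  qed
  then show ?thesis by blast
qed

end


section \<open>The delta integral of rd-continuous functions\<close>

lemma rd_continuous_on_scale_const: "rd_continuous_on_scale T (\<lambda>_. c)"
  unfolding rd_continuous_on_scale_def by (blast intro: tendsto_const)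

lemma rd_continuous_on_scale_diff:
  "rd_continuous_on_scale T f \<Longrightarrow> rd_continuous_on_scale T g \<Longrightarrow> rd_continuous_on_scale T (\<lambda>t. f t - g t)"
  unfolding rd_continuous_on_scale_def by (blast intro: tendsto_diff)

lemma rd_continuous_on_scale_cmult:
  "rd_continuous_on_scale T f \<Longrightarrow> rd_continuous_on_scale T (\<lambda>t. c * f t)"
  unfolding rd_continuous_on_scale_def
proof (intro ballI)
  fix t A assume "\<forall>t\<in>T. \<forall>A\<in>rd_filters T t. \<exists>l. (f \<longlongrightarrow> l) A" "t \<in> T" "A \<in> rd_filters T t"
  then obtain l where "(f \<longlongrightarrow> l) A" by blast
  then have "((\<lambda>t. c * f t) \<longlongrightarrow> c * l) A" by (intro tendsto_intros)
  then show "\<exists>l. ((\<lambda>t. c * f t) \<longlongrightarrow> l) A" ..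
qed

lemma delta_integral_cong:
  assumes "\<And>t. t \<in> T \<Longrightarrow> f t = g t"
  shows "delta_integral T r s f = delta_integral T r s g"
proof -
  have "f t = g t" if "t \<in> kappa T" for t using assms that kappa_subset by blast
  then have "(\<forall>t\<in>kappa T. has_delta_derivative T \<Phi> (f t) t) \<longleftrightarrow>
      (\<forall>t\<in>kappa T. has_delta_derivative T \<Phi> (g t) t)" for \<Phi>
    by auto
  then show ?thesis by (simp add: delta_integral_def)
qed

context time_scale_ray
begin

lemma has_delta_derivative_integral:
  assumes f: "rd_continuous_on_scale T f" and r: "r \<in> T" and t: "t \<in> kappa T"
  shows "has_delta_derivative T (\<lambda>s. delta_integral T r s f) (f t) t"
proof -
  obtain \<Phi> where \<Phi>: "\<And>t. t \<in> kappa T \<Longrightarrow> has_delta_derivative T \<Phi> (f t) t"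
    using rd_antiderivative_exists[OF f] by blast
  have "has_delta_derivative T (\<lambda>s. \<Phi> s - \<Phi> r) (f t) t"
    using has_delta_derivative_diff[OF \<Phi>[OF t] has_delta_derivative_const[OF t, of "\<Phi> r"]] by simp
  then show ?thesis
    by (rule has_delta_derivative_cong[OF closed, rotated])
      (simp add: delta_integral_eq[OF closed r _ \<Phi>])
qed

lemma delta_integral_refl: "r \<in> T \<Longrightarrow> rd_continuous_on_scale T f \<Longrightarrow> delta_integral T r r f = 0"
  using delta_integral_eq[OF closed, of r r "\<lambda>s. delta_integral T r s f" f]
    has_delta_derivative_integral by simp

lemma delta_integral_combine:
  assumes f: "rd_continuous_on_scale T f" and "r \<in> T" "p \<in> T" "s \<in> T"
  shows "delta_integral T r p f + delta_integral T p s f = delta_integral T r s f"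
  using delta_integral_eq[OF closed assms(3,4), of "\<lambda>s. delta_integral T r s f" f]
    has_delta_derivative_integral[OF f assms(2)] by simp

lemma delta_integral_diff:
  assumes f: "rd_continuous_on_scale T f" and g: "rd_continuous_on_scale T g" and r: "r \<in> T" and s: "s \<in> T"
  shows "delta_integral T r s (\<lambda>t. f t - g t) = delta_integral T r s f - delta_integral T r s g"
  using delta_integral_eq[OF closed r s has_delta_derivative_diff[OF
      has_delta_derivative_integral[OF f r] has_delta_derivative_integral[OF g r]]]
    delta_integral_refl[OF r f] delta_integral_refl[OF r g] by simp

lemma delta_integral_cmult:
  assumes f: "rd_continuous_on_scale T f" and r: "r \<in> T" and s: "s \<in> T"
  shows "delta_integral T r s (\<lambda>t. c * f t) = c * delta_integral T r s f"
  using delta_integral_eq[OF closed r s has_delta_derivative_cmult[OF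
      has_delta_derivative_integral[OF f r]], of c]
    delta_integral_refl[OF r f] by simp

lemma delta_integral_const:
  assumes r: "r \<in> T" and s: "s \<in> T"
  shows "delta_integral T r s (\<lambda>t. c) = c * (s - r)"
  using delta_integral_eq[OF closed r s has_delta_derivative_cmult[OF has_delta_derivative_id], of c]
  by (simp add: algebra_simps)

lemma delta_integral_nonneg:
  assumes f: "rd_continuous_on_scale T f" and r: "r \<in> T" and s: "s \<in> T" "r \<le> s"
    and nn: "\<And>t. t \<in> T \<Longrightarrow> r \<le> t \<Longrightarrow> t \<le> s \<Longrightarrow> 0 \<le> f t"
  shows "0 \<le> delta_integral T r s f"
proof -
  have "delta_integral T r r f \<le> delta_integral T r s f"
    using kappa_subset
    by (intro delta_derivative_nonneg_imp_le[OF closed r s, of _ f] conjI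
        has_delta_derivative_integral[OF f r] nn) blast+
  then show ?thesis using delta_integral_refl[OF r f] by simp
qed

lemma delta_integral_mono:
  assumes f: "rd_continuous_on_scale T f" and g: "rd_continuous_on_scale T g"
    and r: "r \<in> T" and s: "s \<in> T" "r \<le> s"
    and le: "\<And>t. t \<in> T \<Longrightarrow> r \<le> t \<Longrightarrow> t \<le> s \<Longrightarrow> f t \<le> g t"
  shows "delta_integral T r s f \<le> delta_integral T r s g"
  using delta_integral_nonneg[OF rd_continuous_on_scale_diff[OF g f] r s] le
    delta_integral_diff[OF g f r s(1)] by simp

lemma delta_integral_abs_le:
  assumes f: "rd_continuous_on_scale T f" and g: "rd_continuous_on_scale T g"
    and r: "r \<in> T" and s: "s \<in> T" "r \<le> s"
    and le: "\<And>t. t \<in> T \<Longrightarrow> r \<le> t \<Longrightarrow> t \<le> s \<Longrightarrow> \<bar>f t\<bar> \<le> g t"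
  shows "\<bar>delta_integral T r s f\<bar> \<le> delta_integral T r s g"
proof -
  have "delta_integral T r s f \<le> delta_integral T r s g"
    using le by (intro delta_integral_mono f g r s) (fastforce simp: abs_le_iff)
  moreover have "delta_integral T r s (\<lambda>t. (- 1) * f t) \<le> delta_integral T r s g"
    using le by (intro delta_integral_mono rd_continuous_on_scale_cmult f g r s) (fastforce simp: abs_le_iff)
  ultimately show ?thesis unfolding delta_integral_cmult[OF f r s(1)] by simp
qed

lemma delta_integral_bound:
  assumes f: "rd_continuous_on_scale T f" and r: "r \<in> T" and s: "s \<in> T" "r \<le> s"
    and le: "\<And>t. t \<in> T \<Longrightarrow> r \<le> t \<Longrightarrow> t \<le> s \<Longrightarrow> \<bar>f t\<bar> \<le> B"
  shows "\<bar>delta_integral T r s f\<bar> \<le> B * (s - r)"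
  using delta_integral_abs_le[OF f rd_continuous_on_scale_const r s le] delta_integral_const[OF r s(1)]
  by simp

lemma delta_integral_abs_diff_le:
  assumes f: "rd_continuous_on_scale T f" and r: "r \<in> T" and s: "s \<in> T"
    and le: "\<And>t. t \<in> T \<Longrightarrow> min r s \<le> t \<Longrightarrow> t \<le> max r s \<Longrightarrow> \<bar>f t\<bar> \<le> B"
  shows "\<bar>delta_integral T r s f\<bar> \<le> B * \<bar>s - r\<bar>"
proof (cases "r \<le> s")
  case True
  then show ?thesis using delta_integral_bound[OF f r s True] le by simp
next
  case False
  moreover have "delta_integral T r s f = - delta_integral T s r f"
    using delta_integral_combine[OF f r s r] delta_integral_refl[OF r f] by simp
  ultimately show ?thesis using delta_integral_bound[OF f s r] le by simp
qed

lemma compact_atMost: "compact (T \<inter> {..c})"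
proof -
  have "T \<inter> {..c} = T \<inter> {t0..c}" using start_le by auto
  moreover have "compact (T \<inter> {t0..c})" by (intro closed_Int_compact closed compact_Icc)
  ultimately show ?thesis by simp
qed

end


section \<open>Rd-continuity in two scale variables\<close>

text \<open>An event of a product filter contains a box, so the oscillation condition splits into
  one event per variable. A later estimate can then sharpen the event of one variable and leave the
  others alone.\<close>

lemma rd_continuous2_iff_cauchy:
  "rd_continuous2 X Y W f \<longleftrightarrow>
   (\<forall>x\<in>X. \<forall>y\<in>Y. \<forall>w\<in>W. \<forall>A\<in>rd_filters X x. \<forall>B\<in>rd_filters Y y. \<forall>\<epsilon>>0.
      \<exists>P Q R. eventually P A \<and> eventually Q B \<and> eventually R (inf (nhds w) (principal W)) \<and>
        (\<forall>s s' t t' v v'. P s \<longrightarrow> P s' \<longrightarrow> Q t \<longrightarrow> Q t' \<longrightarrow> R v \<longrightarrow> R v' \<longrightarrow> \<bar>f s t v - f s' t' v'\<bar> < \<epsilon>))"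
proof -
  have "(\<exists>l. ((\<lambda>(s, t, v). f s t v) \<longlongrightarrow> l) (prod_filter A (prod_filter B N))) \<longleftrightarrow>
    (\<forall>\<epsilon>>0. \<exists>P Q R. eventually P A \<and> eventually Q B \<and> eventually R N \<and>
      (\<forall>s s' t t' v v'. P s \<longrightarrow> P s' \<longrightarrow> Q t \<longrightarrow> Q t' \<longrightarrow> R v \<longrightarrow> R v' \<longrightarrow> \<bar>f s t v - f s' t' v'\<bar> < \<epsilon>))"
    (is "_ \<longleftrightarrow> ?R") for A B N
    unfolding convergent_along_iff_cauchy
  proof (intro iffI allI impI)
    fix \<epsilon> :: real
    assume "\<epsilon> > 0" and "\<forall>\<epsilon>>0. \<exists>P. eventually P (prod_filter A (prod_filter B N)) \<and>
       (\<forall>p q. P p \<longrightarrow> P q \<longrightarrow> \<bar>(case p of (s, t, v) \<Rightarrow> f s t v) - (case q of (s, t, v) \<Rightarrow> f s t v)\<bar> < \<epsilon>)"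
    then obtain U where "eventually U (prod_filter A (prod_filter B N))"
      and U: "\<And>p q. U p \<Longrightarrow> U q \<Longrightarrow> \<bar>(case p of (s, t, v) \<Rightarrow> f s t v) - (case q of (s, t, v) \<Rightarrow> f s t v)\<bar> < \<epsilon>"
      by blast
    then obtain P V where P: "eventually P A" and V: "eventually V (prod_filter B N)"
      and PV: "\<And>s p. P s \<Longrightarrow> V p \<Longrightarrow> U (s, p)"
      unfolding eventually_prod_filter[of U] by blast
    then obtain Q R where Q: "eventually Q B" and R: "eventually R N"
      and QR: "\<And>t v. Q t \<Longrightarrow> R v \<Longrightarrow> V (t, v)"
      unfolding eventually_prod_filter[of V] by blast
    have "\<bar>f s t v - f s' t' v'\<bar> < \<epsilon>" if "P s" "P s'" "Q t" "Q t'" "R v" "R v'" for s s' t t' v v'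
      using U[of "(s, t, v)" "(s', t', v')"] PV QR that by simp
    then show "\<exists>P Q R. eventually P A \<and> eventually Q B \<and> eventually R N \<and>
      (\<forall>s s' t t' v v'. P s \<longrightarrow> P s' \<longrightarrow> Q t \<longrightarrow> Q t' \<longrightarrow> R v \<longrightarrow> R v' \<longrightarrow> \<bar>f s t v - f s' t' v'\<bar> < \<epsilon>)"
      using P Q R by blast
  next
    fix \<epsilon> :: real
    assume "\<epsilon> > 0" and ?R
    then obtain P Q R where P: "eventually P A" and Q: "eventually Q B" and R: "eventually R N"
      and PQR: "\<And>s s' t t' v v'. P s \<Longrightarrow> P s' \<Longrightarrow> Q t \<Longrightarrow> Q t' \<Longrightarrow> R v \<Longrightarrow> R v' \<Longrightarrow>
        \<bar>f s t v - f s' t' v'\<bar> < \<epsilon>"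
      by blast
    have "eventually (\<lambda>p. P (fst p) \<and> Q (fst (snd p)) \<and> R (snd (snd p))) (prod_filter A (prod_filter B N))"
      using eventually_prodI[OF P eventually_prodI[OF Q R]] by simp
    then show "\<exists>P. eventually P (prod_filter A (prod_filter B N)) \<and>
       (\<forall>p q. P p \<longrightarrow> P q \<longrightarrow> \<bar>(case p of (s, t, v) \<Rightarrow> f s t v) - (case q of (s, t, v) \<Rightarrow> f s t v)\<bar> < \<epsilon>)"
      by (intro exI[of _ "\<lambda>p. P (fst p) \<and> Q (fst (snd p)) \<and> R (snd (snd p))"] conjI) (auto intro!: PQR)
  qed
  then show ?thesis unfolding rd_continuous2_def by simp
qed

lemma rd_continuous2_cauchyD:
  assumes "rd_continuous2 X Y W f" "x \<in> X" "y \<in> Y" "w \<in> W" "A \<in> rd_filters X x" "B \<in> rd_filters Y y" "0 < \<epsilon>"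
  obtains P Q R where "eventually P A" "eventually Q B" "eventually R (inf (nhds w) (principal W))"
    "\<And>s s' t t' v v'. P s \<Longrightarrow> P s' \<Longrightarrow> Q t \<Longrightarrow> Q t' \<Longrightarrow> R v \<Longrightarrow> R v' \<Longrightarrow> \<bar>f s t v - f s' t' v'\<bar> < \<epsilon>"
proof -
  have "\<exists>P Q R. eventually P A \<and> eventually Q B \<and> eventually R (inf (nhds w) (principal W)) \<and>
        (\<forall>s s' t t' v v'. P s \<longrightarrow> P s' \<longrightarrow> Q t \<longrightarrow> Q t' \<longrightarrow> R v \<longrightarrow> R v' \<longrightarrow> \<bar>f s t v - f s' t' v'\<bar> < \<epsilon>)"
    using assms(1)[unfolded rd_continuous2_iff_cauchy, rule_format, OF assms(2-7)] .
  then show ?thesis using that by (elim exE conjE) blast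
qed

lemma rd_continuous2_cauchyI:
  assumes "\<And>x y w A B \<epsilon>. x \<in> X \<Longrightarrow> y \<in> Y \<Longrightarrow> w \<in> W \<Longrightarrow> A \<in> rd_filters X x \<Longrightarrow> B \<in> rd_filters Y y \<Longrightarrow> 0 < \<epsilon> \<Longrightarrow>
    \<exists>P Q R. eventually P A \<and> eventually Q B \<and> eventually R (inf (nhds w) (principal W)) \<and>
        (\<forall>s s' t t' v v'. P s \<longrightarrow> P s' \<longrightarrow> Q t \<longrightarrow> Q t' \<longrightarrow> R v \<longrightarrow> R v' \<longrightarrow> \<bar>f s t v - f s' t' v'\<bar> < (\<epsilon>::real))"
  shows "rd_continuous2 X Y W f"
  unfolding rd_continuous2_iff_cauchy by (intro ballI allI impI assms)

text \<open>The Cauchy form is symmetric in the two scale variables, so sections, integrals and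
  cut-offs need to be treated in one of them only.\<close>

lemma rd_continuous2_swap:
  assumes f: "rd_continuous2 X Y W f"
  shows "rd_continuous2 Y X W (\<lambda>y x w. f x y w)"
proof (rule rd_continuous2_cauchyI)
  fix y x w B A and \<epsilon> :: real
  assume a: "y \<in> Y" "x \<in> X" "w \<in> W" "B \<in> rd_filters Y y" "A \<in> rd_filters X x" "0 < \<epsilon>"
  obtain P Q R where "eventually P A" "eventually Q B" "eventually R (inf (nhds w) (principal W))"
    "\<And>s s' t t' v v'. P s \<Longrightarrow> P s' \<Longrightarrow> Q t \<Longrightarrow> Q t' \<Longrightarrow> R v \<Longrightarrow> R v' \<Longrightarrow> \<bar>f s t v - f s' t' v'\<bar> < \<epsilon>"
    by (rule rd_continuous2_cauchyD[OF f a(2,1,3,5,4,6)]) blast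
  then show "\<exists>Q P R. eventually Q B \<and> eventually P A \<and> eventually R (inf (nhds w) (principal W)) \<and>
      (\<forall>t t' s s' v v'. Q t \<longrightarrow> Q t' \<longrightarrow> P s \<longrightarrow> P s' \<longrightarrow> R v \<longrightarrow> R v' \<longrightarrow> \<bar>f s t v - f s' t' v'\<bar> < \<epsilon>)"
    by (intro exI[of _ Q] exI[of _ P] exI[of _ R]) simp
qed

lemma eventually_nhds_point: "w \<in> W \<Longrightarrow> eventually R (inf (nhds w) (principal W)) \<Longrightarrow> R w"
  by (auto simp: eventually_inf_principal dest: eventually_nhds_x_imp_x)

lemma rd_continuous2_section2:
  assumes f: "rd_continuous2 X Y W f" and x: "x \<in> X" and w: "w \<in> W"
  shows "rd_continuous_on_scale Y (\<lambda>y. f x y w)"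
  unfolding rd_continuous_on_scale_def convergent_along_iff_cauchy
proof (intro ballI allI impI)
  fix y B and \<epsilon> :: real assume a: "y \<in> Y" "B \<in> rd_filters Y y" "0 < \<epsilon>"
  obtain A where A: "A \<in> rd_filters X x" "\<And>P. eventually P A \<Longrightarrow> P x"
    using rd_filters_point[OF x] by blast
  obtain P Q R where 1: "eventually P A" "eventually Q B" "eventually R (inf (nhds w) (principal W))"
    and 2: "\<And>s s' t t' v v'. P s \<Longrightarrow> P s' \<Longrightarrow> Q t \<Longrightarrow> Q t' \<Longrightarrow> R v \<Longrightarrow> R v' \<Longrightarrow> \<bar>f s t v - f s' t' v'\<bar> < \<epsilon>"
    by (rule rd_continuous2_cauchyD[OF f x a(1) w A(1) a(2,3)]) blast
  have "P x" "R w" using 1 A(2) eventually_nhds_point[OF w] by auto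
  then show "\<exists>Q. eventually Q B \<and> (\<forall>t t'. Q t \<longrightarrow> Q t' \<longrightarrow> \<bar>f x t w - f x t' w\<bar> < \<epsilon>)"
    using 1 2 by (intro exI[of _ Q]) simp
qed

lemma rd_continuous2_section1:
  assumes "rd_continuous2 X Y W f" "y \<in> Y" "w \<in> W"
  shows "rd_continuous_on_scale X (\<lambda>x. f x y w)"
  by (rule rd_continuous2_section2[OF rd_continuous2_swap[OF assms(1)] assms(2,3)])

lemma rd_continuous2_section3:
  fixes f :: "real \<Rightarrow> real \<Rightarrow> 'w::topological_space \<Rightarrow> real"
  assumes f: "rd_continuous2 X Y W f" and x: "x \<in> X" and y: "y \<in> Y"
  shows "continuous_on W (f x y)"
  unfolding continuous_on_def
proof (intro ballI tendstoI)
  fix w and \<epsilon> :: real assume w: "w \<in> W" and \<epsilon>: "0 < \<epsilon>"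
  obtain A where A: "A \<in> rd_filters X x" "\<And>P. eventually P A \<Longrightarrow> P x"
    using rd_filters_point[OF x] by blast
  obtain B where B: "B \<in> rd_filters Y y" "\<And>P. eventually P B \<Longrightarrow> P y"
    using rd_filters_point[OF y] by blast
  obtain P Q R where 1: "eventually P A" "eventually Q B" "eventually R (inf (nhds w) (principal W))"
    and 2: "\<And>s s' t t' v v'. P s \<Longrightarrow> P s' \<Longrightarrow> Q t \<Longrightarrow> Q t' \<Longrightarrow> R v \<Longrightarrow> R v' \<Longrightarrow> \<bar>f s t v - f s' t' v'\<bar> < \<epsilon>"
    by (rule rd_continuous2_cauchyD[OF f x y w A(1) B(1) \<epsilon>]) blast
  have "P x" "Q y" "R w" using 1 A(2) B(2) eventually_nhds_point[OF w] by auto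
  moreover have "at w within W \<le> inf (nhds w) (principal W)"
    unfolding at_within_def by (rule inf_mono) auto
  then have "eventually R (at w within W)" using 1(3) by (simp add: le_filter_def)
  ultimately show "eventually (\<lambda>v. dist (f x y v) (f x y w) < \<epsilon>) (at w within W)"
    using 2 by (auto simp: dist_real_def elim!: eventually_mono)
qed

lemma rd_continuous2_of_rd_continuous:
  assumes f: "rd_continuous X W f"
  shows "rd_continuous2 X Y W (\<lambda>x y w. f x w)"
proof (rule rd_continuous2_cauchyI)
  fix x y w A B and \<epsilon> :: real
  assume a: "x \<in> X" "y \<in> Y" "w \<in> W" "A \<in> rd_filters X x" "B \<in> rd_filters Y y" "0 < \<epsilon>"
  have "\<exists>l. ((\<lambda>(s, v). f s v) \<longlongrightarrow> l) (prod_filter A (inf (nhds w) (principal W)))"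
    using f a by (simp add: rd_continuous_def)
  then obtain U where U: "eventually U (prod_filter A (inf (nhds w) (principal W)))"
    "\<And>p q. U p \<Longrightarrow> U q \<Longrightarrow> \<bar>(case p of (s, v) \<Rightarrow> f s v) - (case q of (s, v) \<Rightarrow> f s v)\<bar> < \<epsilon>"
    unfolding convergent_along_iff_cauchy using a(6) by blast
  then obtain P R where 1: "eventually P A" "eventually R (inf (nhds w) (principal W))"
    and "\<And>s v. P s \<Longrightarrow> R v \<Longrightarrow> U (s, v)"
    unfolding eventually_prod_filter by blast
  then have "\<bar>f s v - f s' v'\<bar> < \<epsilon>" if "P s" "P s'" "R v" "R v'" for s s' v v'
    using U(2)[of "(s, v)" "(s', v')"] that by simp
  with 1 show "\<exists>P Q R. eventually P A \<and> eventually Q B \<and> eventually R (inf (nhds w) (principal W)) \<and>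
      (\<forall>s s' t t' v v'. P s \<longrightarrow> P s' \<longrightarrow> Q t \<longrightarrow> Q t' \<longrightarrow> R v \<longrightarrow> R v' \<longrightarrow> \<bar>f s v - f s' v'\<bar> < \<epsilon>)"
    by (intro exI[of _ P] exI[of _ "\<lambda>_. True"] exI[of _ R]) simp
qed

lemma rd_continuous2_compose2:
  assumes f: "rd_continuous2 X Y W f" and g: "rd_continuous2 X Y W g"
    and h: "continuous_on UNIV (\<lambda>p. h (fst p) (snd p))"
  shows "rd_continuous2 X Y W (\<lambda>x y w. h (f x y w) (g x y w))"
  unfolding rd_continuous2_def
proof (intro ballI)
  fix x y w A B
  assume "x \<in> X" "y \<in> Y" "w \<in> W" "A \<in> rd_filters X x" "B \<in> rd_filters Y y"
  then obtain l m where
    "((\<lambda>(s, t, v). f s t v) \<longlongrightarrow> l) (prod_filter A (prod_filter B (inf (nhds w) (principal W))))"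
    "((\<lambda>(s, t, v). g s t v) \<longlongrightarrow> m) (prod_filter A (prod_filter B (inf (nhds w) (principal W))))"
    using f g unfolding rd_continuous2_def by blast
  from continuous_on_tendsto_compose[OF h tendsto_Pair[OF this]]
  show "\<exists>l. ((\<lambda>(s, t, v). h (f s t v) (g s t v)) \<longlongrightarrow> l)
      (prod_filter A (prod_filter B (inf (nhds w) (principal W))))"
    by (intro exI[of _ "h l m"]) (simp add: case_prod_unfold)
qed

lemma rd_continuous2_add:
  "rd_continuous2 X Y W f \<Longrightarrow> rd_continuous2 X Y W g \<Longrightarrow> rd_continuous2 X Y W (\<lambda>x y w. f x y w + g x y w)"
  by (rule rd_continuous2_compose2) (auto intro!: continuous_intros)

lemma rd_continuous2_diff:
  "rd_continuous2 X Y W f \<Longrightarrow> rd_continuous2 X Y W g \<Longrightarrow> rd_continuous2 X Y W (\<lambda>x y w. f x y w - g x y w)"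
  by (rule rd_continuous2_compose2) (auto intro!: continuous_intros)

lemma rd_continuous2_mult:
  "rd_continuous2 X Y W f \<Longrightarrow> rd_continuous2 X Y W g \<Longrightarrow> rd_continuous2 X Y W (\<lambda>x y w. f x y w * g x y w)"
  by (rule rd_continuous2_compose2) (auto intro!: continuous_intros)

lemma rd_continuous2_abs:
  "rd_continuous2 X Y W f \<Longrightarrow> rd_continuous2 X Y W (\<lambda>x y w. \<bar>f x y w\<bar>)"
  by (rule rd_continuous2_compose2[of X Y W f f "\<lambda>u v. \<bar>u\<bar>"]) (auto intro!: continuous_intros)

lemma rd_continuous2_const: "rd_continuous2 X Y W (\<lambda>x y w. c)"
  by (auto simp: rd_continuous2_def case_prod_unfold intro: tendsto_const)

lemma rd_continuous2_eventually_mem: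
  assumes "x \<in> X" "y \<in> Y" "A \<in> rd_filters X x" "B \<in> rd_filters Y y"
  shows "eventually (\<lambda>p. fst p \<in> X \<and> fst (snd p) \<in> Y \<and> snd (snd p) \<in> W)
    (prod_filter A (prod_filter B (inf (nhds w) (principal W))))"
  using eventually_prodI[OF eventually_rd_filters_mem[OF assms(1,3)]
      eventually_prodI[OF eventually_rd_filters_mem[OF assms(2,4)], of "\<lambda>v. v \<in> W" "inf (nhds w) (principal W)"]]
  by (simp add: eventually_inf_principal)

lemma rd_continuous2_cong:
  assumes f: "rd_continuous2 X Y W f" and eq: "\<And>x y w. x \<in> X \<Longrightarrow> y \<in> Y \<Longrightarrow> w \<in> W \<Longrightarrow> f x y w = g x y w"
  shows "rd_continuous2 X Y W g"
  unfolding rd_continuous2_def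
proof (intro ballI)
  fix x y w A B
  assume a: "x \<in> X" "y \<in> Y" "w \<in> W" "A \<in> rd_filters X x" "B \<in> rd_filters Y y"
  then obtain l where
    "((\<lambda>(s, t, v). f s t v) \<longlongrightarrow> l) (prod_filter A (prod_filter B (inf (nhds w) (principal W))))"
    using f unfolding rd_continuous2_def by blast
  then have "((\<lambda>(s, t, v). g s t v) \<longlongrightarrow> l) (prod_filter A (prod_filter B (inf (nhds w) (principal W))))"
    by (rule Lim_transform_eventually)
      (rule eventually_mono[OF rd_continuous2_eventually_mem[OF a(1,2,4,5)]], auto simp: eq)
  then show "\<exists>l. ((\<lambda>(s, t, v). g s t v) \<longlongrightarrow> l) (prod_filter A (prod_filter B (inf (nhds w) (principal W))))" ..
qed

text \<open>The event for \<open>x\<close> is shrunk until all its points fall into the same branch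
  of the conditional.\<close>

lemma rd_continuous2_restrict_kappa:
  assumes f: "rd_continuous2 X Y W f"
  shows "rd_continuous2 X Y W (\<lambda>x y w. if x \<in> kappa X then f x y w else 0)"
proof (rule rd_continuous2_cauchyI)
  fix x y w A B and \<epsilon> :: real
  assume a: "x \<in> X" "y \<in> Y" "w \<in> W" "A \<in> rd_filters X x" "B \<in> rd_filters Y y" "0 < \<epsilon>"
  obtain P Q R where 1: "eventually P A" "eventually Q B" "eventually R (inf (nhds w) (principal W))"
    and 2: "\<And>s s' t t' v v'. P s \<Longrightarrow> P s' \<Longrightarrow> Q t \<Longrightarrow> Q t' \<Longrightarrow> R v \<Longrightarrow> R v' \<Longrightarrow> \<bar>f s t v - f s' t' v'\<bar> < \<epsilon>"
    by (rule rd_continuous2_cauchyD[OF f a]) blast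
  have "eventually (\<lambda>s. P s \<and> (s \<in> kappa X \<longleftrightarrow> x \<in> kappa X)) A"
    using 1(1) eventually_kappa_iff[OF a(1,4)] by (rule eventually_conj)
  then show "\<exists>P Q R. eventually P A \<and> eventually Q B \<and> eventually R (inf (nhds w) (principal W)) \<and>
      (\<forall>s s' t t' v v'. P s \<longrightarrow> P s' \<longrightarrow> Q t \<longrightarrow> Q t' \<longrightarrow> R v \<longrightarrow> R v' \<longrightarrow>
        \<bar>(if s \<in> kappa X then f s t v else 0) - (if s' \<in> kappa X then f s' t' v' else 0)\<bar> < \<epsilon>)"
    using 1 2 a(6)
    by (intro exI[of _ "\<lambda>s. P s \<and> (s \<in> kappa X \<longleftrightarrow> x \<in> kappa X)"] exI[of _ Q] exI[of _ R]) simp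
qed

lemma rd_continuous2_of_continuous:
  fixes f :: "real \<Rightarrow> real \<Rightarrow> 'w::topological_space \<Rightarrow> real"
  assumes f: "continuous_on (X \<times> Y \<times> W) (\<lambda>(x, y, w). f x y w)"
  shows "rd_continuous2 X Y W f"
  unfolding rd_continuous2_def
proof (intro ballI)
  fix x y w A B
  assume a: "x \<in> X" "y \<in> Y" "w \<in> W" "A \<in> rd_filters X x" "B \<in> rd_filters Y y"
  let ?E = "prod_filter A (prod_filter B (inf (nhds w) (principal W)))"
  have "?E \<le> prod_filter (nhds x) (prod_filter (nhds y) (nhds w))"
    using rd_filters_le[OF a(1,4)] rd_filters_le[OF a(2,5)]
    by (intro prod_filter_mono) auto
  then have "?E \<le> nhds (x, y, w)" by (simp add: nhds_prod)
  moreover have "eventually (\<lambda>p. p \<in> X \<times> Y \<times> W) ?E"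
    using rd_continuous2_eventually_mem[OF a(1,2,4,5)] by (rule eventually_mono) auto
  then have "?E \<le> principal (X \<times> Y \<times> W)" by (simp add: le_principal)
  ultimately have E: "?E \<le> inf (nhds (x, y, w)) (principal (X \<times> Y \<times> W))" by simp
  have "((\<lambda>(x, y, w). f x y w) \<longlongrightarrow> f x y w) (inf (nhds (x, y, w)) (principal (X \<times> Y \<times> W)))"
    unfolding tendsto_def
  proof (intro allI impI)
    fix S assume S: "open S" "f x y w \<in> S"
    have "eventually (\<lambda>p. (case p of (x, y, w) \<Rightarrow> f x y w) \<in> S) (at (x, y, w) within X \<times> Y \<times> W)"
      using f S a unfolding continuous_on_def tendsto_def by fastforce
    then show "eventually (\<lambda>p. (case p of (x, y, w) \<Rightarrow> f x y w) \<in> S) (inf (nhds (x, y, w)) (principal (X \<times> Y \<times> W)))"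
      unfolding eventually_at_filter eventually_inf_principal
      by (rule eventually_mono) (use S in auto)
  qed
  then show "\<exists>l. ((\<lambda>(s, t, v). f s t v) \<longlongrightarrow> l) ?E" using tendsto_mono[OF E] by blast
qed

text \<open>Maps along which an rd-continuous function on \<open>V\<close> pulls back to an rd-continuous function
  on \<open>W\<close>: they may have different limits along different approach filters, but all in \<open>V\<close>.\<close>

definition rd_limits ::
    "real set \<Rightarrow> real set \<Rightarrow> 'w::topological_space set \<Rightarrow> 'v::topological_space set
      \<Rightarrow> (real \<Rightarrow> real \<Rightarrow> 'w \<Rightarrow> 'v) \<Rightarrow> bool" where
  "rd_limits X Y W V \<phi> \<longleftrightarrow>
     (\<forall>x\<in>X. \<forall>y\<in>Y. \<forall>w\<in>W. \<phi> x y w \<in> V \<and>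
       (\<forall>A\<in>rd_filters X x. \<forall>B\<in>rd_filters Y y. \<exists>l\<in>V.
         ((\<lambda>p. \<phi> (fst p) (fst (snd p)) (snd (snd p))) \<longlongrightarrow> l)
            (prod_filter A (prod_filter B (inf (nhds w) (principal W))))))"

lemma rd_limits_of_rd_continuous2: "rd_continuous2 X Y W f \<Longrightarrow> rd_limits X Y W UNIV f"
  by (auto simp: rd_limits_def rd_continuous2_def case_prod_unfold)

lemma rd_limits_Pair:
  assumes f: "rd_limits X Y W V f" and g: "rd_limits X Y W V' g"
  shows "rd_limits X Y W (V \<times> V') (\<lambda>x y w. (f x y w, g x y w))"
  unfolding rd_limits_def
proof (intro ballI conjI)
  fix x y w A B
  assume a: "x \<in> X" "y \<in> Y" "w \<in> W"
  then show "(f x y w, g x y w) \<in> V \<times> V'" using f g by (simp add: rd_limits_def)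
  assume "A \<in> rd_filters X x" "B \<in> rd_filters Y y"
  then obtain l m where lm: "l \<in> V" "m \<in> V'"
    "((\<lambda>p. f (fst p) (fst (snd p)) (snd (snd p))) \<longlongrightarrow> l) (prod_filter A (prod_filter B (inf (nhds w) (principal W))))"
    "((\<lambda>p. g (fst p) (fst (snd p)) (snd (snd p))) \<longlongrightarrow> m) (prod_filter A (prod_filter B (inf (nhds w) (principal W))))"
    using f g a unfolding rd_limits_def by blast
  then show "\<exists>l\<in>V \<times> V'. ((\<lambda>p. (f (fst p) (fst (snd p)) (snd (snd p)), g (fst p) (fst (snd p)) (snd (snd p)))) \<longlongrightarrow> l)
      (prod_filter A (prod_filter B (inf (nhds w) (principal W))))"
    using tendsto_Pair[OF lm(3,4)] by (intro bexI[of _ "(l, m)"]) auto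
qed

lemma rd_limits_of_continuous:
  assumes h: "continuous_on W h" and V: "h ` W \<subseteq> V"
  shows "rd_limits X Y W V (\<lambda>x y w. h w)"
  unfolding rd_limits_def
proof (intro ballI conjI)
  fix x y w A B
  assume a: "x \<in> X" "y \<in> Y" "w \<in> W"
  then show "h w \<in> V" using V by auto
  have "(h \<longlongrightarrow> h w) (inf (nhds w) (principal W))"
    unfolding tendsto_def
  proof (intro allI impI)
    fix S assume S: "open S" "h w \<in> S"
    have "eventually (\<lambda>p. h p \<in> S) (at w within W)"
      using h S a unfolding continuous_on_def tendsto_def by fastforce
    then show "eventually (\<lambda>p. h p \<in> S) (inf (nhds w) (principal W))"
      unfolding eventually_at_filter eventually_inf_principal
      by (rule eventually_mono) (use S in auto)
  qed
  moreover have "filterlim (\<lambda>p. snd (snd p)) (inf (nhds w) (principal W))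
      (prod_filter A (prod_filter B (inf (nhds w) (principal W))))"
    by (rule filterlim_compose[OF filterlim_snd filterlim_snd])
  ultimately show "\<exists>l\<in>V. ((\<lambda>p. h (snd (snd p))) \<longlongrightarrow> l) (prod_filter A (prod_filter B (inf (nhds w) (principal W))))"
    using a V by (intro bexI[of _ "h w"]) (auto intro: filterlim_compose)
qed

text \<open>The limit \<open>l\<close> of \<open>\<phi>\<close> along the filters need not be its
  value at the point, so the limit of \<open>f\<close> is taken at \<open>l\<close>; for this reason
  \<open>rd_limits\<close> demands that \<open>l\<close> lie in \<open>V\<close>.\<close>

lemma rd_continuous2_compose:
  assumes f: "rd_continuous2 X Y V f" and \<phi>: "rd_limits X Y W V \<phi>"
  shows "rd_continuous2 X Y W (\<lambda>x y w. f x y (\<phi> x y w))"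
  unfolding rd_continuous2_def
proof (intro ballI)
  fix x y w A B
  assume a: "x \<in> X" "y \<in> Y" "w \<in> W" and AB: "A \<in> rd_filters X x" "B \<in> rd_filters Y y"
  let ?E = "prod_filter A (prod_filter B (inf (nhds w) (principal W)))"
  obtain l where l: "l \<in> V" "((\<lambda>p. \<phi> (fst p) (fst (snd p)) (snd (snd p))) \<longlongrightarrow> l) ?E"
    using \<phi> a AB unfolding rd_limits_def by blast
  obtain m where m: "((\<lambda>(s, t, v). f s t v) \<longlongrightarrow> m) (prod_filter A (prod_filter B (inf (nhds l) (principal V))))"
    using f a AB l(1) unfolding rd_continuous2_def by blast
  have "eventually (\<lambda>p. \<phi> (fst p) (fst (snd p)) (snd (snd p)) \<in> V) ?E"
    using rd_continuous2_eventually_mem[OF a(1,2) AB] by (rule eventually_mono) (use \<phi> in \<open>auto simp: rd_limits_def\<close>)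
  then have "filterlim (\<lambda>p. (fst p, fst (snd p), \<phi> (fst p) (fst (snd p)) (snd (snd p))))
      (prod_filter A (prod_filter B (inf (nhds l) (principal V)))) ?E"
    using l(2)
    by (intro filterlim_Pair filterlim_fst filterlim_compose[OF filterlim_fst filterlim_snd])
      (simp add: filterlim_inf filterlim_principal)
  from filterlim_compose[OF m this]
  show "\<exists>m. ((\<lambda>(s, t, v). f s t (\<phi> s t v)) \<longlongrightarrow> m) ?E"
    by (auto simp: case_prod_unfold)
qed

text \<open>The convergence is uniform only relative to \<open>e\<close>. But \<open>e\<close>
  oscillates by less than \<open>1\<close> on suitable events and is therefore bounded there, which
  makes the convergence uniform on these events; three errors of \<open>\<epsilon> / 4\<close> then
  remain.\<close>

lemma rd_continuous2_uniform_limit: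
  assumes f: "\<And>n. rd_continuous2 X Y W (f n)" and e: "rd_continuous2 X Y W e"
    and c: "c \<longlonglongrightarrow> 0"
    and le: "\<And>n x y w. x \<in> X \<Longrightarrow> y \<in> Y \<Longrightarrow> w \<in> W \<Longrightarrow> \<bar>f n x y w - g x y w\<bar> \<le> c n * e x y w"
  shows "rd_continuous2 X Y W g"
proof (rule rd_continuous2_cauchyI)
  fix x y w A B and \<epsilon> :: real
  assume a: "x \<in> X" "y \<in> Y" "w \<in> W" "A \<in> rd_filters X x" "B \<in> rd_filters Y y" "0 < \<epsilon>"
  obtain P1 Q1 R1 where e1: "eventually P1 A" "eventually Q1 B" "eventually R1 (inf (nhds w) (principal W))"
    and e2: "\<And>s s' t t' v v'. P1 s \<Longrightarrow> P1 s' \<Longrightarrow> Q1 t \<Longrightarrow> Q1 t' \<Longrightarrow> R1 v \<Longrightarrow> R1 v' \<Longrightarrow> \<bar>e s t v - e s' t' v'\<bar> < 1"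
    using rd_continuous2_cauchyD[OF e a(1-5), of 1] by auto
  obtain b where b: "b > 0" "\<And>s t v. P1 s \<Longrightarrow> Q1 t \<Longrightarrow> R1 v \<Longrightarrow> \<bar>e s t v\<bar> \<le> b"
  proof (cases "\<exists>s t v. P1 s \<and> Q1 t \<and> R1 v")
    case True
    then obtain s t v where stv: "P1 s" "Q1 t" "R1 v" by blast
    show ?thesis
    proof (rule that[of "\<bar>e s t v\<bar> + 1"])
      fix s' t' v' assume "P1 s'" "Q1 t'" "R1 v'"
      then show "\<bar>e s' t' v'\<bar> \<le> \<bar>e s t v\<bar> + 1" using e2[OF _ stv(1) _ stv(2) _ stv(3)] by fastforce
    qed simp
  next
    case False
    then show ?thesis by (intro that[of 1]) auto
  qed
  have "eventually (\<lambda>n. dist (c n) 0 < \<epsilon> / (4 * b)) sequentially"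
    by (rule tendstoD[OF c]) (use a(6) b(1) in simp)
  then obtain n where n: "\<bar>c n\<bar> < \<epsilon> / (4 * b)"
    using eventually_happens[of _ sequentially] by auto
  have nb: "\<bar>c n\<bar> * b < \<epsilon> / 4" using n b(1) by (simp add: field_simps)
  obtain P Q R where 1: "eventually P A" "eventually Q B" "eventually R (inf (nhds w) (principal W))"
    and 2: "\<And>s s' t t' v v'. P s \<Longrightarrow> P s' \<Longrightarrow> Q t \<Longrightarrow> Q t' \<Longrightarrow> R v \<Longrightarrow> R v' \<Longrightarrow> \<bar>f n s t v - f n s' t' v'\<bar> < \<epsilon> / 4"
    using rd_continuous2_cauchyD[OF f[of n] a(1-5), of "\<epsilon> / 4"] a(6) by auto
  define P' where "P' s \<longleftrightarrow> P s \<and> P1 s \<and> s \<in> X" for s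
  define Q' where "Q' s \<longleftrightarrow> Q s \<and> Q1 s \<and> s \<in> Y" for s
  define R' where "R' s \<longleftrightarrow> R s \<and> R1 s \<and> s \<in> W" for s
  have near: "\<bar>f n s t v - g s t v\<bar> < \<epsilon> / 4" if "P' s" "Q' t" "R' v" for s t v
  proof -
    have "\<bar>f n s t v - g s t v\<bar> \<le> c n * e s t v" using le that by (simp add: P'_def Q'_def R'_def)
    also have "\<dots> \<le> \<bar>c n\<bar> * \<bar>e s t v\<bar>" by (metis abs_ge_self abs_mult)
    also have "\<dots> \<le> \<bar>c n\<bar> * b"
      using b(2) that by (intro mult_left_mono) (auto simp: P'_def Q'_def R'_def)
    finally show ?thesis using nb by simp
  qed
  have "eventually P' A" "eventually Q' B" "eventually R' (inf (nhds w) (principal W))"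
    unfolding P'_def[abs_def] Q'_def[abs_def] R'_def[abs_def]
    using 1 e1 eventually_rd_filters_mem[OF a(1,4)] eventually_rd_filters_mem[OF a(2,5)]
    by (simp_all add: eventually_conj_iff) (simp add: eventually_inf_principal)
  moreover have "\<bar>g s t v - g s' t' v'\<bar> < \<epsilon>"
    if "P' s" "P' s'" "Q' t" "Q' t'" "R' v" "R' v'" for s s' t t' v v'
    using near[OF that(1,3,5)] near[OF that(2,4,6)] 2[of s s' t t' v v'] that a(6)
    unfolding P'_def Q'_def R'_def by linarith
  ultimately show "\<exists>P Q R. eventually P A \<and> eventually Q B \<and> eventually R (inf (nhds w) (principal W)) \<and>
      (\<forall>s s' t t' v v'. P s \<longrightarrow> P s' \<longrightarrow> Q t \<longrightarrow> Q t' \<longrightarrow> R v \<longrightarrow> R v' \<longrightarrow> \<bar>g s t v - g s' t' v'\<bar> < \<epsilon>)"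
    by (intro exI[of _ P'] exI[of _ Q'] exI[of _ R']) blast
qed


section \<open>Parameter integrals\<close>

text \<open>Heine-Borel in \<open>t\<close>, with the pairs of parameter points
  \<open>(s, v)\<close>, \<open>(s', v')\<close> as events. Both values of \<open>f\<close> are
  taken at the same \<open>t\<close>, because between different values of \<open>t\<close> the
  function may jump.\<close>

lemma rd_continuous2_uniform_on_compact_scale:
  assumes Y: "time_scale_ray Y y0" and f: "rd_continuous2 X Y W f"
    and x: "x \<in> X" and w: "w \<in> W" and A: "A \<in> rd_filters X x" and \<epsilon>: "0 < \<epsilon>"
  obtains P R where "eventually P A" "eventually R (inf (nhds w) (principal W))"
    "\<And>s s' t v v'. P s \<Longrightarrow> P s' \<Longrightarrow> R v \<Longrightarrow> R v' \<Longrightarrow> t \<in> Y \<Longrightarrow> t \<le> c \<Longrightarrow> \<bar>f s t v - f s' t v'\<bar> < \<epsilon>"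
proof -
  let ?N = "inf (nhds w) (principal W)"
  let ?E = "prod_filter (prod_filter A ?N) (prod_filter A ?N)"
  have "eventually (\<lambda>z. \<forall>t\<in>Y \<inter> {..c}. \<bar>f (fst (fst z)) t (snd (fst z)) - f (fst (snd z)) t (snd (snd z))\<bar> < \<epsilon>) ?E"
  proof (rule eventually_ball_compact)
    show "compact (Y \<inter> {..c})" by (rule time_scale_ray.compact_atMost[OF Y])
    fix t assume t: "t \<in> Y \<inter> {..c}"
    have "eventually (\<lambda>(z, t). \<bar>f (fst (fst z)) t (snd (fst z)) - f (fst (snd z)) t (snd (snd z))\<bar> < \<epsilon>)
        (prod_filter ?E (inf (nhds t) (principal Y)))"
    proof (rule eventually_prod_nhds_if_rd_filters)
      show tY: "t \<in> Y" using t by simp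
      fix B assume B: "B \<in> rd_filters Y t"
      obtain P Q R where 1: "eventually P A" "eventually Q B" "eventually R ?N"
        and 2: "\<And>s s' t t' v v'. P s \<Longrightarrow> P s' \<Longrightarrow> Q t \<Longrightarrow> Q t' \<Longrightarrow> R v \<Longrightarrow> R v' \<Longrightarrow> \<bar>f s t v - f s' t' v'\<bar> < \<epsilon>"
        by (rule rd_continuous2_cauchyD[OF f x tY w A B \<epsilon>]) blast
      from eventually_prodI[OF eventually_prodI[OF eventually_prodI[OF 1(1,3)] eventually_prodI[OF 1(1,3)]] 1(2)]
      show "eventually (\<lambda>(z, t). \<bar>f (fst (fst z)) t (snd (fst z)) - f (fst (snd z)) t (snd (snd z))\<bar> < \<epsilon>)
          (prod_filter ?E B)"
        by (rule eventually_mono) (auto intro!: 2)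
    qed
    moreover have "prod_filter ?E (inf (nhds t) (principal (Y \<inter> {..c}))) \<le> prod_filter ?E (inf (nhds t) (principal Y))"
      by (intro prod_filter_mono inf_mono) auto
    ultimately show "eventually (\<lambda>(z, t). \<bar>f (fst (fst z)) t (snd (fst z)) - f (fst (snd z)) t (snd (snd z))\<bar> < \<epsilon>)
        (prod_filter ?E (inf (nhds t) (principal (Y \<inter> {..c}))))"
      using le_filter_def by blast
  qed
  then obtain U where U: "eventually U (prod_filter A ?N)"
    and U2: "\<And>z z' t. U z \<Longrightarrow> U z' \<Longrightarrow> t \<in> Y \<inter> {..c} \<Longrightarrow> \<bar>f (fst z) t (snd z) - f (fst z') t (snd z')\<bar> < \<epsilon>"
    unfolding eventually_prod_same by auto
  obtain P R where ev: "eventually P A" "eventually R ?N" and PR: "\<And>s v. P s \<Longrightarrow> R v \<Longrightarrow> U (s, v)"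
    using U unfolding eventually_prod_filter by blast
  have "\<bar>f s t v - f s' t v'\<bar> < \<epsilon>"
    if "P s" "P s'" "R v" "R v'" "t \<in> Y" "t \<le> c" for s s' t v v'
    using U2[of "(s, v)" "(s', v')" t] PR that by simp
  then show thesis by (rule that[OF ev])
qed

text \<open>Along \<open>at_top\<close> the word eventually means for all sufficiently large bounds.
  Near each point such bounds come from the limits of \<open>f\<close>, and compactness makes them
  common.\<close>

lemma bounded_on_compact_scale:
  assumes Y: "time_scale_ray Y y0" and f: "rd_continuous_on_scale Y f"
  shows "\<exists>b. \<forall>t\<in>Y. t \<le> c \<longrightarrow> \<bar>f t\<bar> \<le> b"
proof -
  have "eventually (\<lambda>b. \<forall>t\<in>Y \<inter> {..c}. \<bar>f t\<bar> \<le> b) at_top"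
  proof (rule eventually_ball_compact)
    show "compact (Y \<inter> {..c})" by (rule time_scale_ray.compact_atMost[OF Y])
    fix t assume t: "t \<in> Y \<inter> {..c}"
    have "eventually (\<lambda>(b, t). \<bar>f t\<bar> \<le> b) (prod_filter at_top (inf (nhds t) (principal Y)))"
    proof (rule eventually_prod_nhds_if_rd_filters)
      show "t \<in> Y" using t by simp
      fix B assume B: "B \<in> rd_filters Y t"
      then obtain l where "(f \<longlongrightarrow> l) B"
        using f t unfolding rd_continuous_on_scale_def by blast
      then have "eventually (\<lambda>t. dist (f t) l < 1) B" by (rule tendstoD) simp
      from eventually_prodI[OF eventually_ge_at_top[of "\<bar>l\<bar> + 1"] this]
      show "eventually (\<lambda>(b, t). \<bar>f t\<bar> \<le> b) (prod_filter at_top B)"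
        by (rule eventually_mono) (auto simp: dist_real_def)
    qed
    moreover have "prod_filter at_top (inf (nhds t) (principal (Y \<inter> {..c}))) \<le>
        prod_filter (at_top :: real filter) (inf (nhds t) (principal Y))"
      by (intro prod_filter_mono inf_mono) auto
    ultimately show "eventually (\<lambda>(b, t). \<bar>f t\<bar> \<le> b) (prod_filter at_top (inf (nhds t) (principal (Y \<inter> {..c}))))"
      using le_filter_def by blast
  qed
  then have "\<exists>b. \<forall>t\<in>Y \<inter> {..c}. \<bar>f t\<bar> \<le> b"
    using eventually_happens trivial_limit_at_top_linorder by blast
  then show ?thesis by auto
qed

text \<open>A single section in \<open>t\<close> is bounded on the compact part of \<open>Y\<close>,
  and all sections with nearby parameters differ from it by less than \<open>1\<close>.\<close>

lemma rd_continuous2_locally_bounded: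
  assumes Y: "time_scale_ray Y y0" and f: "rd_continuous2 X Y W f"
    and x: "x \<in> X" and w: "w \<in> W" and A: "A \<in> rd_filters X x"
  obtains P R b where "eventually P A" "eventually R (inf (nhds w) (principal W))" "0 < b"
    "\<And>s t v. P s \<Longrightarrow> R v \<Longrightarrow> t \<in> Y \<Longrightarrow> t \<le> c \<Longrightarrow> \<bar>f s t v\<bar> \<le> b"
proof -
  obtain P R where P: "eventually P A" and R: "eventually R (inf (nhds w) (principal W))" and
    PR: "\<And>s s' t v v'. P s \<Longrightarrow> P s' \<Longrightarrow> R v \<Longrightarrow> R v' \<Longrightarrow> t \<in> Y \<Longrightarrow> t \<le> c \<Longrightarrow> \<bar>f s t v - f s' t v'\<bar> < 1"
    by (rule rd_continuous2_uniform_on_compact_scale[OF Y f x w A, of 1 c]) (simp, blast)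
  define P' where "P' s \<longleftrightarrow> P s \<and> s \<in> X" for s
  have P': "eventually P' A"
    unfolding P'_def[abs_def] using P eventually_rd_filters_mem[OF x A] by (rule eventually_conj)
  have Rw: "R w" by (rule eventually_nhds_point[OF w R])
  show thesis
  proof (cases "\<exists>s. P' s")
    case True
    then obtain s where s: "P s" "s \<in> X" by (auto simp: P'_def)
    obtain b where b: "\<And>t. t \<in> Y \<Longrightarrow> t \<le> c \<Longrightarrow> \<bar>f s t w\<bar> \<le> b"
      using bounded_on_compact_scale[OF Y rd_continuous2_section2[OF f s(2) w]] by blast
    show thesis
    proof (rule that[OF P' R, of "\<bar>b\<bar> + 1"])
      fix s' t v assume a: "P' s'" "R v" "t \<in> Y" "t \<le> c"
      then have "\<bar>f s' t v - f s t w\<bar> < 1" using PR[OF _ s(1) _ Rw] by (simp add: P'_def)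
      then show "\<bar>f s' t v\<bar> \<le> \<bar>b\<bar> + 1" using b[OF a(3,4)] by linarith
    qed simp
  next
    case False
    then show thesis using that[OF P' R, of 1] by auto
  qed
qed

lemma rd_continuous2_bounded_on_compact:
  assumes X: "time_scale_ray X x0" and Y: "time_scale_ray Y y0" and f: "rd_continuous2 X Y W f"
    and w: "w \<in> W"
  shows "\<exists>b>0. \<forall>s\<in>X. \<forall>t\<in>Y. s \<le> c \<longrightarrow> t \<le> d \<longrightarrow> \<bar>f s t w\<bar> \<le> b"
proof -
  have "eventually (\<lambda>b. \<forall>s\<in>X \<inter> {..c}. \<forall>t\<in>Y. t \<le> d \<longrightarrow> \<bar>f s t w\<bar> \<le> b) at_top"
  proof (rule eventually_ball_compact)
    show "compact (X \<inter> {..c})" by (rule time_scale_ray.compact_atMost[OF X])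
    fix s assume s: "s \<in> X \<inter> {..c}"
    have "eventually (\<lambda>(b, s). \<forall>t\<in>Y. t \<le> d \<longrightarrow> \<bar>f s t w\<bar> \<le> b) (prod_filter at_top (inf (nhds s) (principal X)))"
    proof (rule eventually_prod_nhds_if_rd_filters)
      show sX: "s \<in> X" using s by simp
      fix A assume A: "A \<in> rd_filters X s"
      obtain P R b where PR: "eventually P A" "eventually R (inf (nhds w) (principal W))"
        "\<And>s t v. P s \<Longrightarrow> R v \<Longrightarrow> t \<in> Y \<Longrightarrow> t \<le> d \<Longrightarrow> \<bar>f s t v\<bar> \<le> b"
        by (rule rd_continuous2_locally_bounded[OF Y f sX w A, of d]) blast
      have "R w" by (rule eventually_nhds_point[OF w PR(2)])
      from eventually_prodI[OF eventually_ge_at_top[of b] PR(1)]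
      show "eventually (\<lambda>(b, s). \<forall>t\<in>Y. t \<le> d \<longrightarrow> \<bar>f s t w\<bar> \<le> b) (prod_filter at_top A)"
        by (rule eventually_mono) (use PR(3) \<open>R w\<close> in fastforce)
    qed
    moreover have "prod_filter at_top (inf (nhds s) (principal (X \<inter> {..c}))) \<le>
        prod_filter (at_top :: real filter) (inf (nhds s) (principal X))"
      by (intro prod_filter_mono inf_mono) auto
    ultimately show "eventually (\<lambda>(b, s). \<forall>t\<in>Y. t \<le> d \<longrightarrow> \<bar>f s t w\<bar> \<le> b)
        (prod_filter at_top (inf (nhds s) (principal (X \<inter> {..c}))))"
      using le_filter_def by blast
  qed
  then have "eventually (\<lambda>b. 0 < b \<and> (\<forall>s\<in>X \<inter> {..c}. \<forall>t\<in>Y. t \<le> d \<longrightarrow> \<bar>f s t w\<bar> \<le> b)) at_top"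
    using eventually_conj[OF eventually_gt_at_top[of "0::real"]] by blast
  then have "\<exists>b. 0 < b \<and> (\<forall>s\<in>X \<inter> {..c}. \<forall>t\<in>Y. t \<le> d \<longrightarrow> \<bar>f s t w\<bar> \<le> b)"
    using eventually_happens trivial_limit_at_top_linorder by blast
  then show ?thesis by auto
qed

text \<open>First the integrand is changed, then the upper limit. The former costs at most
  \<open>\<epsilon> / 4\<close> by uniformity on a compact part of \<open>Y\<close>, the latter at
  most \<open>\<epsilon> / 2\<close> by local boundedness. Jumps of \<open>f\<close> in
  \<open>y\<close> do no harm, as \<open>y\<close> enters only through the interval of
  integration.\<close>

lemma rd_continuous2_delta_integral2:
  assumes Y: "time_scale_ray Y y0" and f: "rd_continuous2 X Y W f"
  shows "rd_continuous2 X Y W (\<lambda>x y w. delta_integral Y y0 y (\<lambda>t. f x t w))"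
proof (rule rd_continuous2_cauchyI)
  interpret Y: time_scale_ray Y y0 by (rule Y)
  fix x y w A B and \<epsilon> :: real
  assume a: "x \<in> X" "y \<in> Y" "w \<in> W" "A \<in> rd_filters X x" "B \<in> rd_filters Y y" "0 < \<epsilon>"
  \<comment> \<open>Only upper limits within distance \<open>1\<close> of \<open>y\<close> are
    compared, so no interval of integration is longer than \<open>L\<close>.\<close>
  define L where "L = y + 1 - y0"
  have L: "L \<ge> 1" using Y.start_le[OF a(2)] by (simp add: L_def)
  have \<epsilon>L: "0 < \<epsilon> / (4 * L)" using a(6) L by simp
  obtain P1 R1 where 1: "eventually P1 A" "eventually R1 (inf (nhds w) (principal W))"
    "\<And>s s' t v v'. P1 s \<Longrightarrow> P1 s' \<Longrightarrow> R1 v \<Longrightarrow> R1 v' \<Longrightarrow> t \<in> Y \<Longrightarrow> t \<le> y + 1 \<Longrightarrow> \<bar>f s t v - f s' t v'\<bar> < \<epsilon> / (4 * L)"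
    by (rule rd_continuous2_uniform_on_compact_scale[OF Y f a(1,3,4) \<epsilon>L, of "y + 1"]) blast
  obtain P2 R2 b where 2: "eventually P2 A" "eventually R2 (inf (nhds w) (principal W))" "0 < b"
    "\<And>s t v. P2 s \<Longrightarrow> R2 v \<Longrightarrow> t \<in> Y \<Longrightarrow> t \<le> y + 1 \<Longrightarrow> \<bar>f s t v\<bar> \<le> b"
    by (rule rd_continuous2_locally_bounded[OF Y f a(1,3,4), of "y + 1"]) blast
  \<comment> \<open>Two admissible upper limits are less than \<open>2 * d\<close> apart, and
    \<open>b * (2 * d)\<close> is at most \<open>\<epsilon> / 2\<close>.\<close>
  define d where "d = min 1 (\<epsilon> / (4 * b))"
  have d: "d > 0" using a(6) 2(3) by (simp add: d_def)
  define P where "P s \<longleftrightarrow> P1 s \<and> P2 s \<and> s \<in> X" for s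
  define Q where "Q t \<longleftrightarrow> t \<in> Y \<and> \<bar>t - y\<bar> < d" for t
  define R where "R v \<longleftrightarrow> R1 v \<and> R2 v \<and> v \<in> W" for v
  have ev: "eventually P A" "eventually Q B" "eventually R (inf (nhds w) (principal W))"
    unfolding P_def[abs_def] Q_def[abs_def] R_def[abs_def]
    using 1 2 eventually_rd_filters_mem[OF a(1,4)] eventually_rd_filters_mem[OF a(2,5)]
      eventually_rd_filters_near[OF a(2,5) d]
    by (simp_all add: eventually_conj_iff) (simp add: eventually_inf_principal)
  have "\<bar>delta_integral Y y0 t (\<lambda>t. f s t v) - delta_integral Y y0 t' (\<lambda>t. f s' t v')\<bar> < \<epsilon>"
    if h: "P s" "P s'" "Q t" "Q t'" "R v" "R v'" for s s' t t' v v'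
  proof -
    have t: "t \<in> Y" "t' \<in> Y" "t < y + 1" "t' < y + 1" "y0 \<le> t" "\<bar>t' - t\<bar> < 2 * d"
      using h Y.start_le by (auto simp: Q_def d_def)
    have g: "rd_continuous_on_scale Y (\<lambda>t. f s t v)" "rd_continuous_on_scale Y (\<lambda>t. f s' t v')"
      using rd_continuous2_section2[OF f] h by (auto simp: P_def R_def)
    have "\<bar>delta_integral Y y0 t (\<lambda>t. f s t v - f s' t v')\<bar> \<le> \<epsilon> / (4 * L) * (t - y0)"
      using t h by (intro Y.delta_integral_bound[OF rd_continuous_on_scale_diff[OF g] Y.start] less_imp_le[OF 1(3)])
        (auto simp: P_def R_def)
    also have "\<dots> \<le> \<epsilon> / (4 * L) * L" using t \<epsilon>L by (intro mult_left_mono) (auto simp: L_def)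
    also have "\<dots> = \<epsilon> / 4" using L by simp
    finally have i1: "\<bar>delta_integral Y y0 t (\<lambda>t. f s t v) - delta_integral Y y0 t (\<lambda>t. f s' t v')\<bar> \<le> \<epsilon> / 4"
      using Y.delta_integral_diff[OF g Y.start t(1)] by simp
    have "\<bar>delta_integral Y t t' (\<lambda>t. f s' t v')\<bar> \<le> b * \<bar>t' - t\<bar>"
      using t h by (intro Y.delta_integral_abs_diff_le[OF g(2) t(1,2)] 2(4)) (auto simp: P_def R_def)
    also have "\<dots> \<le> b * (2 * d)" using t(6) 2(3) by (intro mult_left_mono) auto
    also have "\<dots> \<le> \<epsilon> / 2"
    proof -
      have "d \<le> \<epsilon> / (4 * b)" by (simp add: d_def)
      then show ?thesis using 2(3) by (simp add: field_simps)
    qed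
    finally have "\<bar>delta_integral Y y0 t' (\<lambda>t. f s' t v') - delta_integral Y y0 t (\<lambda>t. f s' t v')\<bar> \<le> \<epsilon> / 2"
      using Y.delta_integral_combine[OF g(2) Y.start t(1,2)] by linarith
    then show ?thesis using i1 a(6) by linarith
  qed
  then show "\<exists>P Q R. eventually P A \<and> eventually Q B \<and> eventually R (inf (nhds w) (principal W)) \<and>
      (\<forall>s s' t t' v v'. P s \<longrightarrow> P s' \<longrightarrow> Q t \<longrightarrow> Q t' \<longrightarrow> R v \<longrightarrow> R v' \<longrightarrow>
        \<bar>delta_integral Y y0 t (\<lambda>t. f s t v) - delta_integral Y y0 t' (\<lambda>t. f s' t v')\<bar> < \<epsilon>)"
    using ev by (intro exI[of _ P] exI[of _ Q] exI[of _ R]) blast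
qed

lemma rd_continuous2_delta_integral1:
  assumes X: "time_scale_ray X x0" and f: "rd_continuous2 X Y W f"
  shows "rd_continuous2 X Y W (\<lambda>x y w. delta_integral X x0 x (\<lambda>s. f s y w))"
  using rd_continuous2_swap[OF rd_continuous2_delta_integral2[OF X rd_continuous2_swap[OF f]]] .

text \<open>Since \<open>q\<close> runs through a compact interval, the Cauchy events of the other
  variables can be chosen independently of \<open>q\<close>; a uniformly small difference of the
  integrands has a small integral.\<close>

lemma rd_continuous2_integral:
  fixes f :: "real \<Rightarrow> real \<Rightarrow> 'w::topological_space \<times> real \<Rightarrow> real"
  assumes f: "rd_continuous2 X Y (W \<times> {a..b}) f"
  shows "rd_continuous2 X Y W (\<lambda>x y w. integral {a..b} (\<lambda>q. f x y (w, q)))"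
proof (cases "a \<le> b")
  case ab: True
  show ?thesis
  proof (rule rd_continuous2_cauchyI)
    fix x y w A B and \<epsilon> :: real
    assume a: "x \<in> X" "y \<in> Y" "w \<in> W" "A \<in> rd_filters X x" "B \<in> rd_filters Y y" "0 < \<epsilon>"
    define \<epsilon>' where "\<epsilon>' = \<epsilon> / (2 * (b - a + 1))"
    have \<epsilon>': "\<epsilon>' > 0" using a(6) ab by (simp add: \<epsilon>'_def)
    let ?N = "inf (nhds w) (principal W)"
    let ?F = "prod_filter A (prod_filter B ?N)"
    have "eventually (\<lambda>z. \<forall>q\<in>{a..b}.
        \<bar>f (fst (fst z)) (fst (snd (fst z))) (snd (snd (fst z)), q) -
         f (fst (snd z)) (fst (snd (snd z))) (snd (snd (snd z)), q)\<bar> < \<epsilon>') (prod_filter ?F ?F)"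
    proof (rule eventually_ball_compact)
      fix q assume q: "q \<in> {a..b}"
      obtain P Q R where 1: "eventually P A" "eventually Q B"
        "eventually R (inf (nhds (w, q)) (principal (W \<times> {a..b})))"
        and 2: "\<And>s s' t t' v v'. P s \<Longrightarrow> P s' \<Longrightarrow> Q t \<Longrightarrow> Q t' \<Longrightarrow> R v \<Longrightarrow> R v' \<Longrightarrow> \<bar>f s t v - f s' t' v'\<bar> < \<epsilon>'"
        by (rule rd_continuous2_cauchyD[OF f a(1,2) _ a(4,5) \<epsilon>', of "(w, q)"]) (use a q in auto)
      obtain R1 R2 where R: "eventually R1 (nhds w)" "eventually R2 (nhds q)"
        "\<And>v p. R1 v \<Longrightarrow> R2 p \<Longrightarrow> v \<in> W \<Longrightarrow> p \<in> {a..b} \<Longrightarrow> R (v, p)"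
        using 1(3) unfolding nhds_prod eventually_inf_principal eventually_prod_filter by auto
      have R1: "eventually (\<lambda>v. R1 v \<and> v \<in> W) ?N" "eventually (\<lambda>p. R2 p \<and> p \<in> {a..b}) (inf (nhds q) (principal {a..b}))"
        using R(1,2) by (auto simp: eventually_inf_principal elim: eventually_mono)
      note F = eventually_prodI[OF 1(1) eventually_prodI[OF 1(2) R1(1)]]
      from eventually_prodI[OF eventually_prodI[OF F F] R1(2)]
      show "eventually (\<lambda>(z, q). \<bar>f (fst (fst z)) (fst (snd (fst z))) (snd (snd (fst z)), q) -
         f (fst (snd z)) (fst (snd (snd z))) (snd (snd (snd z)), q)\<bar> < \<epsilon>')
         (prod_filter (prod_filter ?F ?F) (inf (nhds q) (principal {a..b})))"
        by (rule eventually_mono) (auto intro!: 2 R(3))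
    qed simp
    then obtain U where U: "eventually U ?F"
      and U2: "\<And>z z' q. U z \<Longrightarrow> U z' \<Longrightarrow> q \<in> {a..b} \<Longrightarrow>
        \<bar>f (fst z) (fst (snd z)) (snd (snd z), q) - f (fst z') (fst (snd z')) (snd (snd z'), q)\<bar> < \<epsilon>'"
      unfolding eventually_prod_same[of _ ?F] by auto
    obtain P V where P: "eventually P A" and V: "eventually V (prod_filter B ?N)"
      and PV: "\<And>s p. P s \<Longrightarrow> V p \<Longrightarrow> U (s, p)"
      using U unfolding eventually_prod_filter[of U] by blast
    obtain Q R where Q: "eventually Q B" and R: "eventually R ?N" and QR: "\<And>t v. Q t \<Longrightarrow> R v \<Longrightarrow> V (t, v)"
      using V unfolding eventually_prod_filter[of V] by blast
    define P' where "P' s \<longleftrightarrow> P s \<and> s \<in> X" for s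
    define Q' where "Q' s \<longleftrightarrow> Q s \<and> s \<in> Y" for s
    define R' where "R' s \<longleftrightarrow> R s \<and> s \<in> W" for s
    have ev: "eventually P' A" "eventually Q' B" "eventually R' ?N"
      unfolding P'_def[abs_def] Q'_def[abs_def] R'_def[abs_def]
      using P Q R eventually_rd_filters_mem[OF a(1,4)] eventually_rd_filters_mem[OF a(2,5)]
      by (simp_all add: eventually_conj_iff) (simp add: eventually_inf_principal)
    have int: "(\<lambda>q. f s t (v, q)) integrable_on {a..b}" if "P' s" "Q' t" "R' v" for s t v
    proof -
      have "continuous_on (W \<times> {a..b}) (f s t)"
        using rd_continuous2_section3[OF f] that by (simp add: P'_def Q'_def)
      then have "continuous_on {a..b} (\<lambda>q. f s t (v, q))"
        by (rule continuous_on_compose2) (use that in \<open>auto intro!: continuous_intros simp: R'_def\<close>)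
      then show ?thesis by (rule integrable_continuous_real)
    qed
    have "\<bar>integral {a..b} (\<lambda>q. f s t (v, q)) - integral {a..b} (\<lambda>q. f s' t' (v', q))\<bar> < \<epsilon>"
      if h: "P' s" "P' s'" "Q' t" "Q' t'" "R' v" "R' v'" for s s' t t' v v'
    proof -
      have i: "(\<lambda>q. f s t (v, q)) integrable_on {a..b}" "(\<lambda>q. f s' t' (v', q)) integrable_on {a..b}"
        using int h by auto
      have "norm (integral {a..b} (\<lambda>q. f s t (v, q) - f s' t' (v', q))) \<le> integral {a..b} (\<lambda>q. \<epsilon>')"
      proof (rule integral_norm_bound_integral)
        fix q assume "q \<in> {a..b}"
        then show "norm (f s t (v, q) - f s' t' (v', q)) \<le> \<epsilon>'"
          using U2[of "(s, t, v)" "(s', t', v')" q] PV QR h by (simp add: P'_def Q'_def R'_def less_imp_le)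
      qed (auto intro: integrable_diff i)
      also have "\<dots> = \<epsilon>' * (b - a)" using ab by simp
      also have "\<dots> < \<epsilon>' * (2 * (b - a + 1))" using \<epsilon>' ab by (intro mult_strict_left_mono) auto
      also have "\<dots> = \<epsilon>" using ab by (simp add: \<epsilon>'_def)
      finally show ?thesis using Henstock_Kurzweil_Integration.integral_diff[OF i] by simp
    qed
    then show "\<exists>P Q R. eventually P A \<and> eventually Q B \<and> eventually R ?N \<and>
      (\<forall>s s' t t' v v'. P s \<longrightarrow> P s' \<longrightarrow> Q t \<longrightarrow> Q t' \<longrightarrow> R v \<longrightarrow> R v' \<longrightarrow>
        \<bar>integral {a..b} (\<lambda>q. f s t (v, q)) - integral {a..b} (\<lambda>q. f s' t' (v', q))\<bar> < \<epsilon>)"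
      using ev by (intro exI[of _ P'] exI[of _ Q'] exI[of _ R']) blast
  qed
qed (simp add: rd_continuous2_const)

text \<open>Differentiation under the integral sign. It stands in for Fubini's theorem when the double
  integral is differentiated in the variable of the inner integral.\<close>

lemma has_delta_derivative_delta_integral:
  assumes X: "time_scale_ray X x0" and Y: "time_scale_ray Y y0" and f: "rd_continuous2 X Y W f"
    and x: "x \<in> X" and y: "y \<in> kappa Y" and w: "w \<in> W"
  shows "has_delta_derivative Y
    (\<lambda>t. delta_integral X x0 x (\<lambda>s. delta_integral Y y0 t (\<lambda>t. f s t w)))
    (delta_integral X x0 x (\<lambda>s. f s y w)) y"
  unfolding has_delta_derivative_def
proof (intro conjI allI impI y)
  interpret X: time_scale_ray X x0 by (rule X)
  interpret Y: time_scale_ray Y y0 by (rule Y)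
  fix \<epsilon> :: real assume \<epsilon>: "0 < \<epsilon>"
  have yY: "y \<in> Y" using y kappa_subset by blast
  have x0x: "x0 \<le> x" by (rule X.start_le[OF x])
  have \<sigma>Y: "sigma Y y \<in> Y" by (rule sigma_mem[OF Y.closed yY])
  define g where "g s t = delta_integral Y y0 t (\<lambda>t. f s t w)" for s t
  have f2: "rd_continuous_on_scale Y (\<lambda>t. f s t w)" if "s \<in> X" for s
    by (rule rd_continuous2_section2[OF f that w])
  have f1: "rd_continuous_on_scale X (\<lambda>s. f s t w)" if "t \<in> Y" for t
    by (rule rd_continuous2_section1[OF f that w])
  have g1: "rd_continuous_on_scale X (\<lambda>s. g s t)" if "t \<in> Y" for t
    unfolding g_def by (rule rd_continuous2_section1[OF rd_continuous2_delta_integral2[OF Y f] that w])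
  \<comment> \<open>The error term of the derivative estimate for the inner integral. Its integral
    over \<open>s\<close> is the error term of the double integral, so the task is to bound it
    uniformly in \<open>s\<close>.\<close>
  define h where "h t s = (g s (sigma Y y) - g s t) - (sigma Y y - t) * f s y w" for t s
  have h: "rd_continuous_on_scale X (h t)" if "t \<in> Y" for t
    unfolding h_def by (intro rd_continuous_on_scale_diff rd_continuous_on_scale_cmult g1 f1 that \<sigma>Y yY)
  have red: "delta_integral X x0 x (\<lambda>s. g s (sigma Y y)) - delta_integral X x0 x (\<lambda>s. g s t)
      - delta_integral X x0 x (\<lambda>s. f s y w) * (sigma Y y - t) = delta_integral X x0 x (h t)"
    if t: "t \<in> Y" for t
    unfolding h_def
    using X.delta_integral_diff[OF rd_continuous_on_scale_diff[OF g1[OF \<sigma>Y] g1[OF t]]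
        rd_continuous_on_scale_cmult[OF f1[OF yY]] X.start x, of "sigma Y y - t"]
      X.delta_integral_diff[OF g1[OF \<sigma>Y] g1[OF t] X.start x]
      X.delta_integral_cmult[OF f1[OF yY] X.start x, of "sigma Y y - t"]
    by simp
  have diff: "g s p - g s t - (p - t) * f s y w = delta_integral Y t p (\<lambda>\<tau>. f s \<tau> w - f s y w)"
    if "s \<in> X" "t \<in> Y" "p \<in> Y" for s t p
    using Y.delta_integral_combine[OF f2[OF that(1)] Y.start that(2,3)]
      Y.delta_integral_diff[OF f2[OF that(1)] rd_continuous_on_scale_const that(2,3)]
      Y.delta_integral_const[OF that(2,3)]
    by (simp add: g_def mult.commute)
  \<comment> \<open>A bound \<open>\<epsilon> / L\<close> on the integrand integrates to at most
    \<open>\<epsilon>\<close> over the interval from \<open>x0\<close> to \<open>x\<close>; the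
    summand \<open>1\<close> covers \<open>x = x0\<close>.\<close>
  define L where "L = x - x0 + 1"
  have L: "L > 0" using x0x by (simp add: L_def)
  have "\<exists>\<delta>>0. \<forall>t\<in>Y. \<bar>t - y\<bar> < \<delta> \<longrightarrow> (\<forall>s\<in>X. s \<le> x \<longrightarrow> \<bar>h t s\<bar> \<le> \<epsilon> / L * \<bar>sigma Y y - t\<bar>)"
  proof (cases "sigma Y y = y")
    case True
    then have B: "inf (nhds y) (principal Y) \<in> rd_filters Y y"
      by (simp add: rd_filters_def right_dense_def)
    \<comment> \<open>At a right-dense \<open>y\<close> the integrand is continuous in
      \<open>t\<close>, uniformly for \<open>s \<le> x\<close>; here \<open>y\<close> acts as the
      parameter and \<open>s\<close> as the variable in which compactness is used.\<close>
    obtain P R where PR: "eventually P (inf (nhds y) (principal Y))" "eventually R (inf (nhds w) (principal W))"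
      "\<And>t t' s v v'. P t \<Longrightarrow> P t' \<Longrightarrow> R v \<Longrightarrow> R v' \<Longrightarrow> s \<in> X \<Longrightarrow> s \<le> x \<Longrightarrow> \<bar>f s t v - f s t' v'\<bar> < \<epsilon> / L"
      by (rule rd_continuous2_uniform_on_compact_scale[OF X rd_continuous2_swap[OF f] yY w B, of "\<epsilon> / L" x])
        (use \<epsilon> L in auto)
    have Rw: "R w" by (rule eventually_nhds_point[OF w PR(2)])
    have Py: "P y" by (rule eventually_nhds_point[OF yY PR(1)])
    obtain \<delta> where \<delta>: "\<delta> > 0" "\<And>t. \<bar>t - y\<bar> < \<delta> \<Longrightarrow> t \<in> Y \<Longrightarrow> P t"
      using PR(1) unfolding eventually_inf_principal eventually_nhds_metric dist_real_def by blast
    show ?thesis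
    proof (intro exI[of _ \<delta>] conjI ballI impI \<delta>(1))
      fix t s assume t: "t \<in> Y" "\<bar>t - y\<bar> < \<delta>" and s: "s \<in> X" "s \<le> x"
      have "\<bar>delta_integral Y t y (\<lambda>\<tau>. f s \<tau> w - f s y w)\<bar> \<le> \<epsilon> / L * \<bar>y - t\<bar>"
      proof (rule Y.delta_integral_abs_diff_le)
        show "rd_continuous_on_scale Y (\<lambda>\<tau>. f s \<tau> w - f s y w)"
          by (intro rd_continuous_on_scale_diff f2 s(1) rd_continuous_on_scale_const)
        fix \<tau> assume "\<tau> \<in> Y" "min t y \<le> \<tau>" "\<tau> \<le> max t y"
        then show "\<bar>f s \<tau> w - f s y w\<bar> \<le> \<epsilon> / L"
          using t by (intro less_imp_le PR(3) Rw Py s \<delta>(2)) auto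
      qed (use t yY in auto)
      then show "\<bar>h t s\<bar> \<le> \<epsilon> / L * \<bar>sigma Y y - t\<bar>"
        using diff[OF s(1) t(1) yY] True by (simp add: h_def)
    qed
  next
    case False
    define \<mu> where "\<mu> = sigma Y y - y"
    have \<mu>: "\<mu> > 0" using False sigma_ge[of y Y] by (simp add: \<mu>_def)
    obtain b where b: "b > 0" "\<And>s t. s \<in> X \<Longrightarrow> t \<in> Y \<Longrightarrow> s \<le> x \<Longrightarrow> t \<le> y \<Longrightarrow> \<bar>f s t w\<bar> \<le> b"
      using rd_continuous2_bounded_on_compact[OF X Y f w, of x y] by auto
    \<comment> \<open>The bound \<open>\<mu>\<close> excludes points to the right of
      \<open>y\<close>. The other bound turns \<open>2 * b * \<delta>\<close> into at most
      \<open>\<epsilon> / L * \<mu>\<close>, which suffices because the increment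
      \<open>sigma Y y - t\<close> is at least \<open>\<mu>\<close>.\<close>
    define \<delta> where "\<delta> = min \<mu> (\<epsilon> / L * \<mu> / (2 * b))"
    have \<delta>: "\<delta> > 0" using \<mu> b(1) \<epsilon> L by (simp add: \<delta>_def)
    show ?thesis
    proof (intro exI[of _ \<delta>] conjI ballI impI \<delta>)
      fix t s assume t: "t \<in> Y" "\<bar>t - y\<bar> < \<delta>" and s: "s \<in> X" "s \<le> x"
      have ty: "t \<le> y" using sigma_le[OF t(1), of y] t(2) by (force simp: \<delta>_def \<mu>_def)
      have "g s (sigma Y y) - g s y = f s y w * (sigma Y y - y)"
        unfolding g_def
        by (rule has_delta_derivative_right_scattered[OF Y.has_delta_derivative_integral[OF f2[OF s(1)] Y.start y]])
      then have "h t s = g s y - g s t - (y - t) * f s y w"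
        by (simp add: h_def algebra_simps)
      also have "\<dots> = delta_integral Y t y (\<lambda>\<tau>. f s \<tau> w - f s y w)"
        by (rule diff[OF s(1) t(1) yY])
      finally have "\<bar>h t s\<bar> = \<bar>delta_integral Y t y (\<lambda>\<tau>. f s \<tau> w - f s y w)\<bar>" by simp
      also have "\<dots> \<le> (2 * b) * \<bar>y - t\<bar>"
      proof (rule Y.delta_integral_abs_diff_le)
        show "rd_continuous_on_scale Y (\<lambda>\<tau>. f s \<tau> w - f s y w)"
          by (intro rd_continuous_on_scale_diff f2 s(1) rd_continuous_on_scale_const)
        fix \<tau> assume "\<tau> \<in> Y" "min t y \<le> \<tau>" "\<tau> \<le> max t y"
        then have "\<bar>f s \<tau> w\<bar> \<le> b" "\<bar>f s y w\<bar> \<le> b" using b(2)[OF s(1)] s(2) ty yY by auto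
        then show "\<bar>f s \<tau> w - f s y w\<bar> \<le> 2 * b" by linarith
      qed (use t yY in auto)
      also have "\<dots> \<le> (2 * b) * \<delta>" using t b(1) by (intro mult_left_mono) auto
      also have "\<dots> \<le> \<epsilon> / L * \<mu>"
      proof -
        have "(2 * b) * \<delta> \<le> (2 * b) * (\<epsilon> / L * \<mu> / (2 * b))"
          using b(1) by (intro mult_left_mono) (auto simp: \<delta>_def)
        then show ?thesis using b(1) by simp
      qed
      also have "\<dots> \<le> \<epsilon> / L * \<bar>sigma Y y - t\<bar>"
        using ty \<epsilon> L by (intro mult_left_mono) (auto simp: \<mu>_def)
      finally show "\<bar>h t s\<bar> \<le> \<epsilon> / L * \<bar>sigma Y y - t\<bar>" .
    qed
  qed
  then obtain \<delta> where \<delta>: "\<delta> > 0"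
    "\<And>t s. t \<in> Y \<Longrightarrow> \<bar>t - y\<bar> < \<delta> \<Longrightarrow> s \<in> X \<Longrightarrow> s \<le> x \<Longrightarrow> \<bar>h t s\<bar> \<le> \<epsilon> / L * \<bar>sigma Y y - t\<bar>"
    by blast
  show "\<exists>\<delta>>0. \<forall>t\<in>Y. \<bar>t - y\<bar> < \<delta> \<longrightarrow>
      \<bar>delta_integral X x0 x (\<lambda>s. delta_integral Y y0 (sigma Y y) (\<lambda>t. f s t w))
        - delta_integral X x0 x (\<lambda>s. delta_integral Y y0 t (\<lambda>t. f s t w))
        - delta_integral X x0 x (\<lambda>s. f s y w) * (sigma Y y - t)\<bar> \<le> \<epsilon> * \<bar>sigma Y y - t\<bar>"
  proof (intro exI[of _ \<delta>] conjI ballI impI \<delta>(1))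
    fix t assume t: "t \<in> Y" "\<bar>t - y\<bar> < \<delta>"
    have "\<bar>delta_integral X x0 x (h t)\<bar> \<le> (\<epsilon> / L * \<bar>sigma Y y - t\<bar>) * (x - x0)"
      by (rule X.delta_integral_bound[OF h[OF t(1)] X.start x x0x]) (rule \<delta>(2)[OF t])
    also have "\<dots> \<le> (\<epsilon> / L * \<bar>sigma Y y - t\<bar>) * L"
      using \<epsilon> L by (intro mult_left_mono) (auto simp: L_def)
    also have "\<dots> = \<epsilon> * \<bar>sigma Y y - t\<bar>" using L by simp
    finally show "\<bar>delta_integral X x0 x (\<lambda>s. delta_integral Y y0 (sigma Y y) (\<lambda>t. f s t w))
        - delta_integral X x0 x (\<lambda>s. delta_integral Y y0 t (\<lambda>t. f s t w))
        - delta_integral X x0 x (\<lambda>s. f s y w) * (sigma Y y - t)\<bar> \<le> \<epsilon> * \<bar>sigma Y y - t\<bar>"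
      using red[OF t(1)] by (simp add: g_def)
  qed
qed


section \<open>The boundary value problem as a fixed-point equation\<close>

lemma (in time_scale_ray) delta_integral_dist_le:
  assumes f: "rd_continuous_on_scale T f" and g: "rd_continuous_on_scale T g" and h: "rd_continuous_on_scale T h"
    and r: "r \<in> T" and s: "s \<in> T" "r \<le> s"
    and le: "\<And>t. t \<in> T \<Longrightarrow> \<bar>f t - g t\<bar> \<le> c * h t"
  shows "\<bar>delta_integral T r s f - delta_integral T r s g\<bar> \<le> c * delta_integral T r s h"
  using delta_integral_abs_le[OF rd_continuous_on_scale_diff[OF f g] rd_continuous_on_scale_cmult[OF h] r s le]
  unfolding delta_integral_diff[OF f g r s(1)] delta_integral_cmult[OF h r s(1)] .

lemma geometric_cauchy_limit:
  fixes c :: "nat \<Rightarrow> real"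
  assumes \<gamma>: "0 \<le> \<gamma>" "\<gamma> < 1" and c: "\<And>n. \<bar>c (Suc n) - c n\<bar> \<le> k * \<gamma> ^ n"
  shows "\<bar>c n - lim c\<bar> \<le> k / (1 - \<gamma>) * \<gamma> ^ n"
proof -
  have k: "0 \<le> k" using c[of 0] by simp
  \<comment> \<open>The factor \<open>1 - \<gamma> ^ m\<close> makes the right-hand side the exact
    partial sum of the geometric series, so that the induction closes.\<close>
  have dist: "\<bar>c (n + m) - c n\<bar> \<le> k / (1 - \<gamma>) * \<gamma> ^ n * (1 - \<gamma> ^ m)" for n m
  proof (induction m)
    case (Suc m)
    have "\<bar>c (n + Suc m) - c n\<bar> \<le> k / (1 - \<gamma>) * \<gamma> ^ n * (1 - \<gamma> ^ m) + k * \<gamma> ^ (n + m)"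
      using Suc c[of "n + m"] by simp
    also have "k * \<gamma> ^ (n + m) = k / (1 - \<gamma>) * \<gamma> ^ n * (\<gamma> ^ m * (1 - \<gamma>))"
      using \<gamma> by (simp add: power_add)
    also have "A * (1 - \<gamma> ^ m) + A * (\<gamma> ^ m * (1 - \<gamma>)) = A * (1 - \<gamma> ^ Suc m)" for A
      by (simp add: algebra_simps)
    finally show ?case .
  qed simp
  have bound: "\<bar>c m - c n\<bar> \<le> k / (1 - \<gamma>) * \<gamma> ^ n" if "n \<le> m" for m n
  proof -
    have "\<bar>c m - c n\<bar> \<le> k / (1 - \<gamma>) * \<gamma> ^ n * (1 - \<gamma> ^ (m - n))"
      using dist[of n "m - n"] that by simp
    also have "\<dots> \<le> k / (1 - \<gamma>) * \<gamma> ^ n * 1"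
      using \<gamma> k by (intro mult_left_mono) auto
    finally show ?thesis by simp
  qed
  have "(\<lambda>n. k / (1 - \<gamma>) * \<gamma> ^ n) \<longlonglongrightarrow> k / (1 - \<gamma>) * 0"
    using \<gamma> by (intro tendsto_mult tendsto_const LIMSEQ_power_zero) auto
  then have z: "(\<lambda>n. k / (1 - \<gamma>) * \<gamma> ^ n) \<longlonglongrightarrow> 0" by simp
  have "Cauchy c"
  proof (rule metric_CauchyI)
    fix e :: real assume "e > 0"
    then have "eventually (\<lambda>n. dist (k / (1 - \<gamma>) * \<gamma> ^ n) 0 < e / 2) sequentially"
      using tendstoD[OF z, of "e / 2"] by simp
    then obtain N where N: "\<bar>k / (1 - \<gamma>) * \<gamma> ^ N\<bar> < e / 2"
      using eventually_happens[of _ sequentially] by auto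
    have "dist (c m) (c n) < e" if "N \<le> m" "N \<le> n" for m n
      using bound[OF that(1)] bound[OF that(2)] N unfolding dist_real_def by linarith
    then show "\<exists>M. \<forall>m\<ge>M. \<forall>n\<ge>M. dist (c m) (c n) < e" by blast
  qed
  then have lim: "c \<longlonglongrightarrow> lim c" by (simp add: Cauchy_convergent_iff convergent_LIMSEQ_iff)
  have "\<bar>lim c - c n\<bar> \<le> k / (1 - \<gamma>) * \<gamma> ^ n"
    by (rule LIMSEQ_le_const2[OF tendsto_rabs[OF tendsto_diff[OF lim tendsto_const]]])
      (use bound in blast)
  then show ?thesis by (simp add: abs_minus_commute)
qed

lemma le_geometric_imp_le_zero:
  fixes d :: real
  assumes "0 \<le> \<gamma>" "\<gamma> < 1" and le: "\<And>n. d \<le> k * \<gamma> ^ n"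
  shows "d \<le> 0"
proof -
  have "(\<lambda>n. k * \<gamma> ^ n) \<longlonglongrightarrow> k * 0"
    using assms by (intro tendsto_mult tendsto_const LIMSEQ_power_zero) auto
  then show ?thesis using LIMSEQ_le_const[of "\<lambda>n. k * \<gamma> ^ n" "k * 0" d] le by auto
qed

lemma abs_triangle3:
  fixes a1 a2 a3 :: real
  shows "\<bar>a1 - b1\<bar> + \<bar>a2 - b2\<bar> + \<bar>a3 - b3\<bar> \<le>
    (\<bar>a1 - c1\<bar> + \<bar>a2 - c2\<bar> + \<bar>a3 - c3\<bar>) + (\<bar>b1 - c1\<bar> + \<bar>b2 - c2\<bar> + \<bar>b3 - c3\<bar>)"
proof -
  have "\<bar>a - b\<bar> \<le> \<bar>a - c\<bar> + \<bar>b - c\<bar>" for a b c :: real by linarith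
  from add_mono[OF add_mono[OF this[of a1 b1 c1] this[of a2 b2 c2]] this[of a3 b3 c3]]
  show ?thesis by (simp only: add_ac)
qed

text \<open>\<open>E x y z\<close> stands for \<open>e lam x y \<bar>z\<bar>\<close>. Regarded as a
  function of \<open>z\<close>, the weight is rd-continuous like the other data and can be
  multiplied and integrated with them.\<close>

locale darboux_problem = X: time_scale_ray X x0 + Y: time_scale_ray Y y0
  for X Y :: "real set" and x0 y0 :: real +
  fixes a b :: real
    and E :: "real \<Rightarrow> real \<Rightarrow> real \<Rightarrow> real"
    and F :: "real \<Rightarrow> real \<Rightarrow> real \<Rightarrow> real \<Rightarrow> real \<Rightarrow> real \<Rightarrow> real \<Rightarrow> real"
    and G :: "real \<Rightarrow> real \<Rightarrow> real \<Rightarrow> real \<Rightarrow> real \<Rightarrow> real \<Rightarrow> real \<Rightarrow> real"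
    and \<alpha> \<beta> :: "real \<Rightarrow> real \<Rightarrow> real"
    and M :: "real \<Rightarrow> real \<Rightarrow> real \<Rightarrow> real"
    and K :: "real \<Rightarrow> real \<Rightarrow> real \<Rightarrow> real \<Rightarrow> real"
    and \<gamma>1 \<gamma>2 \<gamma>3 \<eta>1 \<eta>2 \<eta>3 :: real
  assumes E_rd: "rd_continuous2 X Y {a..b} E"
    and E_pos: "x \<in> X \<Longrightarrow> y \<in> Y \<Longrightarrow> z \<in> {a..b} \<Longrightarrow> 0 < E x y z"
    and F_rd: "rd_continuous2 X Y ({a..b} \<times> UNIV) (\<lambda>x y (z, u1, u2, u3, u4). F x y z u1 u2 u3 u4)"
    and G_rd: "rd_continuous2 X Y ({a..b} \<times> {a..b} \<times> UNIV) (\<lambda>x y (z, q, u1, u2, u3). G x y z q u1 u2 u3)"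
    and \<alpha>_rd: "rd_continuous X {a..b} \<alpha>"
    and \<alpha>_diff: "x \<in> kappa X \<Longrightarrow> z \<in> {a..b} \<Longrightarrow> \<exists>D. has_delta_derivative X (\<lambda>s. \<alpha> s z) D x"
    and \<alpha>_deriv_rd: "rd_continuous X {a..b} (\<lambda>x z. delta_deriv X (\<lambda>s. \<alpha> s z) x)"
    and \<beta>_rd: "rd_continuous Y {a..b} \<beta>"
    and \<beta>_diff: "y \<in> kappa Y \<Longrightarrow> z \<in> {a..b} \<Longrightarrow> \<exists>D. has_delta_derivative Y (\<lambda>t. \<beta> t z) D y"
    and \<beta>_deriv_rd: "rd_continuous Y {a..b} (\<lambda>y z. delta_deriv Y (\<lambda>t. \<beta> t z) y)"
    and compat: "z \<in> {a..b} \<Longrightarrow> \<alpha> x0 z = \<beta> y0 z"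
    and M_rd: "rd_continuous2 X Y {a..b} M"
    and M_nonneg: "x \<in> X \<Longrightarrow> y \<in> Y \<Longrightarrow> z \<in> {a..b} \<Longrightarrow> 0 \<le> M x y z"
    and K_rd: "rd_continuous2 X Y ({a..b} \<times> {a..b}) (\<lambda>x y (z, q). K x y z q)"
    and K_nonneg: "x \<in> X \<Longrightarrow> y \<in> Y \<Longrightarrow> z \<in> {a..b} \<Longrightarrow> q \<in> {a..b} \<Longrightarrow> 0 \<le> K x y z q"
    and F_lip: "x \<in> X \<Longrightarrow> y \<in> Y \<Longrightarrow> z \<in> {a..b} \<Longrightarrow>
        \<bar>F x y z u1 u2 u3 u4 - F x y z v1 v2 v3 v4\<bar>
          \<le> M x y z * (\<bar>u1 - v1\<bar> + \<bar>u2 - v2\<bar> + \<bar>u3 - v3\<bar> + \<bar>u4 - v4\<bar>)"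
    and G_lip: "x \<in> X \<Longrightarrow> y \<in> Y \<Longrightarrow> z \<in> {a..b} \<Longrightarrow> q \<in> {a..b} \<Longrightarrow>
        \<bar>G x y z q u1 u2 u3 - G x y z q v1 v2 v3\<bar>
          \<le> K x y z q * (\<bar>u1 - v1\<bar> + \<bar>u2 - v2\<bar> + \<bar>u3 - v3\<bar>)"
    and \<gamma>_nonneg: "0 \<le> \<gamma>1" "0 \<le> \<gamma>2" "0 \<le> \<gamma>3"
    and \<gamma>1: "x \<in> X \<Longrightarrow> y \<in> Y \<Longrightarrow> z \<in> {a..b} \<Longrightarrow>
        delta_integral X x0 x (\<lambda>s. delta_integral Y y0 y (\<lambda>t.
          M s t z * (E s t z + integral {a..b} (\<lambda>q. K s t z q * E s t q)))) \<le> \<gamma>1 * E x y z"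
    and \<gamma>2: "x \<in> X \<Longrightarrow> y \<in> Y \<Longrightarrow> z \<in> {a..b} \<Longrightarrow>
        delta_integral Y y0 y (\<lambda>t.
          M x t z * (E x t z + integral {a..b} (\<lambda>q. K x t z q * E x t q))) \<le> \<gamma>2 * E x y z"
    and \<gamma>3: "x \<in> X \<Longrightarrow> y \<in> Y \<Longrightarrow> z \<in> {a..b} \<Longrightarrow>
        delta_integral X x0 x (\<lambda>s.
          M s y z * (E s y z + integral {a..b} (\<lambda>q. K s y z q * E s y q))) \<le> \<gamma>3 * E x y z"
    and \<eta>_nonneg: "0 \<le> \<eta>1" "0 \<le> \<eta>2" "0 \<le> \<eta>3"
    and \<eta>1: "x \<in> X \<Longrightarrow> y \<in> Y \<Longrightarrow> z \<in> {a..b} \<Longrightarrow>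
        \<bar>\<alpha> x z\<bar> + \<bar>\<beta> y z\<bar> + \<bar>\<alpha> x0 z\<bar>
        + delta_integral X x0 x (\<lambda>s. delta_integral Y y0 y (\<lambda>t.
            \<bar>F s t z 0 0 0 (H_op X Y a b G (\<lambda>_ _ _. 0) s t z)\<bar>)) \<le> \<eta>1 * E x y z"
    and \<eta>2: "x \<in> X \<Longrightarrow> y \<in> Y \<Longrightarrow> z \<in> {a..b} \<Longrightarrow>
        \<bar>delta_deriv X (\<lambda>s. \<alpha> s z) x\<bar>
        + delta_integral Y y0 y (\<lambda>t. \<bar>F x t z 0 0 0 (H_op X Y a b G (\<lambda>_ _ _. 0) x t z)\<bar>) \<le> \<eta>2 * E x y z"
    and \<eta>3: "x \<in> X \<Longrightarrow> y \<in> Y \<Longrightarrow> z \<in> {a..b} \<Longrightarrow>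
        \<bar>delta_deriv Y (\<lambda>t. \<beta> t z) y\<bar>
        + delta_integral X x0 x (\<lambda>s. \<bar>F s y z 0 0 0 (H_op X Y a b G (\<lambda>_ _ _. 0) s y z)\<bar>) \<le> \<eta>3 * E x y z"
    and \<gamma>_less_1: "\<gamma>1 + \<gamma>2 + \<gamma>3 < 1"
begin

abbreviation rd3 :: "(real \<Rightarrow> real \<Rightarrow> real \<Rightarrow> real) \<Rightarrow> bool" where
  "rd3 \<equiv> rd_continuous2 X Y {a..b}"

text \<open>\<open>p\<close> and \<open>q\<close> stand for the partial derivatives of \<open>u\<close>.\<close>

definition rhs_op :: "(real \<Rightarrow> real \<Rightarrow> real \<Rightarrow> real) \<Rightarrow> (real \<Rightarrow> real \<Rightarrow> real \<Rightarrow> real)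
    \<Rightarrow> (real \<Rightarrow> real \<Rightarrow> real \<Rightarrow> real) \<Rightarrow> real \<Rightarrow> real \<Rightarrow> real \<Rightarrow> real" where
  "rhs_op u p q x y z = F x y z (u x y z) (p x y z) (q x y z)
     (integral {a..b} (\<lambda>\<xi>. G x y z \<xi> (u x y \<xi>) (p x y \<xi>) (q x y \<xi>)))"

text \<open>\<open>sol f\<close> is the function with mixed derivative \<open>f\<close> and boundary values \<open>\<alpha>\<close>, \<open>\<beta>\<close>; \<open>sol1 f\<close> and \<open>sol2 f\<close>
  are its partial derivatives, hence \<open>0\<close> outside \<open>kappa\<close>.\<close>

definition sol :: "(real \<Rightarrow> real \<Rightarrow> real \<Rightarrow> real) \<Rightarrow> real \<Rightarrow> real \<Rightarrow> real \<Rightarrow> real" where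
  "sol f x y z = \<alpha> x z + \<beta> y z - \<alpha> x0 z + delta_integral X x0 x (\<lambda>s. delta_integral Y y0 y (\<lambda>t. f s t z))"

definition sol1 :: "(real \<Rightarrow> real \<Rightarrow> real \<Rightarrow> real) \<Rightarrow> real \<Rightarrow> real \<Rightarrow> real \<Rightarrow> real" where
  "sol1 f x y z = (if x \<in> kappa X then delta_deriv X (\<lambda>s. \<alpha> s z) x + delta_integral Y y0 y (\<lambda>t. f x t z) else 0)"

definition sol2 :: "(real \<Rightarrow> real \<Rightarrow> real \<Rightarrow> real) \<Rightarrow> real \<Rightarrow> real \<Rightarrow> real \<Rightarrow> real" where
  "sol2 f x y z = (if y \<in> kappa Y then delta_deriv Y (\<lambda>t. \<beta> t z) y + delta_integral X x0 x (\<lambda>s. f s y z) else 0)"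

lemma rd_limits_id: "rd_limits X Y {a..b} {a..b} (\<lambda>x y z. z)"
  by (rule rd_limits_of_continuous) (auto intro: continuous_intros)

lemma rd_continuous2_snd:
  assumes "rd3 u" shows "rd_continuous2 X Y ({a..b} \<times> {a..b}) (\<lambda>x y w. u x y (snd w))"
  by (rule rd_continuous2_compose[OF assms rd_limits_of_continuous]) (auto intro: continuous_intros)

text \<open>The arguments \<open>p\<close> and \<open>q\<close> may have several limits at one
  point, so the compositions with \<open>G\<close> and \<open>F\<close> go through
  \<open>rd_limits\<close>. The integral of \<open>G\<close> comes first because it is an argument
  of \<open>F\<close>. The plain \<open>simp\<close> steps identify a product of copies of
  \<open>UNIV\<close> with the \<open>UNIV\<close> in the domains of \<open>G\<close> and
  \<open>F\<close>.\<close>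

lemma rd3_rhs_op:
  assumes u: "rd3 u" and p: "rd3 p" and q: "rd3 q"
  shows "rd3 (rhs_op u p q)"
proof -
  have "rd_limits X Y ({a..b} \<times> {a..b}) ({a..b} \<times> {a..b} \<times> UNIV \<times> UNIV \<times> UNIV)
      (\<lambda>x y w. (fst w, snd w, u x y (snd w), p x y (snd w), q x y (snd w)))"
    by (intro rd_limits_Pair rd_limits_of_rd_continuous2 rd_continuous2_snd u p q rd_limits_of_continuous continuous_intros) auto
  then have "rd_limits X Y ({a..b} \<times> {a..b}) ({a..b} \<times> {a..b} \<times> UNIV)
      (\<lambda>x y w. (fst w, snd w, u x y (snd w), p x y (snd w), q x y (snd w)))"
    by simp
  from rd_continuous2_compose[OF G_rd this]
  have "rd_continuous2 X Y ({a..b} \<times> {a..b})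
      (\<lambda>x y w. G x y (fst w) (snd w) (u x y (snd w)) (p x y (snd w)) (q x y (snd w)))"
    by simp
  from rd_continuous2_integral[OF this]
  have H: "rd3 (\<lambda>x y z. integral {a..b} (\<lambda>\<xi>. G x y z \<xi> (u x y \<xi>) (p x y \<xi>) (q x y \<xi>)))" by simp
  have "rd_limits X Y {a..b} ({a..b} \<times> UNIV \<times> UNIV \<times> UNIV \<times> UNIV)
      (\<lambda>x y z. (z, u x y z, p x y z, q x y z, integral {a..b} (\<lambda>\<xi>. G x y z \<xi> (u x y \<xi>) (p x y \<xi>) (q x y \<xi>))))"
    by (intro rd_limits_Pair rd_limits_of_rd_continuous2 u p q H rd_limits_id)
  then have "rd_limits X Y {a..b} ({a..b} \<times> UNIV)
      (\<lambda>x y z. (z, u x y z, p x y z, q x y z, integral {a..b} (\<lambda>\<xi>. G x y z \<xi> (u x y \<xi>) (p x y \<xi>) (q x y \<xi>))))"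
    by simp
  from rd_continuous2_compose[OF F_rd this]
  show ?thesis unfolding rhs_op_def[abs_def] by simp
qed

text \<open>The integrand of the three \<open>\<gamma>\<close> conditions. Right-hand sides are
  compared in units of \<open>weight\<close>, functions and their derivatives in units of
  \<open>E\<close>: \<open>rhs_op\<close> takes a bound \<open>c * E\<close> to
  \<open>c * weight\<close>, and \<open>sol\<close> returns from there to \<open>E\<close> with the
  factor \<open>\<gamma>1 + \<gamma>2 + \<gamma>3\<close>.\<close>

definition weight :: "real \<Rightarrow> real \<Rightarrow> real \<Rightarrow> real" where
  "weight x y z = M x y z * (E x y z + integral {a..b} (\<lambda>q. K x y z q * E x y q))"

lemma rd3_weight: "rd3 weight"
proof -
  have "rd_continuous2 X Y ({a..b} \<times> {a..b}) (\<lambda>x y w. (\<lambda>x y (z, q). K x y z q) x y w * E x y (snd w))"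
    by (intro rd_continuous2_mult K_rd rd_continuous2_snd E_rd)
  from rd_continuous2_integral[OF this]
  have "rd3 (\<lambda>x y z. integral {a..b} (\<lambda>q. K x y z q * E x y q))" by simp
  then show ?thesis
    unfolding weight_def[abs_def] by (intro rd_continuous2_mult rd_continuous2_add M_rd E_rd)
qed

lemma rd3_\<alpha>: "rd3 (\<lambda>x y z. \<alpha> x z)" and rd3_\<alpha>': "rd3 (\<lambda>x y z. delta_deriv X (\<lambda>s. \<alpha> s z) x)"
  by (rule rd_continuous2_of_rd_continuous[OF \<alpha>_rd], rule rd_continuous2_of_rd_continuous[OF \<alpha>_deriv_rd])

lemma rd3_\<beta>: "rd3 (\<lambda>x y z. \<beta> y z)" and rd3_\<beta>': "rd3 (\<lambda>x y z. delta_deriv Y (\<lambda>t. \<beta> t z) y)"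
  by (rule rd_continuous2_swap[OF rd_continuous2_of_rd_continuous[OF \<beta>_rd]],
      rule rd_continuous2_swap[OF rd_continuous2_of_rd_continuous[OF \<beta>_deriv_rd]])

lemma rd3_\<alpha>_start: "rd3 (\<lambda>x y z. \<alpha> x0 z)"
proof -
  have "continuous_on {a..b} (\<alpha> x0)"
    using rd_continuous2_section3[OF rd3_\<alpha> X.start Y.start] .
  then have "continuous_on (X \<times> Y \<times> {a..b}) (\<lambda>p. \<alpha> x0 (snd (snd p)))"
    by (rule continuous_on_compose2) (auto intro!: continuous_intros)
  then show ?thesis by (intro rd_continuous2_of_continuous) (simp add: case_prod_unfold)
qed

section \<open>The function generated by a prescribed mixed derivative\<close>

context
  fixes f assumes f: "rd3 f"
begin

lemma int_y_section: "x \<in> X \<Longrightarrow> z \<in> {a..b} \<Longrightarrow> rd_continuous_on_scale Y (\<lambda>t. f x t z)"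
  by (rule rd_continuous2_section2[OF f])

lemma int_x_section: "y \<in> Y \<Longrightarrow> z \<in> {a..b} \<Longrightarrow> rd_continuous_on_scale X (\<lambda>s. f s y z)"
  by (rule rd_continuous2_section1[OF f])

lemma inner_section: "y \<in> Y \<Longrightarrow> z \<in> {a..b} \<Longrightarrow>
    rd_continuous_on_scale X (\<lambda>s. delta_integral Y y0 y (\<lambda>t. f s t z))"
  by (rule rd_continuous2_section1[OF rd_continuous2_delta_integral2[OF Y.time_scale_ray_axioms f]])

lemma rd3_sol: "rd3 (sol f)"
  unfolding sol_def[abs_def]
  by (intro rd_continuous2_add rd_continuous2_diff rd3_\<alpha> rd3_\<beta> rd3_\<alpha>_start
      rd_continuous2_delta_integral1[OF X.time_scale_ray_axioms]
      rd_continuous2_delta_integral2[OF Y.time_scale_ray_axioms] f)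

lemma rd3_sol1: "rd3 (sol1 f)"
  unfolding sol1_def[abs_def]
  by (intro rd_continuous2_restrict_kappa rd_continuous2_add rd3_\<alpha>'
      rd_continuous2_delta_integral2[OF Y.time_scale_ray_axioms] f)

lemma rd3_sol2: "rd3 (sol2 f)"
proof -
  have "rd3 (\<lambda>x y z. delta_deriv Y (\<lambda>t. \<beta> t z) y + delta_integral X x0 x (\<lambda>s. f s y z))"
    by (intro rd_continuous2_add rd3_\<beta>' rd_continuous2_delta_integral1[OF X.time_scale_ray_axioms] f)
  from rd_continuous2_swap[OF rd_continuous2_restrict_kappa[OF rd_continuous2_swap[OF this]]]
  show ?thesis unfolding sol2_def[abs_def] .
qed

lemma has_delta_derivative_sol_x:
  assumes x: "x \<in> kappa X" and y: "y \<in> Y" and z: "z \<in> {a..b}"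
  shows "has_delta_derivative X (\<lambda>s. sol f s y z) (sol1 f x y z) x"
proof -
  have "has_delta_derivative X (\<lambda>s. \<alpha> s z + (\<beta> y z - \<alpha> x0 z) +
      delta_integral X x0 s (\<lambda>s. delta_integral Y y0 y (\<lambda>t. f s t z)))
      (delta_deriv X (\<lambda>s. \<alpha> s z) x + 0 + delta_integral Y y0 y (\<lambda>t. f x t z)) x"
    by (intro has_delta_derivative_add has_delta_derivative_delta_deriv[OF \<alpha>_diff] has_delta_derivative_const
        X.has_delta_derivative_integral inner_section X.start x y z)
  then show ?thesis using x by (simp add: sol_def sol1_def algebra_simps)
qed

lemma has_delta_derivative_sol_y:
  assumes x: "x \<in> X" and y: "y \<in> kappa Y" and z: "z \<in> {a..b}"
  shows "has_delta_derivative Y (\<lambda>t. sol f x t z) (sol2 f x y z) y"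
proof -
  have "has_delta_derivative Y (\<lambda>t. \<beta> t z + (\<alpha> x z - \<alpha> x0 z) +
      delta_integral X x0 x (\<lambda>s. delta_integral Y y0 t (\<lambda>t. f s t z)))
      (delta_deriv Y (\<lambda>t. \<beta> t z) y + 0 + delta_integral X x0 x (\<lambda>s. f s y z)) y"
    by (intro has_delta_derivative_add has_delta_derivative_delta_deriv[OF \<beta>_diff] has_delta_derivative_const
        has_delta_derivative_delta_integral[OF X.time_scale_ray_axioms Y.time_scale_ray_axioms f] x y z)
  then show ?thesis using y by (simp add: sol_def sol2_def algebra_simps)
qed

text \<open>Outside \<open>kappa X\<close> both sides are \<open>0\<close> by convention, so
  \<open>x\<close> is unrestricted and the two functions agree even at a left-scattered
  maximum.\<close>

lemma pdelta1_sol: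
  assumes "y \<in> Y" "z \<in> {a..b}"
  shows "pdelta1 X (sol f) x y z = sol1 f x y z"
proof (cases "x \<in> kappa X")
  case True
  then show ?thesis
    unfolding pdelta1_def by (intro delta_deriv_eq has_delta_derivative_sol_x assms)
qed (simp add: pdelta1_def sol1_def delta_deriv_def)

lemma pdelta2_sol:
  assumes "x \<in> X" "z \<in> {a..b}"
  shows "pdelta2 Y (sol f) x y z = sol2 f x y z"
proof (cases "y \<in> kappa Y")
  case True
  then show ?thesis
    unfolding pdelta2_def by (intro delta_deriv_eq has_delta_derivative_sol_y assms)
qed (simp add: pdelta2_def sol2_def delta_deriv_def)

lemma has_delta_derivative_sol1:
  assumes x: "x \<in> kappa X" and y: "y \<in> kappa Y" and z: "z \<in> {a..b}"
  shows "has_delta_derivative Y (\<lambda>t. pdelta1 X (sol f) x t z) (f x y z) y"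
proof -
  have xX: "x \<in> X" using x kappa_subset by blast
  have "has_delta_derivative Y (\<lambda>t. delta_deriv X (\<lambda>s. \<alpha> s z) x + delta_integral Y y0 t (\<lambda>t. f x t z)) (0 + f x y z) y"
    by (intro has_delta_derivative_add has_delta_derivative_const Y.has_delta_derivative_integral
        int_y_section Y.start xX y z)
  then show ?thesis
    by (intro has_delta_derivative_cong[OF Y.closed, of _ "\<lambda>t. pdelta1 X (sol f) x t z"])
      (simp_all add: pdelta1_sol[OF _ z] sol1_def x)
qed

lemma has_delta_derivative_sol2:
  assumes x: "x \<in> kappa X" and y: "y \<in> kappa Y" and z: "z \<in> {a..b}"
  shows "has_delta_derivative X (\<lambda>s. pdelta2 Y (sol f) s y z) (f x y z) x"
proof -
  have yY: "y \<in> Y" using y kappa_subset by blast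
  have "has_delta_derivative X (\<lambda>s. delta_deriv Y (\<lambda>t. \<beta> t z) y + delta_integral X x0 s (\<lambda>s. f s y z)) (0 + f x y z) x"
    by (intro has_delta_derivative_add has_delta_derivative_const X.has_delta_derivative_integral
        int_x_section X.start x yY z)
  then show ?thesis
    by (intro has_delta_derivative_cong[OF X.closed, of _ "\<lambda>s. pdelta2 Y (sol f) s y z"])
      (simp_all add: pdelta2_sol[OF _ z] sol2_def y)
qed

text \<open>At \<open>y = y0\<close> the inner integrals vanish and \<open>compat\<close> cancels
  the other terms against each other; at \<open>x = x0\<close> the two occurrences of
  \<open>\<alpha> x0 z\<close> cancel directly.\<close>

lemma sol_boundary:
  assumes z: "z \<in> {a..b}"
  shows "x \<in> X \<Longrightarrow> sol f x y0 z = \<alpha> x z" and "y \<in> Y \<Longrightarrow> sol f x0 y z = \<beta> y z"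
proof -
  assume x: "x \<in> X"
  have "delta_integral X x0 x (\<lambda>s. delta_integral Y y0 y0 (\<lambda>t. f s t z)) = delta_integral X x0 x (\<lambda>s. 0)"
    by (rule delta_integral_cong) (simp add: Y.delta_integral_refl[OF Y.start int_y_section[OF _ z]])
  then show "sol f x y0 z = \<alpha> x z"
    using X.delta_integral_const[OF X.start x, of 0] compat[OF z] by (simp add: sol_def)
next
  assume "y \<in> Y"
  then show "sol f x0 y z = \<beta> y z"
    using X.delta_integral_refl[OF X.start inner_section[OF _ z]] by (simp add: sol_def)
qed

end

section \<open>The contraction estimates\<close>

lemma rhs_op_lipschitz:
  assumes rd: "rd3 u" "rd3 p" "rd3 q" "rd3 u'" "rd3 p'" "rd3 q'"
    and le: "\<And>x y z. x \<in> X \<Longrightarrow> y \<in> Y \<Longrightarrow> z \<in> {a..b} \<Longrightarrow>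
      \<bar>u x y z - u' x y z\<bar> + \<bar>p x y z - p' x y z\<bar> + \<bar>q x y z - q' x y z\<bar> \<le> c * E x y z"
    and x: "x \<in> X" and y: "y \<in> Y" and z: "z \<in> {a..b}"
  shows "\<bar>rhs_op u p q x y z - rhs_op u' p' q' x y z\<bar> \<le> c * weight x y z"
proof -
  let ?g = "\<lambda>u p q \<xi>. G x y z \<xi> (u x y \<xi>) (p x y \<xi>) (q x y \<xi>)"
  have int: "?g u p q integrable_on {a..b}" if "rd3 u" "rd3 p" "rd3 q" for u p q
  proof -
    have "continuous_on ({a..b} \<times> {a..b} \<times> UNIV) (\<lambda>(z, q, u1, u2, u3). G x y z q u1 u2 u3)"
      by (rule rd_continuous2_section3[OF G_rd x y])
    moreover have "continuous_on {a..b} (\<lambda>\<xi>. (z, \<xi>, u x y \<xi>, p x y \<xi>, q x y \<xi>))"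
      using that by (intro continuous_intros rd_continuous2_section3[OF _ x y])
    ultimately have "continuous_on {a..b} (\<lambda>\<xi>. (\<lambda>(z, q, u1, u2, u3). G x y z q u1 u2 u3) (z, \<xi>, u x y \<xi>, p x y \<xi>, q x y \<xi>))"
      by (rule continuous_on_compose2) (use z in auto)
    then show ?thesis by (intro integrable_continuous_real) simp
  qed
  have KE: "(\<lambda>\<xi>. K x y z \<xi> * E x y \<xi>) integrable_on {a..b}"
  proof -
    have "continuous_on {a..b} (\<lambda>\<xi>. (\<lambda>(z, q). K x y z q) (z, \<xi>))"
      by (rule continuous_on_compose2[OF rd_continuous2_section3[OF K_rd x y]])
        (use z in \<open>auto intro!: continuous_intros\<close>)
    then show ?thesis
      by (intro integrable_continuous_real continuous_intros rd_continuous2_section3[OF E_rd x y]) simp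
  qed
  have "norm (integral {a..b} (\<lambda>\<xi>. ?g u p q \<xi> - ?g u' p' q' \<xi>)) \<le> integral {a..b} (\<lambda>\<xi>. c * (K x y z \<xi> * E x y \<xi>))"
  proof (rule integral_norm_bound_integral)
    fix \<xi> assume \<xi>: "\<xi> \<in> {a..b}"
    have "norm (?g u p q \<xi> - ?g u' p' q' \<xi>) \<le>
        K x y z \<xi> * (\<bar>u x y \<xi> - u' x y \<xi>\<bar> + \<bar>p x y \<xi> - p' x y \<xi>\<bar> + \<bar>q x y \<xi> - q' x y \<xi>\<bar>)"
      using G_lip[OF x y z \<xi>] by simp
    \<comment> \<open>The bound \<open>le\<close> is applied at the integration variable, so the
      weight is taken at \<open>\<xi>\<close>; this produces the integral inside
      \<open>weight\<close>.\<close>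
    also have "\<dots> \<le> K x y z \<xi> * (c * E x y \<xi>)"
      by (rule mult_left_mono[OF le[OF x y \<xi>] K_nonneg[OF x y z \<xi>]])
    finally show "norm (?g u p q \<xi> - ?g u' p' q' \<xi>) \<le> c * (K x y z \<xi> * E x y \<xi>)"
      by (simp add: mult_ac)
  next
    show "(\<lambda>\<xi>. ?g u p q \<xi> - ?g u' p' q' \<xi>) integrable_on {a..b}"
      by (intro integrable_diff int rd)
    show "(\<lambda>\<xi>. c * (K x y z \<xi> * E x y \<xi>)) integrable_on {a..b}"
      using integrable_cmul[OF KE, of c] by simp
  qed
  then have H: "\<bar>integral {a..b} (?g u p q) - integral {a..b} (?g u' p' q')\<bar>
      \<le> c * integral {a..b} (\<lambda>\<xi>. K x y z \<xi> * E x y \<xi>)"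
    using Henstock_Kurzweil_Integration.integral_diff[OF int[OF rd(1-3)] int[OF rd(4-6)]] by simp
  have "\<bar>rhs_op u p q x y z - rhs_op u' p' q' x y z\<bar> \<le> M x y z * (\<bar>u x y z - u' x y z\<bar> + \<bar>p x y z - p' x y z\<bar>
      + \<bar>q x y z - q' x y z\<bar> + \<bar>integral {a..b} (?g u p q) - integral {a..b} (?g u' p' q')\<bar>)"
    unfolding rhs_op_def by (rule F_lip[OF x y z])
  also have "\<dots> \<le> M x y z * (c * E x y z + c * integral {a..b} (\<lambda>\<xi>. K x y z \<xi> * E x y \<xi>))"
    by (intro mult_left_mono add_mono le H x y z M_nonneg)
  finally show ?thesis by (simp add: weight_def algebra_simps)
qed

text \<open>The boundary data cancel in all three differences. What remains are integrals of
  \<open>f - g\<close>, dominated by the corresponding integrals of \<open>weight\<close>, to which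
  the three \<open>\<gamma>\<close> conditions apply.\<close>

lemma sol_contraction:
  assumes f: "rd3 f" and g: "rd3 g" and c: "0 \<le> c"
    and le: "\<And>x y z. x \<in> X \<Longrightarrow> y \<in> Y \<Longrightarrow> z \<in> {a..b} \<Longrightarrow> \<bar>f x y z - g x y z\<bar> \<le> c * weight x y z"
    and x: "x \<in> X" and y: "y \<in> Y" and z: "z \<in> {a..b}"
  shows "\<bar>sol f x y z - sol g x y z\<bar> + \<bar>sol1 f x y z - sol1 g x y z\<bar> + \<bar>sol2 f x y z - sol2 g x y z\<bar>
    \<le> c * (\<gamma>1 + \<gamma>2 + \<gamma>3) * E x y z"
proof -
  have inner: "\<bar>delta_integral Y y0 y (\<lambda>t. f s t z) - delta_integral Y y0 y (\<lambda>t. g s t z)\<bar>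
      \<le> c * delta_integral Y y0 y (\<lambda>t. weight s t z)" if "s \<in> X" for s
    by (rule Y.delta_integral_dist_le[OF int_y_section[OF f that z] int_y_section[OF g that z]
          int_y_section[OF rd3_weight that z] Y.start y Y.start_le[OF y] le[OF that _ z]])
  have "\<bar>sol f x y z - sol g x y z\<bar> \<le>
      c * delta_integral X x0 x (\<lambda>s. delta_integral Y y0 y (\<lambda>t. weight s t z))"
    using X.delta_integral_dist_le[OF inner_section[OF f y z] inner_section[OF g y z]
        inner_section[OF rd3_weight y z] X.start x X.start_le[OF x] inner]
    by (simp add: sol_def)
  also have "\<dots> \<le> c * (\<gamma>1 * E x y z)"
    unfolding weight_def by (intro mult_left_mono \<gamma>1 x y z c)
  finally have 1: "\<bar>sol f x y z - sol g x y z\<bar> \<le> c * (\<gamma>1 * E x y z)" .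
  have "c * delta_integral Y y0 y (\<lambda>t. weight x t z) \<le> c * (\<gamma>2 * E x y z)"
    unfolding weight_def by (intro mult_left_mono \<gamma>2 x y z c)
  \<comment> \<open>Outside \<open>kappa\<close> the difference of the derivatives is
    \<open>0\<close>, so the bounds also have to be nonnegative.\<close>
  moreover have "0 \<le> c * (\<gamma>2 * E x y z)" "0 \<le> c * (\<gamma>3 * E x y z)"
    using c \<gamma>_nonneg E_pos[OF x y z] by simp_all
  ultimately have 2: "\<bar>sol1 f x y z - sol1 g x y z\<bar> \<le> c * (\<gamma>2 * E x y z)"
    using inner[OF x] by (simp add: sol1_def)
  have "\<bar>delta_integral X x0 x (\<lambda>s. f s y z) - delta_integral X x0 x (\<lambda>s. g s y z)\<bar>
      \<le> c * delta_integral X x0 x (\<lambda>s. weight s y z)"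
    by (rule X.delta_integral_dist_le[OF int_x_section[OF f y z] int_x_section[OF g y z]
          int_x_section[OF rd3_weight y z] X.start x X.start_le[OF x] le[OF _ y z]])
  also have "\<dots> \<le> c * (\<gamma>3 * E x y z)"
    unfolding weight_def by (intro mult_left_mono \<gamma>3 x y z c)
  finally have 3: "\<bar>sol2 f x y z - sol2 g x y z\<bar> \<le> c * (\<gamma>3 * E x y z)"
    using \<open>0 \<le> c * (\<gamma>3 * E x y z)\<close> by (simp add: sol2_def)
  show ?thesis using 1 2 3 by (simp add: algebra_simps)
qed

section \<open>The Picard iteration\<close>

abbreviation zero3 :: "real \<Rightarrow> real \<Rightarrow> real \<Rightarrow> real" where "zero3 \<equiv> \<lambda>_ _ _. 0"

definition rhs0 :: "real \<Rightarrow> real \<Rightarrow> real \<Rightarrow> real" where "rhs0 = rhs_op zero3 zero3 zero3"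

lemma rd3_rhs0: "rd3 rhs0"
  unfolding rhs0_def by (intro rd3_rhs_op rd_continuous2_const)

lemma rhs0_eq: "rhs0 x y z = F x y z 0 0 0 (H_op X Y a b G zero3 x y z)"
proof -
  have "delta_deriv T (\<lambda>s. 0) t = 0" for T t
    using delta_deriv_eq[OF has_delta_derivative_const, of t T 0]
    by (cases "t \<in> kappa T") (auto simp: delta_deriv_def[of T "\<lambda>s. 0"])
  then show ?thesis by (simp add: rhs0_def rhs_op_def H_op_def pdelta1_def pdelta2_def)
qed

text \<open>The three \<open>\<eta>\<close> conditions are made for this: they bound the boundary
  data together with the integrals of the absolute value of \<open>rhs0\<close>. The triangle
  inequality for delta integrals does the rest.\<close>

lemma sol_rhs0_bound:
  assumes x: "x \<in> X" and y: "y \<in> Y" and z: "z \<in> {a..b}"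
  shows "\<bar>sol rhs0 x y z\<bar> + \<bar>sol1 rhs0 x y z\<bar> + \<bar>sol2 rhs0 x y z\<bar> \<le> (\<eta>1 + \<eta>2 + \<eta>3) * E x y z"
proof -
  note f = rd3_rhs0 and af = rd_continuous2_abs[OF rd3_rhs0]
  have inner: "\<bar>delta_integral Y y0 y (\<lambda>t. rhs0 s t z)\<bar> \<le> delta_integral Y y0 y (\<lambda>t. \<bar>rhs0 s t z\<bar>)"
    if "s \<in> X" for s
    by (rule Y.delta_integral_abs_le[OF int_y_section[OF f that z] int_y_section[OF af that z] Y.start y Y.start_le[OF y]]) simp
  have "\<bar>delta_integral X x0 x (\<lambda>s. delta_integral Y y0 y (\<lambda>t. rhs0 s t z))\<bar>
      \<le> delta_integral X x0 x (\<lambda>s. delta_integral Y y0 y (\<lambda>t. \<bar>rhs0 s t z\<bar>))"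
    by (rule X.delta_integral_abs_le[OF inner_section[OF f y z] inner_section[OF af y z] X.start x X.start_le[OF x] inner])
  then have 1: "\<bar>sol rhs0 x y z\<bar> \<le> \<eta>1 * E x y z"
    using \<eta>1[OF x y z] unfolding sol_def rhs0_eq by linarith
  have "0 \<le> \<eta>2 * E x y z" "0 \<le> \<eta>3 * E x y z" using \<eta>_nonneg E_pos[OF x y z] by simp_all
  have 2: "\<bar>sol1 rhs0 x y z\<bar> \<le> \<eta>2 * E x y z"
  proof (cases "x \<in> kappa X")
    case True
    then show ?thesis using \<eta>2[OF x y z] inner[OF x] unfolding sol1_def rhs0_eq by simp
  qed (use \<open>0 \<le> \<eta>2 * E x y z\<close> in \<open>simp add: sol1_def\<close>)
  have "\<bar>delta_integral X x0 x (\<lambda>s. rhs0 s y z)\<bar> \<le> delta_integral X x0 x (\<lambda>s. \<bar>rhs0 s y z\<bar>)"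
    by (rule X.delta_integral_abs_le[OF int_x_section[OF f y z] int_x_section[OF af y z] X.start x X.start_le[OF x]]) simp
  then have 3: "\<bar>sol2 rhs0 x y z\<bar> \<le> \<eta>3 * E x y z"
    using \<eta>3[OF x y z] \<open>0 \<le> \<eta>3 * E x y z\<close> unfolding sol2_def rhs0_eq by (smt (verit))
  show ?thesis using 1 2 3 by (simp add: algebra_simps)
qed

lemma rhs_op_cong:
  assumes "\<And>z. z \<in> {a..b} \<Longrightarrow> u x y z = u' x y z \<and> p x y z = p' x y z \<and> q x y z = q' x y z" and "z \<in> {a..b}"
  shows "rhs_op u p q x y z = rhs_op u' p' q' x y z"
proof -
  have "integral {a..b} (\<lambda>\<xi>. G x y z \<xi> (u x y \<xi>) (p x y \<xi>) (q x y \<xi>)) =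
      integral {a..b} (\<lambda>\<xi>. G x y z \<xi> (u' x y \<xi>) (p' x y \<xi>) (q' x y \<xi>))"
    by (rule Henstock_Kurzweil_Integration.integral_cong) (simp add: assms(1))
  then show ?thesis using assms by (simp add: rhs_op_def)
qed

primrec picard :: "nat \<Rightarrow> real \<Rightarrow> real \<Rightarrow> real \<Rightarrow> real" where
  "picard 0 = rhs0"
| "picard (Suc n) = rhs_op (sol (picard n)) (sol1 (picard n)) (sol2 (picard n))"

lemma rd3_picard: "rd3 (picard n)"
  by (induction n) (simp_all add: rd3_rhs0 rd3_rhs_op rd3_sol rd3_sol1 rd3_sol2)

abbreviation "\<gamma> \<equiv> \<gamma>1 + \<gamma>2 + \<gamma>3"
abbreviation "\<eta> \<equiv> \<eta>1 + \<eta>2 + \<eta>3"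

lemma \<gamma>_ge_0: "0 \<le> \<gamma>" and \<eta>_ge_0: "0 \<le> \<eta>"
  using \<gamma>_nonneg \<eta>_nonneg by simp_all

text \<open>The start \<open>rhs0\<close> is the right-hand side at zero, so the first step compares
  the right-hand sides at \<open>sol rhs0\<close> and at \<open>0\<close>, whose distance is bounded
  by \<open>\<eta>\<close>. Every further round of \<open>sol_contraction\<close> and
  \<open>rhs_op_lipschitz\<close> gains a factor \<open>\<gamma>\<close>.\<close>

lemma picard_step:
  assumes "x \<in> X" "y \<in> Y" "z \<in> {a..b}"
  shows "\<bar>picard (Suc n) x y z - picard n x y z\<bar> \<le> (\<eta> * \<gamma> ^ n) * weight x y z"
  using assms
proof (induction n arbitrary: x y z)
  case 0
  show ?case
    unfolding picard.simps rhs0_def power_0 mult_1_right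
  proof (rule rhs_op_lipschitz)
    fix x y z assume "x \<in> X" "y \<in> Y" "z \<in> {a..b}"
    then show "\<bar>sol (rhs_op zero3 zero3 zero3) x y z - 0\<bar> + \<bar>sol1 (rhs_op zero3 zero3 zero3) x y z - 0\<bar>
        + \<bar>sol2 (rhs_op zero3 zero3 zero3) x y z - 0\<bar> \<le> \<eta> * E x y z"
      using sol_rhs0_bound[of x y z] by (simp add: rhs0_def)
  qed (use 0 rd3_rhs0 in \<open>simp_all add: rd3_sol rd3_sol1 rd3_sol2 rd_continuous2_const rhs0_def\<close>)
next
  case (Suc n)
  have "\<bar>rhs_op (sol (picard (Suc n))) (sol1 (picard (Suc n))) (sol2 (picard (Suc n))) x y z
      - rhs_op (sol (picard n)) (sol1 (picard n)) (sol2 (picard n)) x y z\<bar> \<le> (\<eta> * \<gamma> ^ Suc n) * weight x y z"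
  proof (rule rhs_op_lipschitz)
    fix x y z assume h: "x \<in> X" "y \<in> Y" "z \<in> {a..b}"
    have "\<bar>sol (picard (Suc n)) x y z - sol (picard n) x y z\<bar> + \<bar>sol1 (picard (Suc n)) x y z - sol1 (picard n) x y z\<bar>
        + \<bar>sol2 (picard (Suc n)) x y z - sol2 (picard n) x y z\<bar> \<le> (\<eta> * \<gamma> ^ n) * \<gamma> * E x y z"
      by (rule sol_contraction[OF rd3_picard rd3_picard _ Suc.IH h]) (use \<gamma>_ge_0 \<eta>_ge_0 in simp)
    then show "\<bar>sol (picard (Suc n)) x y z - sol (picard n) x y z\<bar> + \<bar>sol1 (picard (Suc n)) x y z - sol1 (picard n) x y z\<bar>
        + \<bar>sol2 (picard (Suc n)) x y z - sol2 (picard n) x y z\<bar> \<le> (\<eta> * \<gamma> ^ Suc n) * E x y z"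
      by (simp only: power_Suc mult_ac)
  qed (use Suc.prems in \<open>simp_all only: rd3_sol rd3_sol1 rd3_sol2 rd3_picard\<close>)
  then show ?case unfolding picard.simps(2) .
qed

lemma picard_sol_step:
  assumes "x \<in> X" "y \<in> Y" "z \<in> {a..b}"
  shows "\<bar>sol (picard (Suc n)) x y z - sol (picard n) x y z\<bar> + \<bar>sol1 (picard (Suc n)) x y z - sol1 (picard n) x y z\<bar>
    + \<bar>sol2 (picard (Suc n)) x y z - sol2 (picard n) x y z\<bar> \<le> (\<eta> * E x y z) * \<gamma> ^ n"
proof -
  have "\<bar>sol (picard (Suc n)) x y z - sol (picard n) x y z\<bar> + \<bar>sol1 (picard (Suc n)) x y z - sol1 (picard n) x y z\<bar>
    + \<bar>sol2 (picard (Suc n)) x y z - sol2 (picard n) x y z\<bar> \<le> (\<eta> * \<gamma> ^ n) * \<gamma> * E x y z"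
    by (rule sol_contraction[OF rd3_picard rd3_picard _ picard_step assms]) (use \<gamma>_ge_0 \<eta>_ge_0 in simp)
  \<comment> \<open>The spare factor \<open>\<gamma>\<close> is replaced by \<open>1\<close>, which
    leaves the form expected by \<open>geometric_cauchy_limit\<close>.\<close>
  also have "\<dots> \<le> (\<eta> * \<gamma> ^ n) * 1 * E x y z"
    using \<gamma>_ge_0 \<eta>_ge_0 \<gamma>_less_1 E_pos[OF assms] by (intro mult_right_mono mult_left_mono) auto
  finally show ?thesis by (simp add: mult_ac)
qed

text \<open>No limit is exchanged with a derivative. The limits \<open>u\<close>, \<open>p\<close>,
  \<open>q\<close> of the three sequences start as unrelated functions; \<open>f\<close> is the
  right-hand side formed from them, and the contraction estimate shows that \<open>sol f\<close>,
  \<open>sol1 f\<close>, \<open>sol2 f\<close> coincide with them.\<close>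

lemma sol_fixed_point_exists:
  "\<exists>f C. rd3 f \<and>
    (\<forall>x\<in>X. \<forall>y\<in>Y. \<forall>z\<in>{a..b}. f x y z = rhs_op (sol f) (sol1 f) (sol2 f) x y z) \<and>
    (\<forall>x\<in>X. \<forall>y\<in>Y. \<forall>z\<in>{a..b}. \<bar>sol f x y z\<bar> + \<bar>sol1 f x y z\<bar> + \<bar>sol2 f x y z\<bar> \<le> C * E x y z)"
proof -
  define u where "u x y z = lim (\<lambda>n. sol (picard n) x y z)" for x y z
  define p where "p x y z = lim (\<lambda>n. sol1 (picard n) x y z)" for x y z
  define q where "q x y z = lim (\<lambda>n. sol2 (picard n) x y z)" for x y z
  \<comment> \<open>The sum of the geometric series with first term \<open>\<eta>\<close> and ratio
    \<open>\<gamma>\<close>, in units of \<open>E\<close>.\<close>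
  define k where "k = \<eta> / (1 - \<gamma>)"
  have k: "0 \<le> k" using \<eta>_ge_0 \<gamma>_less_1 by (simp add: k_def)
  have near: "\<bar>sol (picard n) x y z - u x y z\<bar> \<le> (k * \<gamma> ^ n) * E x y z"
      "\<bar>sol1 (picard n) x y z - p x y z\<bar> \<le> (k * \<gamma> ^ n) * E x y z"
      "\<bar>sol2 (picard n) x y z - q x y z\<bar> \<le> (k * \<gamma> ^ n) * E x y z"
    if h: "x \<in> X" "y \<in> Y" "z \<in> {a..b}" for x y z n
  proof -
    have limit: "\<bar>c n - lim c\<bar> \<le> (k * \<gamma> ^ n) * E x y z"
      if "\<And>n. \<bar>c (Suc n) - c n\<bar> \<le> (\<eta> * E x y z) * \<gamma> ^ n" for c
      using geometric_cauchy_limit[OF \<gamma>_ge_0 \<gamma>_less_1 that, of n] by (simp add: k_def mult_ac)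
    have step: "\<bar>sol (picard (Suc n)) x y z - sol (picard n) x y z\<bar> \<le> (\<eta> * E x y z) * \<gamma> ^ n"
      "\<bar>sol1 (picard (Suc n)) x y z - sol1 (picard n) x y z\<bar> \<le> (\<eta> * E x y z) * \<gamma> ^ n"
      "\<bar>sol2 (picard (Suc n)) x y z - sol2 (picard n) x y z\<bar> \<le> (\<eta> * E x y z) * \<gamma> ^ n" for n
      using picard_sol_step[OF h, of n] by linarith+
    show "\<bar>sol (picard n) x y z - u x y z\<bar> \<le> (k * \<gamma> ^ n) * E x y z"
      unfolding u_def by (rule limit[of "\<lambda>n. sol (picard n) x y z", OF step(1)])
    show "\<bar>sol1 (picard n) x y z - p x y z\<bar> \<le> (k * \<gamma> ^ n) * E x y z"
      unfolding p_def by (rule limit[of "\<lambda>n. sol1 (picard n) x y z", OF step(2)])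
    show "\<bar>sol2 (picard n) x y z - q x y z\<bar> \<le> (k * \<gamma> ^ n) * E x y z"
      unfolding q_def by (rule limit[of "\<lambda>n. sol2 (picard n) x y z", OF step(3)])
  qed
  have "(\<lambda>n. k * \<gamma> ^ n) \<longlonglongrightarrow> k * 0"
    using \<gamma>_ge_0 \<gamma>_less_1 by (intro tendsto_mult tendsto_const LIMSEQ_power_zero) auto
  then have k0: "(\<lambda>n. k * \<gamma> ^ n) \<longlonglongrightarrow> 0" by simp
  have rd: "rd3 u" "rd3 p" "rd3 q"
    by (rule rd_continuous2_uniform_limit[OF rd3_sol[OF rd3_picard] E_rd k0 near(1)]
        rd_continuous2_uniform_limit[OF rd3_sol1[OF rd3_picard] E_rd k0 near(2)]
        rd_continuous2_uniform_limit[OF rd3_sol2[OF rd3_picard] E_rd k0 near(3)]; assumption)+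
  define f where "f = rhs_op u p q"
  have f: "rd3 f" unfolding f_def by (rule rd3_rhs_op[OF rd])
  \<comment> \<open>The factor \<open>3\<close> comes from adding the three separate bounds.\<close>
  have near3: "\<bar>u x y z - sol (picard n) x y z\<bar> + \<bar>p x y z - sol1 (picard n) x y z\<bar> + \<bar>q x y z - sol2 (picard n) x y z\<bar>
      \<le> (3 * k * \<gamma> ^ n) * E x y z" if h: "x \<in> X" "y \<in> Y" "z \<in> {a..b}" for x y z n
    using near[OF h, of n] by linarith
  have fn: "\<bar>f x y z - picard (Suc n) x y z\<bar> \<le> (3 * k * \<gamma> ^ n) * weight x y z"
    if h: "x \<in> X" "y \<in> Y" "z \<in> {a..b}" for x y z n
    unfolding f_def picard.simps
    by (rule rhs_op_lipschitz[OF rd rd3_sol rd3_sol1 rd3_sol2 near3 h]) (rule rd3_picard)+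
  \<comment> \<open>Both triples lie within a multiple of \<open>\<gamma> ^ n\<close> of the triple
    generated by \<open>picard (Suc n)\<close>: one by \<open>sol_contraction\<close>, the other as
    its limit. As \<open>n\<close> is arbitrary, their distance is \<open>0\<close>.\<close>
  have fixed: "\<bar>sol f x y z - u x y z\<bar> + \<bar>sol1 f x y z - p x y z\<bar> + \<bar>sol2 f x y z - q x y z\<bar> \<le> 0"
    if h: "x \<in> X" "y \<in> Y" "z \<in> {a..b}" for x y z
  proof (rule le_geometric_imp_le_zero[OF \<gamma>_ge_0 \<gamma>_less_1])
    fix n
    have "\<bar>sol f x y z - sol (picard (Suc n)) x y z\<bar> + \<bar>sol1 f x y z - sol1 (picard (Suc n)) x y z\<bar>
        + \<bar>sol2 f x y z - sol2 (picard (Suc n)) x y z\<bar> \<le> (3 * k * \<gamma> ^ n) * \<gamma> * E x y z"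
      by (rule sol_contraction[OF f rd3_picard _ fn h]) (use k \<gamma>_ge_0 in simp)
    then have step: "\<bar>sol f x y z - sol (picard (Suc n)) x y z\<bar> + \<bar>sol1 f x y z - sol1 (picard (Suc n)) x y z\<bar>
        + \<bar>sol2 f x y z - sol2 (picard (Suc n)) x y z\<bar> \<le> (3 * k * \<gamma> ^ Suc n) * E x y z"
      by (simp only: power_Suc mult_ac)
    have "\<bar>sol f x y z - u x y z\<bar> + \<bar>sol1 f x y z - p x y z\<bar> + \<bar>sol2 f x y z - q x y z\<bar>
        \<le> (3 * k * \<gamma> ^ Suc n) * E x y z + (3 * k * \<gamma> ^ Suc n) * E x y z"
      by (rule order_trans[OF abs_triangle3 add_mono[OF step near3[OF h, of "Suc n"]]])
    also have "\<dots> = (6 * k * \<gamma> * E x y z) * \<gamma> ^ n" by (simp only: power_Suc) (simp add: mult_ac)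
    finally show "\<bar>sol f x y z - u x y z\<bar> + \<bar>sol1 f x y z - p x y z\<bar> + \<bar>sol2 f x y z - q x y z\<bar>
        \<le> (6 * k * \<gamma> * E x y z) * \<gamma> ^ n" .
  qed
  have eq: "sol f x y z = u x y z \<and> sol1 f x y z = p x y z \<and> sol2 f x y z = q x y z"
    if h: "x \<in> X" "y \<in> Y" "z \<in> {a..b}" for x y z
    using fixed[OF h] by linarith
  have "f x y z = rhs_op (sol f) (sol1 f) (sol2 f) x y z" if h: "x \<in> X" "y \<in> Y" "z \<in> {a..b}" for x y z
    using rhs_op_cong[of "sol f" x y u "sol1 f" p "sol2 f" q z] eq h by (simp add: f_def)
  moreover have "\<bar>sol f x y z\<bar> + \<bar>sol1 f x y z\<bar> + \<bar>sol2 f x y z\<bar> \<le> (3 * k + \<eta>) * E x y z"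
    if h: "x \<in> X" "y \<in> Y" "z \<in> {a..b}" for x y z
  proof -
    \<comment> \<open>Taking \<open>n = 0\<close> transfers the \<open>\<eta>\<close> bound for
      \<open>rhs0\<close> to the limit; this growth bound is what later places \<open>sol f\<close>
      in \<open>S\<close>.\<close>
    have "\<bar>u x y z - sol rhs0 x y z\<bar> + \<bar>p x y z - sol1 rhs0 x y z\<bar> + \<bar>q x y z - sol2 rhs0 x y z\<bar>
        \<le> 3 * k * E x y z"
      using near3[OF h, of 0] by simp
    then have "\<bar>sol f x y z\<bar> + \<bar>sol1 f x y z\<bar> + \<bar>sol2 f x y z\<bar> \<le> 3 * k * E x y z + \<eta> * E x y z"
      using sol_rhs0_bound[OF h] eq[OF h] by linarith
    then show ?thesis by (simp add: distrib_right)
  qed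
  ultimately show ?thesis using f by blast
qed

section \<open>Solutions of the problem and fixed points\<close>

lemma rhs_op_pdelta:
  "rhs_op v (pdelta1 X v) (pdelta2 Y v) x y z =
    F x y z (v x y z) (pdelta1 X v x y z) (pdelta2 Y v x y z) (H_op X Y a b G v x y z)"
  by (simp add: rhs_op_def H_op_def)

lemma mem_S_space_iff:
  assumes "E = (\<lambda>x y z. e x y \<bar>z\<bar>)"
  shows "u \<in> S_space X Y {a..b} e \<longleftrightarrow> delta_differentiable X Y {a..b} u \<and> rd3 u \<and>
    rd3 (pdelta1 X u) \<and> rd3 (pdelta2 Y u) \<and>
    (\<exists>N\<ge>0. \<forall>x\<in>X. \<forall>y\<in>Y. \<forall>z\<in>{a..b}. W_abs X Y u x y z \<le> N * E x y z)"
  by (simp add: S_space_def assms)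

lemma solution_exists:
  assumes e: "E = (\<lambda>x y z. e x y \<bar>z\<bar>)"
  shows "\<exists>u \<in> S_space X Y {a..b} e. is_solution X Y a b x0 y0 F G \<alpha> \<beta> u"
proof -
  obtain f C where f: "rd3 f"
    and fixed: "\<And>x y z. x \<in> X \<Longrightarrow> y \<in> Y \<Longrightarrow> z \<in> {a..b} \<Longrightarrow> f x y z = rhs_op (sol f) (sol1 f) (sol2 f) x y z"
    and C: "\<And>x y z. x \<in> X \<Longrightarrow> y \<in> Y \<Longrightarrow> z \<in> {a..b} \<Longrightarrow>
      \<bar>sol f x y z\<bar> + \<bar>sol1 f x y z\<bar> + \<bar>sol2 f x y z\<bar> \<le> C * E x y z"
    using sol_fixed_point_exists by blast
  have diff: "delta_differentiable X Y {a..b} (sol f)"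
    unfolding delta_differentiable_def
    using has_delta_derivative_sol_x[OF f] has_delta_derivative_sol_y[OF f] by blast
  have "rd3 (pdelta1 X (sol f))"
    by (rule rd_continuous2_cong[OF rd3_sol1[OF f]]) (simp add: pdelta1_sol[OF f])
  moreover have "rd3 (pdelta2 Y (sol f))"
    by (rule rd_continuous2_cong[OF rd3_sol2[OF f]]) (simp add: pdelta2_sol[OF f])
  moreover have "\<exists>N\<ge>0. \<forall>x\<in>X. \<forall>y\<in>Y. \<forall>z\<in>{a..b}. W_abs X Y (sol f) x y z \<le> N * E x y z"
  proof (intro exI[of _ "\<bar>C\<bar>"] conjI ballI)
    fix x y z assume h: "x \<in> X" "y \<in> Y" "z \<in> {a..b}"
    have "W_abs X Y (sol f) x y z \<le> C * E x y z"
      using C[OF h] by (simp only: W_abs_def pdelta1_sol[OF f h(2,3)] pdelta2_sol[OF f h(1,3)])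
    also have "\<dots> \<le> \<bar>C\<bar> * E x y z" using E_pos[OF h] by (intro mult_right_mono) auto
    finally show "W_abs X Y (sol f) x y z \<le> \<bar>C\<bar> * E x y z" .
  qed simp
  ultimately have "sol f \<in> S_space X Y {a..b} e"
    using diff rd3_sol[OF f] by (simp add: mem_S_space_iff[OF e])
  moreover have "is_solution X Y a b x0 y0 F G \<alpha> \<beta> (sol f)"
  proof -
    have "F x y z (sol f x y z) (pdelta1 X (sol f) x y z) (pdelta2 Y (sol f) x y z) (H_op X Y a b G (sol f) x y z)
        = f x y z" if h: "x \<in> kappa X" "y \<in> kappa Y" "z \<in> {a..b}" for x y z
    proof -
      have xy: "x \<in> X" "y \<in> Y" using h kappa_subset by blast+
      show ?thesis
        unfolding rhs_op_pdelta[symmetric] fixed[OF xy h(3)]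
        by (rule rhs_op_cong) (use h xy pdelta1_sol[OF f] pdelta2_sol[OF f] in auto)
    qed
    then show ?thesis
      unfolding is_solution_def Let_def
      using diff rd3_sol[OF f] has_delta_derivative_sol1[OF f] has_delta_derivative_sol2[OF f] sol_boundary[OF f]
      by simp
  qed
  ultimately show ?thesis by blast
qed

text \<open>Both partial derivatives of \<open>v\<close> are recovered by integrating the mixed
  derivative \<open>f\<close> from the boundary. Then \<open>v\<close> and \<open>sol f\<close> have
  the same delta derivative in \<open>x\<close> and the same values at \<open>x0\<close>, so one
  more integration identifies them.\<close>

lemma solution_imp_fixed_point:
  assumes e: "E = (\<lambda>x y z. e x y \<bar>z\<bar>)" and S: "v \<in> S_space X Y {a..b} e" and v: "is_solution X Y a b x0 y0 F G \<alpha> \<beta> v"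
    and f: "f = rhs_op v (pdelta1 X v) (pdelta2 Y v)" and x: "x \<in> X" and y: "y \<in> Y" and z: "z \<in> {a..b}"
  shows "v x y z = sol f x y z" "pdelta1 X v x y z = sol1 f x y z" "pdelta2 Y v x y z = sol2 f x y z"
proof -
  have rdf: "rd3 f" using S unfolding f by (intro rd3_rhs_op) (auto simp: mem_S_space_iff[OF e])
  have d: "has_delta_derivative X (\<lambda>s. pdelta2 Y v s y z) (f x y z) x \<and>
      has_delta_derivative Y (\<lambda>t. pdelta1 X v x t z) (f x y z) y"
    if "x \<in> kappa X" "y \<in> kappa Y" for x y
    using v that z unfolding is_solution_def Let_def f rhs_op_pdelta by blast
  have bx: "v x y0 z = \<alpha> x z" if "x \<in> X" for x using v z that by (simp add: is_solution_def)
  have bY: "v x0 y z = \<beta> y z" if "y \<in> Y" for y using v z that by (simp add: is_solution_def)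
  have p: "pdelta1 X v x y z = sol1 f x y z" if "x \<in> X" for x
  proof (cases "x \<in> kappa X")
    case True
    have "delta_integral Y y0 y (\<lambda>t. f x t z) = pdelta1 X v x y z - pdelta1 X v x y0 z"
      by (rule delta_integral_eq[OF Y.closed Y.start y]) (use d True in blast)
    \<comment> \<open>A delta derivative depends only on the values on the scale, and on the line
      \<open>y = y0\<close> these are the values of \<open>\<alpha>\<close>.\<close>
    moreover have "pdelta1 X v x y0 z = delta_deriv X (\<lambda>s. \<alpha> s z) x"
      unfolding pdelta1_def by (rule delta_deriv_cong[OF X.closed bx])
    ultimately show ?thesis using True by (simp add: sol1_def)
  qed (simp add: sol1_def pdelta1_def delta_deriv_def)
  then show "pdelta1 X v x y z = sol1 f x y z" using x by simp
  show "pdelta2 Y v x y z = sol2 f x y z"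
  proof (cases "y \<in> kappa Y")
    case True
    have "delta_integral X x0 x (\<lambda>s. f s y z) = pdelta2 Y v x y z - pdelta2 Y v x0 y z"
      by (rule delta_integral_eq[OF X.closed X.start x]) (use d True in blast)
    moreover have "pdelta2 Y v x0 y z = delta_deriv Y (\<lambda>t. \<beta> t z) y"
      unfolding pdelta2_def by (rule delta_deriv_cong[OF Y.closed bY])
    ultimately show ?thesis using True by (simp add: sol2_def)
  qed (simp add: sol2_def pdelta2_def delta_deriv_def)
  have "has_delta_derivative X (\<lambda>s. v s y z) (sol1 f s y z) s" if s: "s \<in> kappa X" for s
  proof -
    have "s \<in> X" using s kappa_subset by blast
    have "\<exists>D. has_delta_derivative X (\<lambda>s. v s y z) D s"
      using v s y z by (auto simp: is_solution_def delta_differentiable_def)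
    then have "has_delta_derivative X (\<lambda>s. v s y z) (pdelta1 X v s y z) s"
      unfolding pdelta1_def by (rule has_delta_derivative_delta_deriv)
    then show ?thesis using p[OF \<open>s \<in> X\<close>] by simp
  qed
  from delta_integral_eq[OF X.closed X.start x this]
    delta_integral_eq[OF X.closed X.start x has_delta_derivative_sol_x[OF rdf _ y z]]
  have "v x y z - v x0 y z = sol f x y z - sol f x0 y z" by simp
  then show "v x y z = sol f x y z" using bY[OF y] sol_boundary(2)[OF rdf z y] by simp
qed

text \<open>Membership in \<open>S\<close> bounds the distance of two solutions by
  \<open>(A + B) * E\<close>. Since both are generated by their own right-hand sides, each round of
  the two estimates improves this bound by the factor \<open>\<gamma>\<close>, and the distance must
  vanish.\<close>

lemma solution_unique:
  assumes e: "E = (\<lambda>x y z. e x y \<bar>z\<bar>)" and S: "u \<in> S_space X Y {a..b} e" "v \<in> S_space X Y {a..b} e"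
    and sols: "is_solution X Y a b x0 y0 F G \<alpha> \<beta> u" "is_solution X Y a b x0 y0 F G \<alpha> \<beta> v"
    and h: "x \<in> X" "y \<in> Y" "z \<in> {a..b}"
  shows "v x y z = u x y z"
proof -
  let ?d = "\<lambda>x y z. \<bar>u x y z - v x y z\<bar> + \<bar>pdelta1 X u x y z - pdelta1 X v x y z\<bar> + \<bar>pdelta2 Y u x y z - pdelta2 Y v x y z\<bar>"
  obtain A where A: "A \<ge> 0" "\<And>x y z. x \<in> X \<Longrightarrow> y \<in> Y \<Longrightarrow> z \<in> {a..b} \<Longrightarrow> W_abs X Y u x y z \<le> A * E x y z"
    using S(1) by (auto simp: mem_S_space_iff[OF e])
  obtain B where B: "B \<ge> 0" "\<And>x y z. x \<in> X \<Longrightarrow> y \<in> Y \<Longrightarrow> z \<in> {a..b} \<Longrightarrow> W_abs X Y v x y z \<le> B * E x y z"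
    using S(2) by (auto simp: mem_S_space_iff[OF e])
  have rd: "rd3 u" "rd3 (pdelta1 X u)" "rd3 (pdelta2 Y u)" "rd3 v" "rd3 (pdelta1 X v)" "rd3 (pdelta2 Y v)"
    using S by (auto simp: mem_S_space_iff[OF e])
  define f where "f = rhs_op u (pdelta1 X u) (pdelta2 Y u)"
  define g where "g = rhs_op v (pdelta1 X v) (pdelta2 Y v)"
  have fg: "rd3 f" "rd3 g" unfolding f_def g_def by (intro rd3_rhs_op rd)+
  have "?d x y z \<le> ((A + B) * \<gamma> ^ n) * E x y z" if "x \<in> X" "y \<in> Y" "z \<in> {a..b}" for n x y z
    using that
  proof (induction n arbitrary: x y z)
    case 0
    then show ?case using A(2)[OF 0] B(2)[OF 0] by (simp add: W_abs_def distrib_right)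
  next
    case (Suc n)
    have "\<bar>f x y z - g x y z\<bar> \<le> ((A + B) * \<gamma> ^ n) * weight x y z"
      if "x \<in> X" "y \<in> Y" "z \<in> {a..b}" for x y z
      unfolding f_def g_def by (rule rhs_op_lipschitz[OF rd Suc.IH that])
    from sol_contraction[OF fg _ this Suc.prems]
    have "?d x y z \<le> (A + B) * \<gamma> ^ n * \<gamma> * E x y z"
      using A(1) B(1) \<gamma>_ge_0 solution_imp_fixed_point[OF e S(1) sols(1) f_def Suc.prems]
        solution_imp_fixed_point[OF e S(2) sols(2) g_def Suc.prems] by simp
    then show ?case by (simp add: mult_ac)
  qed
  from this[OF h] have "?d x y z \<le> ((A + B) * E x y z) * \<gamma> ^ n" for n
    by (simp add: mult_ac)
  then have "?d x y z \<le> 0" by (rule le_geometric_imp_le_zero[OF \<gamma>_ge_0 \<gamma>_less_1])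
  then show ?thesis by linarith
qed

end


theorem theorem1p1:
  fixes T1 T2 X Y :: "real set"
    and x0 y0 a b lam :: real
    and e :: "real \<Rightarrow> real \<Rightarrow> real \<Rightarrow> real \<Rightarrow> real"
    and F :: "real \<Rightarrow> real \<Rightarrow> real \<Rightarrow> real \<Rightarrow> real \<Rightarrow> real \<Rightarrow> real \<Rightarrow> real"
    and G :: "real \<Rightarrow> real \<Rightarrow> real \<Rightarrow> real \<Rightarrow> real \<Rightarrow> real \<Rightarrow> real \<Rightarrow> real"
    and \<alpha> \<beta> :: "real \<Rightarrow> real \<Rightarrow> real"
    and M :: "real \<Rightarrow> real \<Rightarrow> real \<Rightarrow> real"
    and K :: "real \<Rightarrow> real \<Rightarrow> real \<Rightarrow> real \<Rightarrow> real"
    and \<gamma>1 \<gamma>2 \<gamma>3 \<eta>1 \<eta>2 \<eta>3 :: real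
  assumes T1: "time_scale T1" "\<exists>p\<in>T1. \<exists>q\<in>T1. p \<noteq> q"
    and T2: "time_scale T2" "\<exists>p\<in>T2. \<exists>q\<in>T2. p \<noteq> q"
    and x0: "x0 \<in> T1" and y0: "y0 \<in> T2"
    and X: "X = {x\<in>T1. x0 \<le> x}"
    and Y: "Y = {y\<in>T2. y0 \<le> y}"
    and ab: "a < b"
    and lam: "lam > 0"
    and e_cont: "continuous_on {(x, y, \<bar>z\<bar>) |x y z. x \<in> X \<and> y \<in> Y \<and> z \<in> {a..b}}
                   (\<lambda>(x, y, r). e lam x y r)"
    and e_pos: "\<forall>x\<in>X. \<forall>y\<in>Y. \<forall>z\<in>{a..b}. 0 < e lam x y \<bar>z\<bar>"
    and F_rd: "rd_continuous2 X Y ({a..b} \<times> UNIV)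
                 (\<lambda>x y (z, u1, u2, u3, u4). F x y z u1 u2 u3 u4)"
    and G_rd: "rd_continuous2 X Y ({a..b} \<times> {a..b} \<times> UNIV)
                 (\<lambda>x y (z, q, u1, u2, u3). G x y z q u1 u2 u3)"
    and alpha_rd: "rd_continuous X {a..b} \<alpha>"
    and alpha_diff: "\<forall>x\<in>kappa X. \<forall>z\<in>{a..b}. \<exists>D. has_delta_derivative X (\<lambda>s. \<alpha> s z) D x"
    and alpha_deriv_rd: "rd_continuous X {a..b} (\<lambda>x z. delta_deriv X (\<lambda>s. \<alpha> s z) x)"
    and beta_rd: "rd_continuous Y {a..b} \<beta>"
    and beta_diff: "\<forall>y\<in>kappa Y. \<forall>z\<in>{a..b}. \<exists>D. has_delta_derivative Y (\<lambda>t. \<beta> t z) D y"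
    and beta_deriv_rd: "rd_continuous Y {a..b} (\<lambda>y z. delta_deriv Y (\<lambda>t. \<beta> t z) y)"
    and compat: "\<forall>z\<in>{a..b}. \<alpha> x0 z = \<beta> y0 z"
    and M_rd: "rd_continuous2 X Y {a..b} M"
    and M_nonneg: "\<forall>x\<in>X. \<forall>y\<in>Y. \<forall>z\<in>{a..b}. 0 \<le> M x y z"
    and K_rd: "rd_continuous2 X Y ({a..b} \<times> {a..b}) (\<lambda>x y (z, q). K x y z q)"
    and K_nonneg: "\<forall>x\<in>X. \<forall>y\<in>Y. \<forall>z\<in>{a..b}. \<forall>q\<in>{a..b}. 0 \<le> K x y z q"
    and F_lip: "\<forall>x\<in>X. \<forall>y\<in>Y. \<forall>z\<in>{a..b}. \<forall>u1 u2 u3 u4 v1 v2 v3 v4.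
        \<bar>F x y z u1 u2 u3 u4 - F x y z v1 v2 v3 v4\<bar>
          \<le> M x y z * (\<bar>u1 - v1\<bar> + \<bar>u2 - v2\<bar> + \<bar>u3 - v3\<bar> + \<bar>u4 - v4\<bar>)"
    and G_lip: "\<forall>x\<in>X. \<forall>y\<in>Y. \<forall>z\<in>{a..b}. \<forall>q\<in>{a..b}. \<forall>u1 u2 u3 v1 v2 v3.
        \<bar>G x y z q u1 u2 u3 - G x y z q v1 v2 v3\<bar>
          \<le> K x y z q * (\<bar>u1 - v1\<bar> + \<bar>u2 - v2\<bar> + \<bar>u3 - v3\<bar>)"
    and gamma_nonneg: "0 \<le> \<gamma>1" "0 \<le> \<gamma>2" "0 \<le> \<gamma>3"
    and gamma1: "\<forall>x\<in>X. \<forall>y\<in>Y. \<forall>z\<in>{a..b}.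
        delta_integral X x0 x (\<lambda>s. delta_integral Y y0 y (\<lambda>t.
          M s t z * (e lam s t \<bar>z\<bar> + integral {a..b} (\<lambda>q. K s t z q * e lam s t \<bar>q\<bar>))))
        \<le> \<gamma>1 * e lam x y \<bar>z\<bar>"
    and gamma2: "\<forall>x\<in>X. \<forall>y\<in>Y. \<forall>z\<in>{a..b}.
        delta_integral Y y0 y (\<lambda>t.
          M x t z * (e lam x t \<bar>z\<bar> + integral {a..b} (\<lambda>q. K x t z q * e lam x t \<bar>q\<bar>)))
        \<le> \<gamma>2 * e lam x y \<bar>z\<bar>"
    and gamma3: "\<forall>x\<in>X. \<forall>y\<in>Y. \<forall>z\<in>{a..b}.
        delta_integral X x0 x (\<lambda>s.
          M s y z * (e lam s y \<bar>z\<bar> + integral {a..b} (\<lambda>q. K s y z q * e lam s y \<bar>q\<bar>)))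
        \<le> \<gamma>3 * e lam x y \<bar>z\<bar>"
    and eta_nonneg: "0 \<le> \<eta>1" "0 \<le> \<eta>2" "0 \<le> \<eta>3"
    and eta1: "\<forall>x\<in>X. \<forall>y\<in>Y. \<forall>z\<in>{a..b}.
        \<bar>\<alpha> x z\<bar> + \<bar>\<beta> y z\<bar> + \<bar>\<alpha> x0 z\<bar>
        + delta_integral X x0 x (\<lambda>s. delta_integral Y y0 y (\<lambda>t.
            \<bar>F s t z 0 0 0 (H_op X Y a b G (\<lambda>_ _ _. 0) s t z)\<bar>))
        \<le> \<eta>1 * e lam x y \<bar>z\<bar>"
    and eta2: "\<forall>x\<in>X. \<forall>y\<in>Y. \<forall>z\<in>{a..b}.
        \<bar>delta_deriv X (\<lambda>s. \<alpha> s z) x\<bar>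
        + delta_integral Y y0 y (\<lambda>t.
            \<bar>F x t z 0 0 0 (H_op X Y a b G (\<lambda>_ _ _. 0) x t z)\<bar>)
        \<le> \<eta>2 * e lam x y \<bar>z\<bar>"
    and eta3: "\<forall>x\<in>X. \<forall>y\<in>Y. \<forall>z\<in>{a..b}.
        \<bar>delta_deriv Y (\<lambda>t. \<beta> t z) y\<bar>
        + delta_integral X x0 x (\<lambda>s.
            \<bar>F s y z 0 0 0 (H_op X Y a b G (\<lambda>_ _ _. 0) s y z)\<bar>)
        \<le> \<eta>3 * e lam x y \<bar>z\<bar>"
    and gamma_less_1: "\<gamma>1 + \<gamma>2 + \<gamma>3 < 1"
  shows "\<exists>u \<in> S_space X Y {a..b} (e lam).
           is_solution X Y a b x0 y0 F G \<alpha> \<beta> u \<and>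
           (\<forall>v \<in> S_space X Y {a..b} (e lam).
              is_solution X Y a b x0 y0 F G \<alpha> \<beta> v \<longrightarrow>
              (\<forall>x\<in>X. \<forall>y\<in>Y. \<forall>z\<in>{a..b}. v x y z = u x y z))"
proof -
  have X_ray: "time_scale_ray X x0"
  proof
    have "X = T1 \<inter> {x0..}" using X by auto
    then show "closed X" using T1 by (auto simp: time_scale_def)
  qed (use X x0 in auto)
  have Y_ray: "time_scale_ray Y y0"
  proof
    have "Y = T2 \<inter> {y0..}" using Y by auto
    then show "closed Y" using T2 by (auto simp: time_scale_def)
  qed (use Y y0 in auto)
  \<comment> \<open>Composition with the absolute value turns the weight, given as a continuous
    function of \<open>\<bar>z\<bar>\<close>, into a jointly continuous function of
    \<open>x\<close>, \<open>y\<close> and \<open>z\<close>.\<close>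
  have "continuous_on (X \<times> Y \<times> {a..b}) (\<lambda>p. (\<lambda>(x, y, r). e lam x y r) (fst p, fst (snd p), \<bar>snd (snd p)\<bar>))"
    by (rule continuous_on_compose2[OF e_cont]) (auto intro!: continuous_intros)
  then have e_rd: "rd_continuous2 X Y {a..b} (\<lambda>x y z. e lam x y \<bar>z\<bar>)"
    by (intro rd_continuous2_of_continuous) (simp add: case_prod_unfold)
  interpret darboux_problem X Y x0 y0 a b "\<lambda>x y z. e lam x y \<bar>z\<bar>" F G \<alpha> \<beta> M K \<gamma>1 \<gamma>2 \<gamma>3 \<eta>1 \<eta>2 \<eta>3
    by (intro darboux_problem.intro X_ray Y_ray, unfold_locales)
      (fact e_rd F_rd G_rd alpha_rd alpha_deriv_rd beta_rd beta_deriv_rd M_rd K_rd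
        gamma_nonneg eta_nonneg gamma_less_1 |
       rule e_pos[rule_format] alpha_diff[rule_format] beta_diff[rule_format] compat[rule_format]
        M_nonneg[rule_format] K_nonneg[rule_format] F_lip[rule_format] G_lip[rule_format]
        gamma1[rule_format] gamma2[rule_format] gamma3[rule_format]
        eta1[rule_format] eta2[rule_format] eta3[rule_format]; assumption)+
  from solution_exists[OF refl] obtain u where
    u: "u \<in> S_space X Y {a..b} (e lam)" "is_solution X Y a b x0 y0 F G \<alpha> \<beta> u" by blast
  show ?thesis
    using u solution_unique[OF refl u(1) _ u(2)] by blast
qed

end
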